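(* Let $X_k$ ($k\ge1$) and $X$ be non-degenerate $n$-connected planar domains containing $\infty$, with $X_k\to X$ in the sense of Carathéodory. Let $f_k$ be a Grunsky map on $X_k$ and $f$ a Grunsky map on $X$, and suppose $f_k\to f$ locally uniformly on $X$. Write $f=R\circ g$ and $f_k=R_k\circ g_k$, where $R,R_k$ are normalized $n$-good maps and $g:X\to R^{-1}(\mathbb{D})$, $g_k:X_k\to R_k^{-1}(\mathbb{D})$ are biholomorphisms tangent to the identity at infinity. Then $g_k\to g$ locally uniformly on $X$ and $R_k\to R$ uniformly on $\widehat{\mathbb{C}}$ in the spherical metric.
   Context: Non-degenerate $n$-connected: $\widehat{\mathbb{C}}\setminus X$ has exactly $n$ components, none a point. Carathéodory convergence: $\ker\{X_k\}$ is the largest domain $X\ni\infty$ such that every compact subset of $X$ lies in $X_k$ for all large $k$; $X_k\to X$ means $X$ is the kernel of every subsequence. A Grunsky map on $X$ is a proper holomorphic map $f:X\to\mathbb{D}$ of degree $n$ with $f(\infty)=0$. A rational map $R$ of degree $n$ is $n$-good if $R^{-1}(\mathbb{D})$ is connected and bounded by $n$ disjoint analytic Jordan curves; it is normalized if moreover $R(\infty)=0$ and its (simple) poles sum to $0$. A map $g$ is tangent to the identity at infinity if $g(\infty)=\infty$ and $g(z)/z\to1$ as $z\to\infty$. Known fact (Bell representation): for every Grunsky map $f$ on $X$ there is a unique normalized $n$-good $R$ and a unique biholomorphism $g:X\to R^{-1}(\mathbb{D})$ tangent to the identity at infinity with $f=R\circ g$. *)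

theory Defs
  imports "HOL-Analysis.Analysis" "HOL-Computational_Algebra.Computational_Algebra"
begin

text \<open>Points of the Riemann sphere are modelled as complex option, None being infinity.
  The topology and the (chordal) spherical metric are those induced by the
  inverse stereographic projection sp into the unit sphere of R^3.\<close>

definition sp :: "complex option \<Rightarrow> real \<times> real \<times> real" where
  "sp p = (case p of None \<Rightarrow> (0, 0, 1)
     | Some z \<Rightarrow> (2 * Re z / (1 + (cmod z)\<^sup>2), 2 * Im z / (1 + (cmod z)\<^sup>2),
                  ((cmod z)\<^sup>2 - 1) / (1 + (cmod z)\<^sup>2)))"

definition hat :: "complex set \<Rightarrow> complex option set" where
  "hat X = insert None (Some ` X)"

definition ext_fun :: "(complex \<Rightarrow> complex) \<Rightarrow> complex \<Rightarrow> complex option \<Rightarrow> complex" where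
  "ext_fun f c p = (case p of None \<Rightarrow> c | Some z \<Rightarrow> f z)"

definition ext_map :: "(complex \<Rightarrow> complex) \<Rightarrow> complex option \<Rightarrow> complex option" where
  "ext_map g p = (case p of None \<Rightarrow> None | Some z \<Rightarrow> Some (g z))"

definition domain_inf :: "complex set \<Rightarrow> bool" where
  "domain_inf X \<longleftrightarrow> openin (top_of_set (range sp)) (sp ` hat X) \<and> connected (sp ` hat X)"

text \<open>Non-degenerate n-connected: the complement (which lies in C) has exactly
  n components, none of which is a point.\<close>
definition nondeg_nconn_domain :: "nat \<Rightarrow> complex set \<Rightarrow> bool" where
  "nondeg_nconn_domain n X \<longleftrightarrow> domain_inf X \<and> card (components (- X)) = n
     \<and> finite (components (- X)) \<and> (\<forall>C\<in>components (- X). \<not> (\<exists>a. C = {a}))"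

definition kernel_cond :: "(nat \<Rightarrow> complex set) \<Rightarrow> complex set \<Rightarrow> bool" where
  "kernel_cond Xs Y \<longleftrightarrow> (\<forall>K. compact K \<and> K \<subseteq> sp ` hat Y \<longrightarrow>
       eventually (\<lambda>k. K \<subseteq> sp ` hat (Xs k)) sequentially)"

definition is_kernel :: "(nat \<Rightarrow> complex set) \<Rightarrow> complex set \<Rightarrow> bool" where
  "is_kernel Xs X \<longleftrightarrow> domain_inf X \<and> kernel_cond Xs X \<and>
     (\<forall>Y. domain_inf Y \<and> kernel_cond Xs Y \<longrightarrow> Y \<subseteq> X)"

definition cara_conv :: "(nat \<Rightarrow> complex set) \<Rightarrow> complex set \<Rightarrow> bool" where
  "cara_conv Xs X \<longleftrightarrow> (\<forall>r. strict_mono r \<longrightarrow> is_kernel (Xs \<circ> r) X)"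

definition inf_chart :: "(complex \<Rightarrow> complex) \<Rightarrow> complex \<Rightarrow> complex \<Rightarrow> complex" where
  "inf_chart f c w = (if w = 0 then c else f (1 / w))"

definition holo_at_inf :: "complex set \<Rightarrow> (complex \<Rightarrow> complex) \<Rightarrow> complex \<Rightarrow> bool" where
  "holo_at_inf X f c \<longleftrightarrow> (\<exists>r>0. (\<forall>w. 0 < cmod w \<and> cmod w < r \<longrightarrow> 1 / w \<in> X)
       \<and> inf_chart f c holomorphic_on ball 0 r)"

definition holo_mult :: "(complex \<Rightarrow> complex) \<Rightarrow> complex \<Rightarrow> nat" where
  "holo_mult h z = (LEAST k. 0 < k \<and> (deriv ^^ k) h z \<noteq> 0)"

definition grunsky :: "nat \<Rightarrow> complex set \<Rightarrow> (complex \<Rightarrow> complex) \<Rightarrow> bool" where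
  "grunsky n X f \<longleftrightarrow> domain_inf X \<and> f holomorphic_on X \<and> holo_at_inf X f 0
     \<and> (\<forall>z\<in>X. cmod (f z) < 1)
     \<and> (\<forall>K. compact K \<and> K \<subseteq> ball 0 1 \<longrightarrow>
            compact (sp ` {p \<in> hat X. ext_fun f 0 p \<in> K}))
     \<and> (\<forall>w\<in>ball 0 1. finite {z\<in>X. f z = w} \<and>
            (\<Sum>z\<in>{z\<in>X. f z = w}. holo_mult f z)
              + (if w = 0 then holo_mult (inf_chart f 0) 0 else 0) = n)"

text \<open>The rational map P/Q on the sphere (P, Q coprime, Q nonzero).\<close>
definition ratR :: "complex poly \<Rightarrow> complex poly \<Rightarrow> complex option \<Rightarrow> complex option" where
  "ratR P Q p = (case p of
       None \<Rightarrow> (if degree P < degree Q then Some 0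
                else if degree P = degree Q then Some (lead_coeff P / lead_coeff Q) else None)
     | Some z \<Rightarrow> (if poly Q z = 0 then None else Some (poly P z / poly Q z)))"

definition rat_map :: "nat \<Rightarrow> complex poly \<Rightarrow> complex poly \<Rightarrow> bool" where
  "rat_map n P Q \<longleftrightarrow> Q \<noteq> 0 \<and> coprime P Q \<and> max (degree P) (degree Q) = n"

definition rat_pre_disc :: "complex poly \<Rightarrow> complex poly \<Rightarrow> complex option set" where
  "rat_pre_disc P Q = {p. \<exists>w. ratR P Q p = Some w \<and> cmod w < 1}"

definition analytic_jordan :: "complex set \<Rightarrow> bool" where
  "analytic_jordan \<Gamma> \<longleftrightarrow> (\<exists>\<phi> r. 0 < r \<and> r < 1
      \<and> \<phi> holomorphic_on {z. r < cmod z \<and> cmod z < 1 / r}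
      \<and> inj_on \<phi> {z. r < cmod z \<and> cmod z < 1 / r}
      \<and> \<Gamma> = \<phi> ` sphere 0 1)"

definition n_good :: "nat \<Rightarrow> complex poly \<Rightarrow> complex poly \<Rightarrow> bool" where
  "n_good n P Q \<longleftrightarrow> rat_map n P Q
     \<and> connected (sp ` rat_pre_disc P Q)
     \<and> (\<exists>\<Gamma> :: nat \<Rightarrow> complex set.
          (\<forall>i<n. analytic_jordan (\<Gamma> i))
        \<and> (\<forall>i<n. \<forall>j<n. i \<noteq> j \<longrightarrow> \<Gamma> i \<inter> \<Gamma> j = {})
        \<and> closure (sp ` rat_pre_disc P Q) - sp ` rat_pre_disc P Q
            = (\<Union>i<n. sp ` Some ` \<Gamma> i))"

definition normalized_good :: "nat \<Rightarrow> complex poly \<Rightarrow> complex poly \<Rightarrow> bool" where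
  "normalized_good n P Q \<longleftrightarrow> n_good n P Q \<and> ratR P Q None = Some 0
     \<and> (\<forall>z. poly Q z = 0 \<longrightarrow> order z Q = 1)
     \<and> (\<Sum>z\<in>{z. poly Q z = 0}. z) = 0"

definition tangent_biholo :: "complex set \<Rightarrow> (complex \<Rightarrow> complex) \<Rightarrow> complex poly \<Rightarrow> complex poly \<Rightarrow> bool" where
  "tangent_biholo X g P Q \<longleftrightarrow>
       bij_betw (ext_map g) (hat X) (rat_pre_disc P Q)
     \<and> g holomorphic_on X
     \<and> holo_at_inf X (\<lambda>z. 1 / g z) 0
     \<and> ((\<lambda>z. g z / z) \<longlongrightarrow> 1) at_infinity"

definition factors :: "complex set \<Rightarrow> (complex \<Rightarrow> complex) \<Rightarrow> complex poly \<Rightarrow> complex poly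
     \<Rightarrow> (complex \<Rightarrow> complex) \<Rightarrow> bool" where
  "factors X f P Q g \<longleftrightarrow> (\<forall>p\<in>hat X. ratR P Q (ext_map g p) = Some (ext_fun f 0 p))"

definition loc_unif :: "complex set \<Rightarrow> (nat \<Rightarrow> complex \<Rightarrow> complex) \<Rightarrow> (complex \<Rightarrow> complex) \<Rightarrow> bool" where
  "loc_unif X fs f \<longleftrightarrow> (\<forall>K. compact K \<and> K \<subseteq> sp ` hat X \<longrightarrow>
      uniform_limit {z\<in>X. sp (Some z) \<in> K} fs f sequentially)"

definition loc_unif_sph :: "complex set \<Rightarrow> (nat \<Rightarrow> complex \<Rightarrow> complex) \<Rightarrow> (complex \<Rightarrow> complex) \<Rightarrow> bool" where
  "loc_unif_sph X gs g \<longleftrightarrow> (\<forall>K. compact K \<and> K \<subseteq> sp ` hat X \<longrightarrow>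
      uniform_limit (hat X \<inter> sp -` K) (\<lambda>k p. sp (ext_map (gs k) p)) (\<lambda>p. sp (ext_map g p)) sequentially)"

end

theory Submission
  imports Defs "HOL-Complex_Analysis.Complex_Analysis" "HOL-Library.Diagonal_Subsequence"
begin

text \<open>Scale all denominators to be monic. Schottky's theorem bounds the omitted values of a map
  univalent near infinity and tangent to the identity there; since the poles of \<open>R\<^sub>k\<close> are omitted by
  \<open>g\<^sub>k\<close> and have mean \<open>0\<close>, this bounds the poles, the coefficients of \<open>R\<^sub>k\<close> and the maps \<open>g\<^sub>k\<close> (locally).
  Along a subsequence the coefficients converge, to those of some \<open>R' = p'/q'\<close>, and \<open>g\<^sub>k\<close> converges to a
  univalent \<open>h\<close> with \<open>R' \<circ> h = f\<close>.

  It remains to see that \<open>\<phi> = h \<circ> g\<^sup>-\<^sup>1\<close> is the identity. The \<open>n\<close> Jordan curves bounding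
  \<open>R\<^sup>-\<^sup>1(D)\<close> enclose disjoint regions, each containing at least one of the \<open>n\<close> poles, so by counting
  preimages \<open>R\<close> is injective on each component of \<open>|R| > \<rho>\<close> for some \<open>\<rho> < 1\<close>. The images under \<open>\<phi>\<close> of
  the level curves \<open>|R| = r\<close>, \<open>r < 1\<close> close to \<open>1\<close>, show the same for \<open>R'\<close>. Hence \<open>R' \<circ> \<phi> = R\<close> lets \<open>\<phi>\<close>
  continue across each component by a branch of the inverse of \<open>R'\<close> composed with \<open>R\<close>; the
  extension is entire and tangent to the identity, so it is a translation, and the normalization of the
  poles makes it trivial.\<close>

section \<open>Univalent maps near infinity\<close>

text \<open>The obstacle is degeneration in the limit. The coefficients of \<open>R\<^sub>k\<close>
  converge, but \<open>p'\<close> and \<open>q'\<close> might acquire a common factor, poles might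
  merge, and nothing is known about the boundary of |R'| < 1, so uniqueness of the Bell
  representation cannot be quoted for \<open>R'\<close>. Coprimality, simple poles and the shape of
  the level sets of \<open>R'\<close> are instead recovered from the univalent map
  \<open>\<phi>\<close> by counting preimages, the degree bound being \<open>n\<close> on both
  sides. Levels r < 1 are used because \<open>\<phi>\<close> lives on the open set |R| < 1 and has
  no boundary values a priori. The normalization is carried to the limit as a vanishing coefficient
  of the denominator; a sum over distinct poles would not survive their merging. The estimates are
  uniform in \<open>k\<close> because they depend only on \<open>n\<close>, on one absolute constant
  and on one radius beyond which all the domains contain every point. Such a radius exists, after
  dropping finitely many terms, because a closed neighbourhood of infinity is compact on the sphere
  and kernel convergence applies to it.\<close>

lemma schlicht_omits_value:
  assumes hol: "F holomorphic_on ball 0 1" and inj: "inj_on F (ball 0 1)"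
    and F0: "F 0 = 0" and dF: "deriv F 0 = 1"
  obtains w where "cmod w \<le> 1" "w \<noteq> 0" "\<And>z. cmod z < 1 \<Longrightarrow> F z \<noteq> w"
proof -
  have "\<not> cball 0 1 \<subseteq> F ` ball 0 1"
  proof
    assume sub: "cball 0 1 \<subseteq> F ` ball 0 1"
    obtain k where k: "k holomorphic_on F ` ball 0 1"
      "\<And>z. z \<in> ball 0 1 \<Longrightarrow> deriv F z * deriv k (F z) = 1"
      "\<And>z. z \<in> ball 0 1 \<Longrightarrow> k (F z) = z"
      using holomorphic_has_inverse[OF hol open_ball inj] by blast
    have kb: "cmod (k z) < 1" "F (k z) = z" if "cmod z \<le> 1" for z
      using sub that k(3) by fastforce+
    have hk: "k holomorphic_on ball 0 1"
      using k(1) by (rule holomorphic_on_subset) (use sub in auto)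
    have k0: "k 0 = 0" and dk: "deriv k 0 = 1" using k(2,3)[of 0] F0 dF by auto
    obtain \<alpha> where \<alpha>: "\<And>z. cmod z < 1 \<Longrightarrow> k z = \<alpha> * z" "cmod \<alpha> = 1"
      using Schwarz_Lemma(3)[OF hk k0 _ , of 0] kb dk by fastforce
    \<comment> \<open>Schwarz makes \<open>k\<close> a rotation on the open disc only. The
      contradiction comes from the boundary point 1: its preimage \<open>u\<close> is in the open
      disc, and the rotation forces |F u| = |u| < 1.\<close>
    define u where "u = k 1"
    have u: "cmod u < 1" "F u = 1" using kb[of 1] by (auto simp: u_def)
    have "k (\<alpha> * u) = \<alpha> * (\<alpha> * u)" "k (u / \<alpha>) = u"
      using \<alpha> u by (auto simp: norm_mult norm_divide)
    hence "F u = u / \<alpha>" using kb(2)[of "u / \<alpha>"] \<alpha> u by (simp add: norm_divide)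
    hence "cmod (F u) < 1" using u \<alpha> by (simp add: norm_divide)
    thus False using u by simp
  qed
  then obtain w where w: "cmod w \<le> 1" "w \<notin> F ` ball 0 1" unfolding subset_iff mem_cball_0 by blast
  moreover have "w \<noteq> 0" using w F0 by force
  ultimately show ?thesis using that by force
qed

text \<open>Schottky's theorem is applied twice. If \<open>F\<close> omits \<open>w\<close>, the root \<open>s\<close> of \<open>1 - F/w\<close> with
  \<open>s 0 = -1\<close> omits \<open>0\<close> and \<open>1\<close>, which bounds \<open>F\<close>; then \<open>8C/m\<close> with \<open>m = F/z\<close> and \<open>|m| \<le> 4C\<close> omits
  \<open>0\<close> and \<open>1\<close> as well.\<close>

lemma schlicht_lower_bound:
  "\<exists>C>0. \<forall>F. F holomorphic_on ball 0 1 \<and> inj_on F (ball 0 1) \<and> F 0 = 0 \<and> deriv F 0 = 1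
      \<longrightarrow> (\<forall>z. cmod z = 1/8 \<longrightarrow> 1 \<le> C * cmod (F z))"
proof -
  \<comment> \<open>Schottky's bound on radius 1/2 for functions of modulus at most 1 at the centre;
    \<open>C2\<close> is the same bound with \<open>8 * C1\<close> at the centre.\<close>
  define C0 where "C0 = exp(pi * exp(pi * (2 + 2 * 1 + 12 * (1/2) / (1 - 1/2))))"
  define C1 where "C1 = 1 + C0^2"
  define C2 where "C2 = exp(pi * exp(pi * (2 + 2 * (8 * C1) + 12 * (1/2) / (1 - 1/2))))"
  have C1: "C1 > 0" by (simp add: C1_def add_pos_nonneg)
  have C2: "C2 > 0" by (simp add: C2_def)
  have main: "1 \<le> (C2 / C1) * cmod (F \<zeta>)"
    if hol: "F holomorphic_on ball 0 1" and inj: "inj_on F (ball 0 1)"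
      and F0: "F 0 = 0" and dF: "deriv F 0 = 1" and z: "cmod \<zeta> = 1/8" for F \<zeta>
  proof -
    obtain w where w: "cmod w \<le> 1" "w \<noteq> 0" "\<And>z. cmod z < 1 \<Longrightarrow> F z \<noteq> w"
      using schlicht_omits_value[OF hol inj F0 dF] by blast
    have "(\<lambda>z. 1 - F z / w) holomorphic_on ball 0 1"
      using hol w by (intro holomorphic_intros) auto
    moreover have "1 - F z / w \<noteq> 0" if "z \<in> ball 0 1" for z using w that by auto
    ultimately obtain s0 where s0: "s0 holomorphic_on ball 0 1"
        "\<And>z. z \<in> ball 0 1 \<Longrightarrow> 1 - F z / w = s0 z ^ 2"
      using contractible_imp_holomorphic_sqrt[of "\<lambda>z. 1 - F z / w" "ball 0 1"]
        convex_imp_contractible[OF convex_ball] by metis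
    define s where "s z = - s0 0 * s0 z" for z
    have s00: "s0 0 ^ 2 = 1" using s0(2)[of 0] F0 by simp
    have s: "s holomorphic_on ball 0 1" "\<And>z. z \<in> ball 0 1 \<Longrightarrow> 1 - F z / w = s z ^ 2" "s 0 = -1"
      using s0 s00 by (auto simp: s_def[abs_def] power_mult_distrib power2_eq_square intro!: holomorphic_intros)
    \<comment> \<open>The sign of \<open>s\<close> excludes the value 1: \<open>s z = 1\<close>
      gives \<open>F z = 0\<close>, hence \<open>z = 0\<close> by injectivity, but there
      \<open>s\<close> is -1.\<close>
    have s01: "s z \<noteq> 0 \<and> s z \<noteq> 1" if "cmod z < 1" for z
    proof (intro conjI notI)
      show False if "s z = 0" using s(2)[of z] w(2) w(3)[of z] that \<open>cmod z < 1\<close> by auto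
      assume "s z = 1"
      hence "F z = 0" using s(2)[of z] w(2) \<open>cmod z < 1\<close> by auto
      hence "z = 0" using inj F0 \<open>cmod z < 1\<close> by (metis inj_onD mem_ball_0 norm_zero zero_less_one)
      thus False using \<open>s z = 1\<close> s(3) by simp
    qed
    have sb: "cmod (s z) \<le> C0" if "cmod z \<le> 1/4" for z
    proof -
      have "(\<lambda>z. s (z/2)) holomorphic_on cball 0 1"
        by (rule holomorphic_on_compose_gen[OF _ s(1), unfolded o_def])
           (auto intro!: holomorphic_intros simp: norm_divide)
      from Schottky[OF this, of 1 "1/2" "2*z"] show ?thesis
        using s01 s(3) that by (auto simp: C0_def norm_mult norm_divide)
    qed
    have Fb: "cmod (F z) \<le> C1" if "cmod z \<le> 1/4" for z
    proof -
      have "F z = w * (1 - s z ^ 2)" using s(2)[of z] w(2) that by (simp add: field_simps)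
      hence "cmod (F z) \<le> 1 * cmod (1 - s z ^ 2)" unfolding norm_mult
        by (metis norm_mult mult_right_mono norm_ge_zero w(1))
      also have "\<dots> \<le> 1 + cmod (s z) ^ 2" by (metis mult_1 norm_one norm_power norm_triangle_ineq4)
      also have "\<dots> \<le> C1" using sb[OF that] by (simp add: C1_def power_mono)
      finally show ?thesis .
    qed
    define m where "m z = (if z = 0 then deriv F 0 else (F z - F 0) / (z - 0))" for z
    have m: "m holomorphic_on ball 0 1"
      using pole_theorem_open_0[OF hol, of 0 m] by (auto simp: m_def F0)
    have m0: "m 0 = 1" by (simp add: m_def dF)
    have mF: "F z = z * m z" for z by (simp add: m_def F0)
    have mnz: "m z \<noteq> 0" if "cmod z < 1" for z
    proof
      assume "m z = 0"
      hence "F z = F 0" by (simp add: mF)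
      hence "z = 0" using inj that by (metis inj_onD mem_ball_0 norm_zero zero_less_one)
      thus False using m0 \<open>m z = 0\<close> by simp
    qed
    have mb: "cmod (m z) \<le> 4 * C1" if "cmod z \<le> 1/4" for z
    proof (rule maximum_modulus_frontier[of m "cball 0 (1/4)"])
      show "m holomorphic_on interior (cball 0 (1/4))" by (rule holomorphic_on_subset[OF m]) auto
      show "continuous_on (closure (cball 0 (1/4))) m"
        by (rule continuous_on_subset[OF holomorphic_on_imp_continuous_on[OF m]]) auto
      fix u :: complex assume "u \<in> frontier (cball 0 (1/4))"
      hence u: "cmod u = 1/4" by simp
      have "cmod (F u) \<le> C1" by (rule Fb) (simp add: u)
      thus "cmod (m u) \<le> 4 * C1" by (simp add: mF norm_mult u)
    qed (use that in auto)
    have "cmod (8 * C1 / m \<zeta>) \<le> C2"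
    proof -
      \<comment> \<open>The rescaling by 1/4 is forced by the bound on \<open>m\<close>, which holds
        for |z| <= 1/4. Points of modulus 1/8 then sit at radius 1/2, the radius used in
        \<open>C2\<close>.\<close>
      have h: "(\<lambda>z. 8 * C1 / m (z/4)) holomorphic_on cball 0 1"
        by (intro holomorphic_intros holomorphic_on_compose_gen[OF _ m, unfolded o_def])
           (auto simp: norm_divide mnz)
      have "8 * C1 / m (z/4) \<noteq> 1" if "cmod z \<le> 1" for z
      proof
        assume "8 * C1 / m (z/4) = 1"
        hence "8 * C1 = m (z/4)" by (auto simp: divide_eq_eq split: if_splits)
        hence "cmod (m (z/4)) = 8 * C1" using C1 by (metis abs_of_pos norm_of_real mult_pos_pos zero_less_numeral)
        moreover have "cmod (m (z/4)) \<le> 4 * C1" by (rule mb) (use that in \<open>auto simp: norm_divide\<close>)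
        ultimately show False using C1 by simp
      qed
      with Schottky[OF h, of "8 * C1" "1/2" "4*\<zeta>"] show ?thesis
        using C1 m0 z mnz by (auto simp: C2_def norm_mult norm_divide)
    qed
    hence "8 * C1 / cmod (m \<zeta>) \<le> C2" using C1 by (simp add: norm_mult norm_divide)
    hence "8 * C1 \<le> C2 * cmod (m \<zeta>)" using mnz[of \<zeta>] z by (simp add: divide_le_eq)
    moreover have "cmod (m \<zeta>) = 8 * cmod (F \<zeta>)" by (simp add: mF norm_mult z)
    ultimately have "C1 \<le> C2 * cmod (F \<zeta>)" by simp
    thus ?thesis using C1 by (simp add: field_simps)
  qed
  show ?thesis
    by (rule exI[of _ "C2 / C1"]) (use main C1 C2 in auto)
qed

definition exterior_const :: real where
  "exterior_const = (SOME C. C > 0 \<and> (\<forall>F. F holomorphic_on ball 0 1 \<and> inj_on F (ball 0 1) \<and> F 0 = 0 \<and> deriv F 0 = 1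
      \<longrightarrow> (\<forall>z. cmod z = 1/8 \<longrightarrow> 1 \<le> C * cmod (F z))))"

lemma exterior_const_pos: "0 < exterior_const"
  and exterior_const_schlicht: "\<lbrakk>F holomorphic_on ball 0 1; inj_on F (ball 0 1); F 0 = 0; deriv F 0 = 1; cmod z = 1/8\<rbrakk>
      \<Longrightarrow> 1 \<le> exterior_const * cmod (F z)"
  using someI_ex[OF schlicht_lower_bound, folded exterior_const_def] by blast+

text \<open>The inversion \<open>F t = r / (G (r / t) - p)\<close> produces a normalized univalent
  function on the unit disc: omission of \<open>p\<close> makes it pole-free, and tangency to the
  identity gives derivative 1 at 0. The circle |z| = 8 r becomes |t| = 1/8, where the lower bound on
  \<open>F\<close> is the upper bound claimed.\<close>

lemma exterior_const_bound:
  assumes r: "0 < r" and G: "G holomorphic_on {z. r < cmod z}"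
    and inj: "inj_on G {z. r < cmod z}" and lim: "((\<lambda>z. G z / z) \<longlongrightarrow> 1) at_infinity"
    and p: "p \<notin> G ` {z. r < cmod z}" and z: "cmod z = 8 * r"
  shows "cmod (G z - p) \<le> exterior_const * r"
proof -
  define F where "F t = (if t = 0 then 0 else r / (G (of_real r / t) - p))" for t
  have big: "r < cmod (of_real r / t)" if "t \<noteq> 0" "cmod t < 1" for t :: complex
    using that r by (simp add: norm_divide field_simps)
  have nz: "G (of_real r / t) - p \<noteq> 0" if "t \<noteq> 0" "cmod t < 1" for t :: complex
    using p big[OF that] by (metis eq_iff_diff_eq_0 imageI mem_Collect_eq)
  have holF': "(\<lambda>t. r / (G (of_real r / t) - p)) holomorphic_on ball 0 1 - {0}"
    by (intro holomorphic_intros holomorphic_on_compose_gen[OF _ G, unfolded o_def])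
       (use big nz in auto)
  have "((\<lambda>z. G z / z - p / z) \<longlongrightarrow> 1 - 0) at_infinity"
    by (intro tendsto_diff lim tendsto_divide_0[OF tendsto_const] filterlim_ident)
  hence "((\<lambda>z. inverse (G z / z - p / z)) \<longlongrightarrow> inverse 1) at_infinity"
    by (intro tendsto_inverse) auto
  moreover have fl: "filterlim (\<lambda>t. of_real r / t) at_infinity (at (0::complex))"
    by (intro filterlim_divide_at_infinity[where c = "of_real r"] tendsto_const) 
       (use r in \<open>auto simp: filterlim_at eventually_at_filter\<close>)
  ultimately have "((\<lambda>t. inverse (G (of_real r / t) / (of_real r / t) - p / (of_real r / t))) \<longlongrightarrow> 1) (at (0::complex))"
    using filterlim_compose[of "\<lambda>z. inverse (G z / z - p / z)" "nhds 1" at_infinity "\<lambda>t. of_real r / t" "at 0"]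
    unfolding inverse_1 by blast
  moreover have "\<forall>\<^sub>F t in at (0::complex). inverse (G (of_real r / t) / (of_real r / t) - p / (of_real r / t)) = (F t - F 0) / (t - 0)"
    unfolding eventually_at_filter
    by (intro always_eventually allI impI) (simp add: F_def diff_divide_distrib[symmetric] right_diff_distrib[symmetric] mult.commute)
  ultimately have "((\<lambda>t. (F t - F 0) / (t - 0)) \<longlongrightarrow> 1) (at (0::complex))"
    using tendsto_cong by fast
  hence D: "(F has_field_derivative 1) (at 0)" by (simp add: has_field_derivative_iff)
  have "F holomorphic_on ball 0 1 - {0}"
    using holF' by (rule holomorphic_transform) (auto simp: F_def)
  moreover have "F field_differentiable at 0" using D by (auto simp: field_differentiable_def)
  ultimately have "F field_differentiable at t" if "t \<in> ball 0 1" for t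
    using that by (cases "t = 0") (auto intro!: holomorphic_on_imp_differentiable_at[of F "ball 0 1 - {0}"])
  hence holF: "F holomorphic_on ball 0 1"
    by (auto simp: holomorphic_on_def intro: field_differentiable_at_within)
  have injF: "inj_on F (ball 0 1)"
  proof (rule inj_onI)
    fix x y assume xy: "x \<in> ball (0::complex) 1" "y \<in> ball (0::complex) 1" "F x = F y"
    consider "x = 0" | "y = 0" | "x \<noteq> 0" "y \<noteq> 0" by blast
    thus "x = y"
    proof cases
      case 1 thus ?thesis using xy nz[of y] r by (auto simp: F_def split: if_splits)
    next
      case 2 thus ?thesis using xy nz[of x] r by (auto simp: F_def split: if_splits)
    next
      case 3
      hence "G (r / x) = G (r / y)" using xy nz[of x] nz[of y] r by (auto simp: F_def divide_simps)
      hence "r / x = r / y" by (rule inj_onD[OF inj]) (use big[of x] big[of y] 3 xy in auto)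
      thus ?thesis using 3 r by simp
    qed
  qed
  have z0: "z \<noteq> 0" using z r by auto
  have "1 \<le> exterior_const * cmod (F (r / z))"
    by (rule exterior_const_schlicht[OF holF injF _ DERIV_imp_deriv[OF D]])
       (use z r in \<open>auto simp: F_def norm_divide\<close>)
  hence "1 \<le> exterior_const * (r / cmod (G z - p))" using z0 r by (auto simp: F_def norm_divide)
  moreover have "r < cmod z" using z r by simp
  hence "G z - p \<noteq> 0" using p by auto
  ultimately show ?thesis by (simp add: field_simps)
qed

lemma not_bounded_if_exterior_subset:
  fixes S :: "complex set"
  assumes "\<And>z. b \<le> cmod z \<Longrightarrow> z \<in> S"
  shows "\<not> bounded S"
proof
  assume "bounded S"
  then obtain B where B: "\<And>z. z \<in> S \<Longrightarrow> cmod z \<le> B" by (auto simp: bounded_iff)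
  define w where "w = complex_of_real (max b (\<bar>B\<bar> + 1))"
  have cw: "cmod w = max b (\<bar>B\<bar> + 1)" unfolding w_def norm_of_real by simp
  have "cmod w \<le> B" by (intro B assms) (simp add: cw)
  thus False using cw by linarith
qed

text \<open>In the coordinate \<open>t = 1 / z\<close> growth o(z) is Riemann's criterion for a
  removable singularity at infinity, so the maximum principle holds on |t| <= 1/s. This suits
  differences of two maps tangent to the identity, which are known a priori only to be o(z).\<close>

lemma maximum_modulus_exterior:
  assumes u: "u holomorphic_on {z. r < cmod z}" and lim: "((\<lambda>z. u z / z) \<longlongrightarrow> 0) at_infinity"
    and r: "0 < r" "r < s" and bd: "\<And>z. cmod z = s \<Longrightarrow> cmod (u z) \<le> B" and z: "s \<le> cmod z"
  shows "cmod (u z) \<le> B"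
proof -
  have big: "r < cmod (1 / t)" if "t \<noteq> 0" "cmod t < 1 / r" for t :: complex
    using that r by (simp add: norm_divide field_simps)
  have "(\<lambda>t. u (1 / t)) holomorphic_on ball 0 (1/r) - {0}"
    by (intro holomorphic_intros holomorphic_on_compose_gen[OF _ u, unfolded o_def])
       (use big in auto)
  moreover have fl: "filterlim (\<lambda>t. 1 / t) at_infinity (at (0::complex))"
    by (intro filterlim_divide_at_infinity[where c = 1] tendsto_const)
         (auto simp: filterlim_at eventually_at_filter)
  have "((\<lambda>t. u (1/t) / (1/t)) \<longlongrightarrow> 0) (at (0::complex))"
    using filterlim_compose[OF lim fl] .
  hence "((\<lambda>t. (t - 0) * u (1/t)) \<longlongrightarrow> 0) (at (0::complex))"
    by (simp add: mult.commute)
  moreover have "0 \<in> interior (ball (0::complex) (1/r))" using r by simp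
  ultimately obtain v where v: "v holomorphic_on ball 0 (1/r)"
      "\<And>t. t \<in> ball 0 (1/r) - {0} \<Longrightarrow> v t = u (1/t)"
    using holomorphic_on_extend_lim[of "\<lambda>t. u (1/t)" "ball 0 (1/r)" 0] by metis
  have rs: "1 / s < 1 / r" using r by (simp add: frac_less2)
  have sub: "cball 0 (1/s) \<subseteq> ball (0::complex) (1/r)" using rs by (simp add: cball_subset_ball_iff)
  have "cmod (v (1/z)) \<le> B"
  proof (rule maximum_modulus_frontier[of v "cball 0 (1/s)"])
    show "v holomorphic_on interior (cball 0 (1/s))"
      by (rule holomorphic_on_subset[OF v(1)]) (use sub interior_subset in blast)
    show "continuous_on (closure (cball 0 (1/s))) v"
      by (rule continuous_on_subset[OF holomorphic_on_imp_continuous_on[OF v(1)]]) (use sub in simp)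
    fix t :: complex assume "t \<in> frontier (cball 0 (1/s))"
    hence t: "cmod t = 1/s" by simp
    hence "t \<in> ball 0 (1/r) - {0}" using rs r t by auto
    hence "v t = u (1/t)" by (rule v(2))
    thus "cmod (v t) \<le> B" using bd[of "1/t"] t r by (simp add: norm_divide)
  qed (use z r in \<open>auto simp: norm_divide frac_le\<close>)
  moreover have "1/z \<in> ball 0 (1/r) - {0}" using z r by (auto simp: norm_divide frac_less2)
  ultimately show ?thesis using v(2)[of "1/z"] by simp
qed

section \<open>Level sets of rational functions\<close>

text \<open>Level sets of |P/Q| with the denominator cleared, so that poles need no separate case: a
  root of \<open>Q\<close> is never in \<open>sublevel\<close> and, for coprime \<open>P\<close> and
  \<open>Q\<close>, always in \<open>superlevel\<close>. For r > 0, exchanging \<open>P\<close> and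
  \<open>Q\<close> replaces \<open>r\<close> by \<open>1/r\<close>.\<close>

definition sublevel :: "complex poly \<Rightarrow> complex poly \<Rightarrow> real \<Rightarrow> complex set" where
  "sublevel P Q r = {z. cmod (poly P z) < r * cmod (poly Q z)}"

definition superlevel :: "complex poly \<Rightarrow> complex poly \<Rightarrow> real \<Rightarrow> complex set" where
  "superlevel P Q r = {z. r * cmod (poly Q z) < cmod (poly P z)}"

definition level :: "complex poly \<Rightarrow> complex poly \<Rightarrow> real \<Rightarrow> complex set" where
  "level P Q r = {z. cmod (poly P z) = r * cmod (poly Q z)}"

lemma open_sublevel: "open (sublevel P Q r)"
  unfolding sublevel_def by (intro open_Collect_less continuous_intros)

lemma open_superlevel: "open (superlevel P Q r)"
  unfolding superlevel_def by (intro open_Collect_less continuous_intros)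

lemma closed_level_Un_superlevel: "closed (level P Q r \<union> superlevel P Q r)"
proof -
  have "level P Q r \<union> superlevel P Q r = {z. r * cmod (poly Q z) \<le> cmod (poly P z)}"
    by (auto simp: level_def superlevel_def)
  moreover have "closed {z. r * cmod (poly Q z) \<le> cmod (poly P z)}"
    by (intro closed_Collect_le continuous_intros)
  ultimately show ?thesis by simp
qed

lemma level_cases: "z \<in> sublevel P Q r \<or> z \<in> level P Q r \<or> z \<in> superlevel P Q r"
  by (auto simp: level_def superlevel_def sublevel_def)

lemma sublevel_superlevel_commute: "r > 0 \<Longrightarrow> sublevel P Q r = superlevel Q P (1/r)"
  by (auto simp: sublevel_def superlevel_def field_simps)

lemma level_commute: "r > 0 \<Longrightarrow> level P Q r = level Q P (1/r)"
  by (auto simp: level_def field_simps)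

text \<open>With \<open>a = r q / p\<close> and \<open>b = r w\<close> this is the classical |1 -
  cnj b a|^2 - |a - b|^2 = (1 - |a|^2)(1 - |b|^2), multiplied by |p|^2 so that it also covers p =
  0.\<close>

lemma cmod_Blaschke_identity:
  "(cmod (p - cnj w * of_real (r^2) * q))\<^sup>2 - r\<^sup>2 * (cmod (q - w * p))\<^sup>2
     = ((cmod p)\<^sup>2 - r\<^sup>2 * (cmod q)\<^sup>2) * (1 - r\<^sup>2 * (cmod w)\<^sup>2)"
  unfolding cmod_power2 by (simp add: power2_eq_square algebra_simps)

text \<open>The composition of \<open>rQ/P\<close> with the disc automorphism moving \<open>rw\<close> to \<open>0\<close> has modulus
  \<open>1\<close> on the frontier and less than \<open>1\<close> inside, so it must vanish somewhere.\<close>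

lemma superlevel_attains:
  assumes PQ: "coprime P Q" and U: "open U" "bounded U" "U \<noteq> {}" "U \<subseteq> superlevel P Q r"
    and fr: "frontier U \<subseteq> level P Q r" and r: "0 < r" "cmod w * r < 1"
  shows "\<exists>z\<in>U. poly Q z = w * poly P z"
proof (rule ccontr)
  assume "\<not> ?thesis"
  hence nU: "poly Q z - w * poly P z \<noteq> 0" if "z \<in> U" for z using that by auto
  have nfr: "poly Q z - w * poly P z \<noteq> 0" if "z \<in> frontier U" for z
  proof
    assume eq: "poly Q z - w * poly P z = 0"
    have l: "cmod (poly P z) = r * cmod (poly Q z)" using fr that by (auto simp: level_def)
    have "cmod (poly Q z) = cmod w * cmod (poly P z)" using eq by (simp flip: norm_mult)
    hence "cmod (poly Q z) * (1 - cmod w * r) = 0" using l by (simp add: algebra_simps)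
    hence "poly Q z = 0" using r by simp
    hence "poly P z = 0" using l by simp
    with \<open>poly Q z = 0\<close> show False using coprime_poly_0[OF PQ, of z] by auto
  qed
  have nz: "poly Q z - w * poly P z \<noteq> 0" if "z \<in> closure U" for z
    using that nU nfr by (auto simp: closure_Un_frontier)
  \<comment> \<open>\<open>F\<close> is \<open>r\<close> over the transformed function, holomorphic
    because \<open>w\<close> is assumed to be missed. It has modulus \<open>r\<close> on the
    frontier, hence at most \<open>r\<close> inside, while the identity makes it exceed
    \<open>r\<close> on the superlevel set.\<close>
  define F where "F z = (poly P z - cnj w * of_real (r^2) * poly Q z) / (poly Q z - w * poly P z)" for z
  have pos: "1 - r\<^sup>2 * (cmod w)\<^sup>2 > 0"
  proof -
    have "(cmod w * r)^2 < 1" using r by (intro power_less_one_iff[THEN iffD2]) auto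
    thus ?thesis by (simp add: power_mult_distrib mult.commute)
  qed
  obtain z where z: "z \<in> U" using U by auto
  have "cmod (F z) \<le> r"
  proof (rule maximum_modulus_frontier[of F U])
    show "F holomorphic_on interior U" unfolding F_def
      by (intro holomorphic_intros) (use nz interior_subset closure_subset in blast)
    show "continuous_on (closure U) F" unfolding F_def
      by (intro continuous_intros) (use nz in auto)
    fix z assume z: "z \<in> frontier U"
    hence l: "cmod (poly P z) = r * cmod (poly Q z)" using fr by (auto simp: level_def)
    have "(cmod (poly P z - cnj w * of_real (r^2) * poly Q z))\<^sup>2 = (r * cmod (poly Q z - w * poly P z))\<^sup>2"
      using cmod_Blaschke_identity[of "poly P z" w r "poly Q z"] l by (simp add: power_mult_distrib)
    hence "cmod (poly P z - cnj w * of_real (r^2) * poly Q z) = r * cmod (poly Q z - w * poly P z)"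
      using r by (simp add: power2_eq_iff_nonneg)
    thus "cmod (F z) \<le> r" using nfr[OF z] by (simp add: F_def norm_divide)
  qed (use U z in auto)
  hence "cmod (poly P z - cnj w * of_real (r^2) * poly Q z) \<le> r * cmod (poly Q z - w * poly P z)"
    using nU[OF z] by (simp add: F_def norm_divide divide_le_eq)
  hence "(cmod (poly P z - cnj w * of_real (r^2) * poly Q z))\<^sup>2 \<le> r\<^sup>2 * (cmod (poly Q z - w * poly P z))\<^sup>2"
    by (metis norm_ge_zero power_mono power_mult_distrib)
  hence "((cmod (poly P z))\<^sup>2 - r\<^sup>2 * (cmod (poly Q z))\<^sup>2) * (1 - r\<^sup>2 * (cmod w)\<^sup>2) \<le> 0"
    using cmod_Blaschke_identity[of "poly P z" w r "poly Q z"] by linarith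
  hence "(cmod (poly P z))\<^sup>2 \<le> (r * cmod (poly Q z))\<^sup>2"
    using pos by (simp add: mult_le_0_iff power_mult_distrib)
  hence "cmod (poly P z) \<le> r * cmod (poly Q z)"
    using r by (simp add: power2_le_iff_abs_le)
  thus False using z U by (auto simp: superlevel_def)
qed

lemma sublevel_contains_infinity:
  assumes "degree P < degree Q" "r > 0"
  obtains b where "b > 0" "\<And>z. b \<le> cmod z \<Longrightarrow> z \<in> sublevel P Q r"
proof -
  have "\<forall>\<^sub>F z in at_infinity. dist (poly P z / poly Q z) 0 < r"
    using poly_divide_tendsto_0_at_infinity[OF assms(1)] assms(2) by (auto dest: tendstoD)
  moreover have "filterlim (poly Q) at_infinity at_infinity"
    by (rule filterlim_poly_at_infinity) (use assms in auto)
  hence "\<forall>\<^sub>F z in at_infinity. poly Q z \<noteq> 0" 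
    by (auto simp: filterlim_at_infinity[of 0] dest!: spec[of _ 1] elim!: eventually_mono)
  ultimately have "\<forall>\<^sub>F z in at_infinity. z \<in> sublevel P Q r"
    by eventually_elim (auto simp: sublevel_def norm_divide divide_less_eq)
  then obtain b where b: "\<And>z. b \<le> cmod z \<Longrightarrow> z \<in> sublevel P Q r"
    unfolding eventually_at_infinity by auto
  show ?thesis by (rule that[of "max b 1"]) (use b in auto)
qed

lemma compact_level_Un_superlevel:
  assumes "degree P < degree Q" "r > 0"
  shows "compact (level P Q r \<union> superlevel P Q r)"
proof -
  obtain b where b: "\<And>z. b \<le> cmod z \<Longrightarrow> z \<in> sublevel P Q r"
    using sublevel_contains_infinity[OF assms] by blast
  have "level P Q r \<union> superlevel P Q r \<subseteq> ball 0 b"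
  proof
    fix z assume "z \<in> level P Q r \<union> superlevel P Q r"
    hence "z \<notin> sublevel P Q r" by (auto simp: level_def superlevel_def sublevel_def)
    with b[of z] show "z \<in> ball 0 b" by force
  qed
  thus ?thesis using closed_level_Un_superlevel bounded_subset[OF bounded_ball]
    by (auto simp: compact_eq_bounded_closed)
qed

text \<open>A level point away from the sublevel set would be a local maximum of |Q/P|. Then
  \<open>Q\<close> is a constant multiple of \<open>P\<close> on a disc, hence everywhere, against
  the degrees.\<close>

lemma level_subset_closure_sublevel:
  assumes PQ: "coprime P Q" "degree P < degree Q" and r: "r > 0"
  shows "level P Q r \<subseteq> closure (sublevel P Q r)"
proof
  fix z assume z: "z \<in> level P Q r"
  show "z \<in> closure (sublevel P Q r)"
  proof (rule ccontr)
    assume "z \<notin> closure (sublevel P Q r)"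
    then obtain e where e: "e > 0" "ball z e \<subseteq> - closure (sublevel P Q r)"
      using openE[of "- closure (sublevel P Q r)" z] by auto
    hence disj: "x \<notin> sublevel P Q r" if "x \<in> ball z e" for x
      using that closure_subset by blast
    have b: "r * cmod (poly Q x) \<le> cmod (poly P x)" if "x \<in> ball z e" for x
      using disj[OF that] by (simp add: sublevel_def)
    have nz: "poly P x \<noteq> 0" if "x \<in> ball z e" for x
      using b[OF that] r coprime_poly_0[OF PQ(1), of x] by (auto simp: mult_le_0_iff)
    have "(\<lambda>x. poly Q x / poly P x) constant_on ball z e"
    proof (rule maximum_modulus_principle[of _ _ "ball z e" z])
      show "(\<lambda>x. poly Q x / poly P x) holomorphic_on ball z e"
        using nz by (intro holomorphic_intros) auto
      fix x assume x: "x \<in> ball z e"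
      have "poly P z \<noteq> 0" using nz[of z] e by simp
      hence "cmod (poly Q z / poly P z) = 1 / r" using z r
        by (auto simp: level_def norm_divide divide_simps)
      moreover have "cmod (poly Q x / poly P x) \<le> 1 / r" using b[OF x] nz[OF x] r
        by (simp add: norm_divide divide_simps mult.commute)
      ultimately show "cmod (poly Q x / poly P x) \<le> cmod (poly Q z / poly P z)" by simp
    qed (use e in auto)
    then obtain c where c: "\<And>x. x \<in> ball z e \<Longrightarrow> poly Q x / poly P x = c"
      by (auto simp: constant_on_def)
    have "poly (Q - smult c P) x = 0" if "x \<in> ball z e" for x
      using c[OF that] nz[OF that] by (auto simp: field_simps)
    hence "ball z e \<subseteq> {x. poly (Q - smult c P) x = 0}" by auto
    moreover have "infinite (ball z e)" using uncountable_ball[OF e(1), of z] countable_finite by blast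
    ultimately have "Q - smult c P = 0" using poly_roots_finite finite_subset by blast
    hence "degree Q \<le> degree P" using degree_smult_le[of c P] by simp
    thus False using PQ(2) by simp
  qed
qed

lemma closed_superlevel_Un: "closure (superlevel P Q r) \<subseteq> level P Q r \<union> superlevel P Q r"
  using closed_level_Un_superlevel by (intro closure_minimal) auto

lemma card_roots_less_degree:
  assumes "degree P < degree Q" "cmod w < 1/r" "r > 0"
  shows "Q - smult w P \<noteq> 0" "degree (Q - smult w P) = degree Q"
    "finite {z. poly Q z = w * poly P z}" "card {z. poly Q z = w * poly P z} \<le> degree Q"
proof -
  show d: "degree (Q - smult w P) = degree Q"
    using assms(1) degree_smult_le[of w P] 
    using degree_add_eq_left[of "- smult w P" Q] by simp
  show n: "Q - smult w P \<noteq> 0" using d assms(1) by auto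
  have "{z. poly Q z = w * poly P z} = {z. poly (Q - smult w P) z = 0}" by auto
  thus "finite {z. poly Q z = w * poly P z}" "card {z. poly Q z = w * poly P z} \<le> degree Q"
    using poly_roots_finite[OF n] card_poly_roots_bound[OF n] d by auto
qed

lemma Jordan_image_sphere:
  fixes c :: "complex \<Rightarrow> complex"
  assumes "continuous_on (sphere 0 1) c" "inj_on c (sphere 0 1)"
  obtains p where "simple_path p" "pathfinish p = pathstart p" "path_image p = c ` sphere 0 1"
proof
  show "simple_path (c \<circ> circlepath 0 1)"
    using assms by (intro simple_path_continuous_image) (auto simp: simple_path_circlepath)
  show "pathfinish (c \<circ> circlepath 0 1) = pathstart (c \<circ> circlepath 0 1)"
    by (simp add: pathfinish_compose pathstart_compose)
  show "path_image (c \<circ> circlepath 0 1) = c ` sphere 0 1"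
    by (simp add: path_image_compose)
qed

lemma sublevel_mono: "s \<le> t \<Longrightarrow> sublevel P Q s \<subseteq> sublevel P Q t"
proof
  fix z assume "s \<le> t" "z \<in> sublevel P Q s"
  moreover have "s * cmod (poly Q z) \<le> t * cmod (poly Q z)" using \<open>s \<le> t\<close> by (intro mult_right_mono) auto
  ultimately show "z \<in> sublevel P Q t" by (simp add: sublevel_def)
qed

lemma superlevel_mono: "s \<le> t \<Longrightarrow> superlevel P Q t \<subseteq> superlevel P Q s"
proof
  fix z assume "s \<le> t" "z \<in> superlevel P Q t"
  moreover have "s * cmod (poly Q z) \<le> t * cmod (poly Q z)" using \<open>s \<le> t\<close> by (intro mult_right_mono) auto
  ultimately show "z \<in> superlevel P Q s" by (simp add: superlevel_def)
qed

lemma level_disjoint: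
  "sublevel P Q r \<inter> level P Q r = {}" "superlevel P Q r \<inter> level P Q r = {}"
  "sublevel P Q r \<inter> superlevel P Q r = {}"
  by (auto simp: level_def superlevel_def sublevel_def)

text \<open>The rest of the superlevel set is covered by an open set disjoint from \<open>U\<close>,
  so a frontier point of \<open>U\<close> cannot lie in the superlevel set. This supplies the
  frontier condition of \<open>superlevel_attains\<close>.\<close>

lemma frontier_subset_level:
  assumes U: "open U" "U \<subseteq> superlevel P Q r" and W: "open W" "U \<inter> W = {}" "superlevel P Q r \<subseteq> U \<union> W"
  shows "frontier U \<subseteq> level P Q r"
proof
  fix x assume "x \<in> frontier U"
  hence x: "x \<in> closure U" "x \<notin> U" using U(1) by (auto simp: frontier_def interior_open)
  have "x \<notin> W" using x(1) W(1,2) open_Int_closure_eq_empty[of W U] by blast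
  thus "x \<in> level P Q r" using x closure_mono[OF U(2)] closed_superlevel_Un[of P Q r] W(3) by blast
qed

text \<open>Each Jordan curve encloses a pole, and so would any component of the superlevel set lying
  outside all the curves; as there are only \<open>n\<close> poles, no such component exists.\<close>

lemma Jordan_pieces:
  fixes c :: "nat \<Rightarrow> complex \<Rightarrow> complex"
  assumes PQ: "coprime P Q" "degree P < degree Q" and r: "r > 0" and n: "n = degree Q"
    and c: "\<And>i. i < n \<Longrightarrow> continuous_on (sphere 0 1) (c i)" "\<And>i. i < n \<Longrightarrow> inj_on (c i) (sphere 0 1)"
    and disj: "\<And>i j. i < n \<Longrightarrow> j < n \<Longrightarrow> i \<noteq> j \<Longrightarrow> c i ` sphere 0 1 \<inter> c j ` sphere 0 1 = {}"
    and lev: "level P Q r = (\<Union>i<n. c i ` sphere 0 1)"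
    and E: "connected E" "E \<subseteq> sublevel P Q r" "sublevel P Q r \<subseteq> closure E"
  obtains K where "\<And>i. i < n \<Longrightarrow> compact (K i)" "\<And>i. i < n \<Longrightarrow> \<exists>z\<in>K i. poly Q z = 0"
    "disjoint_family_on K {..<n}" "level P Q r \<union> superlevel P Q r = (\<Union>i<n. K i)"
proof -
  define \<Gamma> where "\<Gamma> i = c i ` sphere 0 1" for i
  define I where "I i = inside (\<Gamma> i)" for i
  have \<Gamma>l: "\<Gamma> i \<subseteq> level P Q r" if "i < n" for i using lev that by (auto simp: \<Gamma>_def)
  have J: "I i \<noteq> {} \<and> open (I i) \<and> connected (I i) \<and> open (outside (\<Gamma> i)) \<and> bounded (I i) \<and>
      I i \<inter> outside (\<Gamma> i) = {} \<and> I i \<union> outside (\<Gamma> i) = - \<Gamma> i \<and> frontier (I i) = \<Gamma> i"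
    if i: "i < n" for i
  proof -
    obtain p where p: "simple_path p" "pathfinish p = pathstart p" "path_image p = \<Gamma> i"
      using Jordan_image_sphere[OF c(1)[OF i] c(2)[OF i]] unfolding \<Gamma>_def by metis
    show ?thesis using Jordan_inside_outside[OF p(1,2)] unfolding p(3) I_def by blast
  qed
  have nbE: "\<not> bounded E"
  proof
    assume "bounded E"
    hence "bounded (sublevel P Q r)" using E(3) bounded_subset bounded_closure by blast
    moreover obtain b where "\<And>z. b \<le> cmod z \<Longrightarrow> z \<in> sublevel P Q r"
      using sublevel_contains_infinity[OF PQ(2) r] by blast
    ultimately show False using not_bounded_if_exterior_subset by blast
  qed
  have levcl: "level P Q r \<subseteq> closure E"
    using level_subset_closure_sublevel[OF PQ r] E(3) closure_minimal[OF E(3)] by blast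
  \<comment> \<open>The connected set \<open>E\<close> is unbounded and misses the curve, so it
    stays outside. Its closure contains the sublevel and level sets, which leaves only superlevel
    points inside. \<open>E\<close> stands in for the sublevel set because for \<open>P'/Q'\<close>
    only a dense connected part is at hand, an image under \<open>\<phi>\<close>.\<close>
  have Isub: "I i \<subseteq> superlevel P Q r" if i: "i < n" for i
  proof -
    have E\<Gamma>: "E \<inter> \<Gamma> i = {}" using E(2) \<Gamma>l[OF i] level_disjoint(1)[of P Q r] by blast
    have "bounded (I i)" using J[OF i] by blast
    then obtain x where x: "x \<in> E" "x \<notin> I i" using nbE bounded_subset[of "I i" E] by blast
    have "E \<inter> I i = {}"
    proof (rule ccontr)
      assume "E \<inter> I i \<noteq> {}"
      moreover have "E \<inter> outside (\<Gamma> i) \<noteq> {}" using x E\<Gamma> J[OF i] by blast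
      moreover have "E \<subseteq> I i \<union> outside (\<Gamma> i)" using E\<Gamma> J[OF i] by blast
      ultimately show False using connectedD[OF E(1), of "I i" "outside (\<Gamma> i)"] J[OF i] by blast
    qed
    hence "closure E \<inter> I i = {}" using J[OF i] open_Int_closure_eq_empty[of "I i" E] by blast
    thus ?thesis using levcl E(3) level_cases[of _ P Q r] by blast
  qed
  have root: "\<exists>z\<in>U. poly Q z = 0"
    if "open U" "bounded U" "U \<noteq> {}" "U \<subseteq> superlevel P Q r" "frontier U \<subseteq> level P Q r" for U
    using superlevel_attains[OF PQ(1) that r, of 0] by simp
  have Iroot: "\<exists>z\<in>I i. poly Q z = 0" if i: "i < n" for i
    using root[of "I i"] J[OF i] Isub[OF i] \<Gamma>l[OF i] by auto
  \<comment> \<open>The regions avoid all the curves, so two that meet contain each other; equal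
    regions would have the same frontier curve.\<close>
  have Idisj: "I i \<inter> I j = {}" if ij: "i < n" "j < n" "i \<noteq> j" for i j
  proof (rule ccontr)
    assume ne: "I i \<inter> I j \<noteq> {}"
    have sub: "I a \<subseteq> I b" if "a < n" "b < n" "I a \<inter> I b \<noteq> {}" for a b
    proof (rule ccontr)
      assume "\<not> I a \<subseteq> I b"
      moreover have "I a \<inter> \<Gamma> b = {}"
        using Isub[OF that(1)] \<Gamma>l[OF that(2)] level_disjoint(2)[of P Q r] by blast
      ultimately have "I a \<inter> frontier (I b) \<noteq> {}"
        using connected_Int_frontier[of "I a" "I b"] J[OF that(1)] that(3) by blast
      thus False using J[OF that(2)] \<open>I a \<inter> \<Gamma> b = {}\<close> by blast
    qed
    have "I i = I j" using sub[of i j] sub[of j i] ne ij by blast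
    hence "\<Gamma> i = \<Gamma> j" using J[OF ij(1)] J[OF ij(2)] by metis
    moreover have "\<Gamma> i \<noteq> {}" by (simp add: \<Gamma>_def)
    ultimately show False using disj[OF ij] by (simp add: \<Gamma>_def)
  qed
  define U where "U = superlevel P Q r \<inter> (\<Inter>i<n. outside (\<Gamma> i))"
  have "U = {}"
  proof (rule ccontr)
    assume ne: "U \<noteq> {}"
    have opU: "open U" unfolding U_def using J by (intro open_Int open_superlevel open_INT) auto
    have "bounded U"
      by (rule bounded_subset[OF compact_imp_bounded[OF compact_level_Un_superlevel[OF PQ(2) r]]])
         (auto simp: U_def)
    moreover have "frontier U \<subseteq> level P Q r"
    proof (rule frontier_subset_level[OF opU])
      show "U \<subseteq> superlevel P Q r" by (simp add: U_def)
      show "open (\<Union>i<n. I i)" using J by (intro open_UN) auto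
      have "I i \<inter> U = {}" if "i < n" for i using J[OF that] that by (auto simp: U_def)
      thus "U \<inter> (\<Union>i<n. I i) = {}" by blast
      show "superlevel P Q r \<subseteq> U \<union> (\<Union>i<n. I i)"
      proof
        fix x assume x: "x \<in> superlevel P Q r"
        hence "x \<notin> \<Gamma> i" if "i < n" for i using \<Gamma>l[OF that] level_disjoint(2)[of P Q r] by blast
        hence "x \<in> I i \<or> x \<in> outside (\<Gamma> i)" if "i < n" for i using J[OF that] that by blast
        thus "x \<in> U \<union> (\<Union>i<n. I i)" using x by (auto simp: U_def)
      qed
    qed
    ultimately obtain z0 where z0: "z0 \<in> U" "poly Q z0 = 0"
      using root[OF opU _ ne] by (auto simp: U_def)
    obtain p where p: "\<And>i. i < n \<Longrightarrow> p i \<in> I i \<and> poly Q (p i) = 0" using Iroot by metis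
    have inj: "inj_on p {..<n}" using p Idisj by (intro inj_onI) (metis IntI empty_iff lessThan_iff)
    have "z0 \<notin> p ` {..<n}" using z0 p J by (fastforce simp: U_def)
    hence "card (insert z0 (p ` {..<n})) = Suc n" by (simp add: card_image[OF inj])
    moreover have "insert z0 (p ` {..<n}) \<subseteq> {z. poly Q z = 0}" using z0 p by auto
    moreover have "Q \<noteq> 0" using PQ by auto
    ultimately have "Suc n \<le> degree Q"
      by (metis card_mono card_poly_roots_bound le_trans poly_roots_finite)
    thus False using n by simp
  qed
  show thesis
  proof (rule that[of "\<lambda>i. I i \<union> \<Gamma> i"])
    fix i assume i: "i < n"
    have "I i \<union> \<Gamma> i = closure (I i)" using J[OF i] by (metis closure_Un_frontier)
    thus "compact (I i \<union> \<Gamma> i)" using J[OF i] by (metis compact_closure)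
    show "\<exists>z\<in>I i \<union> \<Gamma> i. poly Q z = 0" using Iroot[OF i] by blast
  next
    have "I i \<inter> \<Gamma> j = {}" if "i < n" "j < n" for i j
      using Isub[OF that(1)] \<Gamma>l[OF that(2)] level_disjoint(2)[of P Q r] by blast
    thus "disjoint_family_on (\<lambda>i. I i \<union> \<Gamma> i) {..<n}"
      using Idisj disj unfolding disjoint_family_on_def \<Gamma>_def[symmetric] by blast
  next
    have "superlevel P Q r \<subseteq> (\<Union>i<n. I i \<union> \<Gamma> i)"
    proof
      fix x assume "x \<in> superlevel P Q r"
      then obtain i where "i < n" "x \<notin> outside (\<Gamma> i)" using \<open>U = {}\<close> by (auto simp: U_def)
      thus "x \<in> (\<Union>i<n. I i \<union> \<Gamma> i)" using J[of i] by blast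
    qed
    moreover have "level P Q r = (\<Union>i<n. \<Gamma> i)" using lev by (simp add: \<Gamma>_def)
    ultimately show "level P Q r \<union> superlevel P Q r = (\<Union>i<n. I i \<union> \<Gamma> i)"
      using Isub by blast
  qed
qed

section \<open>Inverse branches near the poles\<close>

text \<open>Equivalently, \<open>Q / P\<close> maps each \<open>D i\<close> bijectively onto the
  disc of radius \<open>1 / \<rho>\<close>. The reciprocal of the rational function is used so that
  poles become ordinary points, with value 0.\<close>

definition branched :: "nat \<Rightarrow> complex poly \<Rightarrow> complex poly \<Rightarrow> real \<Rightarrow> (nat \<Rightarrow> complex set) \<Rightarrow> bool" where
  "branched n P Q \<rho> D \<longleftrightarrow> 0 < \<rho> \<and> (\<forall>i<n. open (D i)) \<and> disjoint_family_on D {..<n}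
     \<and> (\<Union>i<n. D i) = superlevel P Q \<rho>
     \<and> (\<forall>i<n. \<forall>w. cmod w < 1 / \<rho> \<longrightarrow> (\<exists>!z. z \<in> D i \<and> poly Q z = w * poly P z))"

text \<open>The neighbourhoods are the open Voronoi cells of the \<open>K i\<close>.\<close>

lemma disjoint_closed_neighbourhoods:
  fixes K :: "nat \<Rightarrow> complex set"
  assumes K: "\<And>i. i < n \<Longrightarrow> closed (K i)" "\<And>i. i < n \<Longrightarrow> K i \<noteq> {}" "disjoint_family_on K {..<n}"
  obtains V where "\<And>i. i < n \<Longrightarrow> open (V i)" "\<And>i. i < n \<Longrightarrow> K i \<subseteq> V i" "disjoint_family_on V {..<n}"
proof
  define V where "V i = (\<Inter>j\<in>{..<n} - {i}. {x. infdist x (K i) < infdist x (K j)})" for i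
  show "open (V i)" for i unfolding V_def by (intro open_INT ballI open_Collect_less continuous_intros) auto
  show "K i \<subseteq> V i" if i: "i < n" for i
  proof
    fix x assume x: "x \<in> K i"
    have "0 < infdist x (K j)" if j: "j < n" "j \<noteq> i" for j
    proof -
      have "x \<notin> K j" using x K(3) i j by (auto simp: disjoint_family_on_def)
      thus ?thesis using K(1,2)[OF j(1)] by (simp add: infdist_pos_not_in_closed)
    qed
    thus "x \<in> V i" using x by (simp add: V_def)
  qed
  show "disjoint_family_on V {..<n}"
    unfolding disjoint_family_on_def
  proof (intro ballI impI equals0I)
    fix i j x assume "i \<in> {..<n}" "j \<in> {..<n}" "i \<noteq> j" "x \<in> V i \<inter> V j"
    hence "infdist x (K i) < infdist x (K j)" "infdist x (K j) < infdist x (K i)" by (auto simp: V_def)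
    thus False by simp
  qed
qed

text \<open>By compactness the superlevel set stays in disjoint neighbourhoods of the
  \<open>K i\<close> when the level drops slightly below \<open>r\<close>. Each piece then has its
  frontier on the level set and so attains every admissible value; with \<open>n\<close> pieces and
  degree \<open>n\<close>, it does so exactly once.\<close>

lemma exists_branched:
  assumes PQ: "coprime P Q" "degree P < degree Q" and r: "r > 0" and n: "n = degree Q"
    and K: "\<And>i. i < n \<Longrightarrow> compact (K i)" "\<And>i. i < n \<Longrightarrow> \<exists>z\<in>K i. poly Q z = 0"
      "disjoint_family_on K {..<n}" "level P Q r \<union> superlevel P Q r = (\<Union>i<n. K i)"
  obtains \<rho> D where "\<rho> < r" "branched n P Q \<rho> D"
proof -
  have cl: "closed (K i)" "K i \<noteq> {}" if "i < n" for i
    using K(1,2)[OF that] by (auto intro: compact_imp_closed)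
  obtain V where V: "\<And>i. i < n \<Longrightarrow> open (V i)" "\<And>i. i < n \<Longrightarrow> K i \<subseteq> V i" "disjoint_family_on V {..<n}"
    using disjoint_closed_neighbourhoods[OF cl K(3)] by blast
  define W where "W = (\<Union>i<n. V i)"
  have oW: "open W" unfolding W_def using V(1) by auto
  \<comment> \<open>What the neighbourhoods fail to catch at level \<open>r/2\<close>; this cut-off
    makes \<open>A\<close> compact. On \<open>A\<close> the modulus of P/Q is below
    \<open>r\<close>, so its maximum is too.\<close>
  define A where "A = (level P Q (r/2) \<union> superlevel P Q (r/2)) - W"
  have cA: "compact A" unfolding A_def
    using compact_level_Un_superlevel[OF PQ(2), of "r/2"] r oW by (intro compact_diff) auto
  have nzA: "poly P z \<noteq> 0" if "z \<in> A" for z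
  proof
    assume 0: "poly P z = 0"
    have "r/2 * cmod (poly Q z) \<le> cmod (poly P z)" using that by (auto simp: A_def level_def superlevel_def)
    hence "poly Q z = 0" using r 0 by (simp add: mult_le_0_iff)
    with 0 show False using coprime_poly_0[OF PQ(1), of z] by blast
  qed
  have lt: "cmod (poly P z) < r * cmod (poly Q z)" if "z \<in> A" for z
  proof -
    have "z \<notin> (\<Union>i<n. K i)" using that V(2) by (auto simp: A_def W_def)
    hence "z \<in> sublevel P Q r" using K(4) level_cases[of z P Q r] by blast
    thus ?thesis by (simp add: sublevel_def)
  qed
  obtain \<rho> where \<rho>: "r/2 \<le> \<rho>" "\<rho> < r" "superlevel P Q \<rho> \<union> level P Q \<rho> \<subseteq> W"
  proof (cases "A = {}")
    case True
    thus ?thesis by (intro that[of "r/2"]) (use r in \<open>auto simp: A_def\<close>)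
  next
    case False
    have "continuous_on A (\<lambda>z. cmod (poly Q z / poly P z))"
      using nzA by (intro continuous_intros) auto
    then obtain a where a: "a \<in> A" "\<And>z. z \<in> A \<Longrightarrow> cmod (poly Q a / poly P a) \<le> cmod (poly Q z / poly P z)"
      using continuous_attains_inf[OF cA False] by blast
    define v where "v = cmod (poly Q a / poly P a)"
    have v: "1 / r < v" using lt[OF a(1)] nzA[OF a(1)] r by (simp add: v_def norm_divide divide_simps mult.commute)
    hence v0: "v > 0" using r by (meson less_trans zero_less_divide_1_iff)
    have v1: "1 / v < r" using v v0 r by (simp add: divide_simps mult.commute)
    \<comment> \<open>\<open>1 / v\<close> is the maximum of |P/Q| on \<open>A\<close>, so a level
      strictly between it and \<open>r\<close> avoids \<open>A\<close>. Staying above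
      \<open>r/2\<close> keeps the definition of \<open>A\<close> applicable.\<close>
    define \<rho> where "\<rho> = max (r/2) ((1/v + r) / 2)"
    have "\<rho> < r" "r/2 \<le> \<rho>" using v1 r by (auto simp: \<rho>_def)
    have "\<rho> \<ge> (1/v + r)/2" by (simp add: \<rho>_def)
    hence \<rho>v: "1 / v < \<rho>" using v1 by argo
    have "z \<in> W" if z: "z \<in> superlevel P Q \<rho> \<union> level P Q \<rho>" for z
    proof (rule ccontr)
      assume "z \<notin> W"
      have ge: "\<rho> * cmod (poly Q z) \<le> cmod (poly P z)" using z by (auto simp: level_def superlevel_def)
      moreover have "r/2 * cmod (poly Q z) \<le> \<rho> * cmod (poly Q z)" using \<open>r/2 \<le> \<rho>\<close> by (intro mult_right_mono) auto
      ultimately have "z \<in> A" using \<open>z \<notin> W\<close> by (auto simp: A_def level_def superlevel_def)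
      hence "v * cmod (poly P z) \<le> cmod (poly Q z)"
        using a(2)[of z] nzA[of z] by (simp add: v_def norm_divide divide_simps mult.commute)
      hence "\<rho> * (v * cmod (poly P z)) \<le> \<rho> * cmod (poly Q z)"
        using \<open>r/2 \<le> \<rho>\<close> r by (intro mult_left_mono) auto
      hence "(\<rho> * v) * cmod (poly P z) \<le> 1 * cmod (poly P z)" using ge by (simp add: mult.assoc)
      hence "\<rho> * v \<le> 1" using nzA[OF \<open>z \<in> A\<close>] by simp
      thus False using \<rho>v v0 by (simp add: divide_less_eq)
    qed
    thus ?thesis using that[of \<rho>] \<open>\<rho> < r\<close> \<open>r/2 \<le> \<rho>\<close> by blast
  qed
  have \<rho>0: "\<rho> > 0" using \<rho> r by simp
  define D where "D i = V i \<inter> superlevel P Q \<rho>" for i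
  have oD: "open (D i)" if "i < n" for i using V(1)[OF that] open_superlevel by (auto simp: D_def)
  have dD: "disjoint_family_on D {..<n}" using V(3) by (auto simp: D_def disjoint_family_on_def)
  have UD: "(\<Union>i<n. D i) = superlevel P Q \<rho>" using \<rho>(3) by (auto simp: D_def W_def)
  have bD: "bounded (D i)" for i
    by (rule bounded_subset[OF compact_imp_bounded[OF compact_level_Un_superlevel[OF PQ(2) \<rho>0]]])
       (auto simp: D_def)
  have neD: "D i \<noteq> {}" if i: "i < n" for i
  proof -
    obtain z where z: "z \<in> K i" "poly Q z = 0" using K(2)[OF i] by blast
    hence "poly P z \<noteq> 0" using coprime_poly_0[OF PQ(1), of z] by auto
    hence "z \<in> D i" using z V(2)[OF i] by (auto simp: D_def superlevel_def)
    thus ?thesis by auto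
  qed
  have frD: "frontier (D i) \<subseteq> level P Q \<rho>" if i: "i < n" for i
  proof (rule frontier_subset_level[OF oD[OF i]])
    show "open (\<Union>j\<in>{..<n} - {i}. D j)" using oD by (intro open_UN) auto
    show "D i \<inter> (\<Union>j\<in>{..<n} - {i}. D j) = {}" using dD i by (auto simp: disjoint_family_on_def)
    show "superlevel P Q \<rho> \<subseteq> D i \<union> (\<Union>j\<in>{..<n} - {i}. D j)" unfolding UD[symmetric] by auto
  qed (simp add: D_def)
  have ex: "\<exists>z. z \<in> D i \<and> poly Q z = w * poly P z" if "i < n" "cmod w < 1 / \<rho>" for i w
  proof -
    have w: "cmod w * \<rho> < 1" using that(2) \<rho>0 by (simp add: less_divide_eq)
    have sub: "D i \<subseteq> superlevel P Q \<rho>" by (simp add: D_def)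
    show ?thesis
      using superlevel_attains[OF PQ(1) oD[OF that(1)] bD neD[OF that(1)] sub frD[OF that(1)] \<rho>0 w]
      unfolding Bex_def .
  qed
  \<comment> \<open>One point in each other piece together with \<open>x\<close> and
    \<open>y\<close> would be \<open>n + 1\<close> roots of \<open>Q - w P\<close>, a polynomial of
    degree \<open>n\<close>.\<close>
  have uni: "x = y" if i: "i < n" "cmod w < 1 / \<rho>" and x: "x \<in> D i" "poly Q x = w * poly P x"
      and y: "y \<in> D i" "poly Q y = w * poly P y" for i w x y
  proof (rule ccontr)
    assume "x \<noteq> y"
    have "\<forall>j. \<exists>z. j < n \<longrightarrow> z \<in> D j \<and> poly Q z = w * poly P z" using ex[OF _ i(2)] by blast
    then obtain p where p: "\<And>j. j < n \<Longrightarrow> p j \<in> D j \<and> poly Q (p j) = w * poly P (p j)"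
      unfolding choice_iff by blast
    define p' where "p' = p(i := x)"
    have p': "p' j \<in> D j \<and> poly Q (p' j) = w * poly P (p' j)" if "j < n" for j
      using p that x by (auto simp: p'_def)
    have sep: "a = b" if "a < n" "b < n" "z \<in> D a" "z \<in> D b" for a b z
      using dD that by (auto simp: disjoint_family_on_def)
    have inj: "inj_on p' {..<n}" by (rule inj_onI) (metis p' sep lessThan_iff)
    have "y \<notin> p' ` {..<n}"
    proof
      assume "y \<in> p' ` {..<n}"
      then obtain j where j: "j < n" "y = p' j" by auto
      hence "j = i" using sep[of j i y] p'[of j] y i by auto
      thus False using j \<open>x \<noteq> y\<close> by (simp add: p'_def)
    qed
    hence c: "card (insert y (p' ` {..<n})) = Suc n" by (simp add: card_image[OF inj])
    have "insert y (p' ` {..<n}) \<subseteq> {z. poly Q z = w * poly P z}" using p' y by auto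
    hence "card (insert y (p' ` {..<n})) \<le> card {z. poly Q z = w * poly P z}"
      by (intro card_mono card_roots_less_degree(3)[OF PQ(2) i(2) \<rho>0])
    hence "Suc n \<le> degree Q" using c card_roots_less_degree(4)[OF PQ(2) i(2) \<rho>0] by simp
    thus False using n by simp
  qed
  have "branched n P Q \<rho> D"
    unfolding branched_def
  proof (intro conjI allI impI)
    fix i w assume iw: "i < n" "cmod w < 1 / \<rho>"
    show "\<exists>!z. z \<in> D i \<and> poly Q z = w * poly P z"
      using ex[OF iw] by (rule ex_ex1I) (use uni[OF iw] in blast)
  qed (use \<rho>0 oD dD UD in auto)
  thus ?thesis using that \<rho>(2) by blast
qed

lemma closure_sublevel_subset:
  assumes "r > 0"
  shows "closure (sublevel P Q r) \<subseteq> level P Q r \<union> sublevel P Q r"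
  unfolding sublevel_superlevel_commute[OF assms, of P Q] level_commute[OF assms, of P Q]
  by (rule closed_superlevel_Un)

text \<open>A bounded component of a lower sublevel set contains a root of \<open>P\<close>, by
  \<open>superlevel_attains\<close> with \<open>P\<close> and \<open>Q\<close> exchanged and value
  0. Join the finitely many roots to a neighbourhood of infinity by paths inside |P/Q| < 1; on these
  compact paths |P/Q| is at most some v < 1. For r above \<open>v\<close> and 1/2 the resulting
  connected set \<open>Y\<close> lies in the sublevel set and meets each of its components.\<close>

lemma connected_sublevel_near:
  assumes PQ: "coprime P Q" "degree P < degree Q" and conn: "connected (sublevel P Q 1)"
  obtains \<rho> where "0 < \<rho>" "\<rho> < 1" "\<And>r. \<rho> < r \<Longrightarrow> r < 1 \<Longrightarrow> connected (sublevel P Q r)"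
proof -
  obtain b where b: "b > 0" "\<And>z. b \<le> cmod z \<Longrightarrow> z \<in> sublevel P Q (1/2)"
    using sublevel_contains_infinity[OF PQ(2), of "1/2"] by auto
  note mono = sublevel_mono[of _ _ P Q]
  define Z where "Z = {z. poly P z = 0}"
  have "P \<noteq> 0"
  proof
    assume "P = 0"
    hence "is_unit Q" using PQ(1) by simp
    thus False using PQ(2) by (auto simp: is_unit_poly_iff)
  qed
  hence fZ: "finite Z" unfolding Z_def by (rule poly_roots_finite)
  have ZS: "Z \<subseteq> sublevel P Q 1"
    using coprime_poly_0[OF PQ(1)] by (auto simp: Z_def sublevel_def)
  have bS: "of_real b \<in> sublevel P Q 1" using b mono[of "1/2" 1] by auto
  have "path_connected (sublevel P Q 1)"
    using conn open_sublevel connected_open_path_connected by blast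
  hence "\<exists>p. path p \<and> path_image p \<subseteq> sublevel P Q 1 \<and> pathstart p = of_real b \<and> pathfinish p = z"
    if "z \<in> Z" for z
    using bS ZS that unfolding path_connected_def by blast
  then obtain p where p: "\<And>z. z \<in> Z \<Longrightarrow> path (p z)" "\<And>z. z \<in> Z \<Longrightarrow> path_image (p z) \<subseteq> sublevel P Q 1"
      "\<And>z. z \<in> Z \<Longrightarrow> pathstart (p z) = of_real b" "\<And>z. z \<in> Z \<Longrightarrow> pathfinish (p z) = z"
    by metis
  define A where "A = (\<Union>z\<in>Z. path_image (p z))"
  have cA: "compact A" unfolding A_def using fZ p(1) by (intro compact_UN) (auto intro: compact_path_image)
  have AS: "A \<subseteq> sublevel P Q 1" using p(2) by (auto simp: A_def)
  have QA: "poly Q z \<noteq> 0" if "z \<in> A" for z using AS that by (auto simp: sublevel_def)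
  obtain v where v: "v < 1" "\<And>z. z \<in> A \<Longrightarrow> cmod (poly P z) \<le> v * cmod (poly Q z)"
  proof (cases "A = {}")
    case True thus ?thesis using that[of 0] by auto
  next
    case False
    have "continuous_on A (\<lambda>z. cmod (poly P z / poly Q z))"
      using QA by (intro continuous_intros) auto
    then obtain a where a: "a \<in> A" "\<And>z. z \<in> A \<Longrightarrow> cmod (poly P z / poly Q z) \<le> cmod (poly P a / poly Q a)"
      using continuous_attains_sup[OF cA False] by blast
    show ?thesis
    proof (rule that[of "cmod (poly P a / poly Q a)"])
      show "cmod (poly P a / poly Q a) < 1"
        using AS a(1) QA[OF a(1)] by (auto simp: sublevel_def norm_divide)
      show "cmod (poly P z) \<le> cmod (poly P a / poly Q a) * cmod (poly Q z)" if "z \<in> A" for z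
      proof -
        have "cmod (poly P z) = cmod (poly P z / poly Q z) * cmod (poly Q z)"
          using QA[OF that] by (simp add: norm_divide)
        also have "\<dots> \<le> cmod (poly P a / poly Q a) * cmod (poly Q z)"
          using a(2)[OF that] by (intro mult_right_mono) auto
        finally show ?thesis .
      qed
    qed
  qed
  have "connected (sublevel P Q r)" if r: "max (1/2) v < r" "r < 1" for r
  proof -
    have r0: "r > 0" using r by simp
    define Y where "Y = \<Union> (insert (- ball 0 b) ((\<lambda>z. path_image (p z)) ` Z))"
    have cY: "connected Y" unfolding Y_def
    proof (rule connected_Union)
      show "connected s" if "s \<in> insert (- ball 0 b) ((\<lambda>z. path_image (p z)) ` Z)" for s
        using that p(1) connected_complement_bounded_convex[of "ball (0::complex) b"]
        by (auto intro: connected_path_image)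
      have "of_real b \<in> \<Inter> (insert (- ball 0 b) ((\<lambda>z. path_image (p z)) ` Z))"
      proof -
        have "of_real b \<in> path_image (p z)" if "z \<in> Z" for z
          using pathstart_in_path_image[of "p z"] p(3)[OF that] by simp
        thus ?thesis using b(1) by auto
      qed
      thus "\<Inter> (insert (- ball 0 b) ((\<lambda>z. path_image (p z)) ` Z)) \<noteq> {}" by blast
    qed
    have YS: "Y \<subseteq> sublevel P Q r"
    proof
      fix z assume "z \<in> Y"
      then consider "b \<le> cmod z" | "z \<in> A" by (force simp: Y_def A_def)
      thus "z \<in> sublevel P Q r"
      proof cases
        case 1 thus ?thesis using b(2) mono[of "1/2" r] r by auto
      next
        case 2
        have "v * cmod (poly Q z) < r * cmod (poly Q z)" using QA[OF 2] r by simp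
        thus ?thesis using v(2)[OF 2] by (simp add: sublevel_def)
      qed
    qed
    have meets: "connected_component_set (sublevel P Q r) x \<inter> Y \<noteq> {}" if x: "x \<in> sublevel P Q r" for x
    proof
      define U where "U = connected_component_set (sublevel P Q r) x"
      assume "connected_component_set (sublevel P Q r) x \<inter> Y = {}"
      hence dis: "U \<inter> Y = {}" by (simp add: U_def)
      have oU: "open U" unfolding U_def using open_sublevel open_connected_component by blast
      have US: "U \<subseteq> superlevel Q P (1/r)"
        unfolding U_def using connected_component_subset sublevel_superlevel_commute[OF r0] by metis
      have "U \<subseteq> ball 0 b" using dis by (auto simp: Y_def)
      hence bU: "bounded U" using bounded_subset bounded_ball by blast
      have neU: "U \<noteq> {}" unfolding U_def using x connected_component_refl by blast
      have "frontier U \<subseteq> frontier (sublevel P Q r)"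
        unfolding U_def by (rule frontier_of_connected_component_subset)
      also have "\<dots> \<subseteq> level Q P (1/r)"
        using closure_sublevel_subset[OF r0, of P Q] open_sublevel[of P Q r] level_commute[OF r0, of P Q]
        by (auto simp: frontier_def interior_open)
      finally have "\<exists>z\<in>U. poly P z = 0 * poly Q z"
        using superlevel_attains[of Q P U "1/r" 0] PQ(1) oU bU neU US r0 by (simp add: coprime_commute)
      then obtain z where z: "z \<in> U" "z \<in> Z" by (auto simp: Z_def)
      hence "z \<in> Y" unfolding Y_def using p(4) pathfinish_in_path_image by (metis UN_I Union_insert UnCI image_eqI)
      thus False using z dis by blast
    qed
    show ?thesis
      unfolding connected_iff_connected_component
    proof (intro ballI)
      fix x y assume xy: "x \<in> sublevel P Q r" "y \<in> sublevel P Q r"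
      obtain x' y' where x': "connected_component (sublevel P Q r) x x'" "x' \<in> Y"
        and y': "connected_component (sublevel P Q r) y y'" "y' \<in> Y"
        using meets[OF xy(1)] meets[OF xy(2)] by blast
      have "connected_component (sublevel P Q r) x' y'"
        using cY YS x' y' by (meson connected_component_def)
      thus "connected_component (sublevel P Q r) x y"
        using x'(1) y'(1) by (meson connected_component_sym connected_component_trans)
    qed
  qed
  moreover have "0 < max (1/2) v" "max (1/2) v < 1" using v(1) by auto
  ultimately show ?thesis using that by metis
qed

section \<open>Fibres and critical values\<close>

lemma card_roots_rsquarefree:
  fixes p :: "complex poly"
  assumes "rsquarefree p"
  shows "card {z. poly p z = 0} = degree p"
proof -
  have p0: "p \<noteq> 0" using assms by (simp add: rsquarefree_def)
  have "degree p = degree (smult (lead_coeff p) (\<Prod>z | poly p z = 0. [:- z, 1:]))"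
    using complex_poly_decompose_rsquarefree[OF assms] by simp
  also have "\<dots> = degree (\<Prod>z | poly p z = 0. [:- z, 1:])" using p0 by simp
  also have "\<dots> = (\<Sum>z | poly p z = 0. degree [:- z, 1:])"
    by (intro degree_prod_eq_sum_degree) auto
  finally show ?thesis by simp
qed

text \<open>Off 0 and the critical values, \<open>w Q - P\<close> has the degree of \<open>Q\<close>
  and only simple roots. The value 0 is set aside because there the degree drops to that of
  \<open>P\<close>.\<close>

lemma finite_critical_values:
  fixes P Q :: "complex poly"
  assumes PQ: "coprime P Q" "degree P < degree Q"
  shows "finite {w. card {z. poly P z = w * poly Q z} \<noteq> degree Q}"
proof -
  define W where "W = pderiv P * Q - P * pderiv Q"
  \<comment> \<open>If the Wronskian vanished, then at a root of \<open>Q\<close> the factor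
    \<open>Q\<close> would divide out one order more on one side than \<open>pderiv Q\<close>
    provides on the other.\<close>
  have "W \<noteq> 0"
  proof
    assume "W = 0"
    hence eq: "P * pderiv Q = pderiv P * Q" by (simp add: W_def)
    have Q0: "Q \<noteq> 0" and dQ: "pderiv Q \<noteq> 0" using PQ(2) by (auto simp: pderiv_eq_0_iff)
    have "\<not> constant (poly Q)" using PQ(2) by (simp add: constant_degree)
    from Fundamental_Theorem_Algebra.fundamental_theorem_of_algebra[OF this] obtain a where a: "poly Q a = 0" ..
    hence Pa: "poly P a \<noteq> 0" using coprime_poly_0[OF PQ(1), of a] by auto
    hence ne: "P * pderiv Q \<noteq> 0" using dQ by auto
    have "order a (P * pderiv Q) = order a (pderiv Q)"
      using order_mult[OF ne] Pa by (simp add: order_0I)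
    moreover have "order a (pderiv P * Q) = order a (pderiv P) + order a Q"
      using order_mult[of "pderiv P" Q a] ne eq by simp
    moreover have "order a Q = Suc (order a (pderiv Q))"
      by (rule Polynomial.order_pderiv[OF Q0 a])
    ultimately show False using eq by simp
  qed
  from poly_roots_finite[OF this]
  have fin: "finite (insert 0 ((\<lambda>a. poly P a / poly Q a) ` {a. poly W a = 0}))"
    by (intro finite.insertI finite_imageI)
  have "{w. card {z. poly P z = w * poly Q z} \<noteq> degree Q}
      \<subseteq> insert 0 ((\<lambda>a. poly P a / poly Q a) ` {a. poly W a = 0})"
  proof
    fix w assume w: "w \<in> {w. card {z. poly P z = w * poly Q z} \<noteq> degree Q}"
    show "w \<in> insert 0 ((\<lambda>a. poly P a / poly Q a) ` {a. poly W a = 0})"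
    proof (rule ccontr)
      assume nw: "w \<notin> insert 0 ((\<lambda>a. poly P a / poly Q a) ` {a. poly W a = 0})"
      define p where "p = smult w Q - P"
      have dp: "degree p = degree Q"
        using degree_add_eq_left[of "- P" "smult w Q"] nw PQ(2) by (simp add: p_def)
      have "\<not> (poly p a = 0 \<and> poly (pderiv p) a = 0)" for a
      proof
        assume "poly p a = 0 \<and> poly (pderiv p) a = 0"
        hence a: "poly P a = w * poly Q a" "poly (pderiv P) a = w * poly (pderiv Q) a"
          by (auto simp: p_def pderiv_diff pderiv_smult)
        have "poly Q a \<noteq> 0" using a(1) coprime_poly_0[OF PQ(1), of a] by auto
        hence "w = poly P a / poly Q a" using a(1) by simp
        moreover have "poly W a = 0" using a by (simp add: W_def)
        ultimately show False using nw by blast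
      qed
      hence "card {z. poly p z = 0} = degree Q"
        using card_roots_rsquarefree[of p] dp by (simp add: rsquarefree_roots)
      moreover have "{z. poly p z = 0} = {z. poly P z = w * poly Q z}" by (auto simp: p_def)
      ultimately show False using w by simp
    qed
  qed
  thus ?thesis using fin by (rule finite_subset)
qed

lemma coprime_if_no_common_root:
  fixes P Q :: "complex poly"
  assumes "Q \<noteq> 0" "\<And>z. \<not> (poly P z = 0 \<and> poly Q z = 0)"
  shows "coprime P Q"
proof (rule coprimeI)
  fix d assume d: "d dvd P" "d dvd Q"
  have d0: "d \<noteq> 0" using d assms by auto
  show "is_unit d"
  proof (rule ccontr)
    assume "\<not> is_unit d"
    hence "degree d \<noteq> 0" using d0 is_unit_iff_degree by blast
    hence "\<not> constant (poly d)" by (simp add: constant_degree)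
    from Fundamental_Theorem_Algebra.fundamental_theorem_of_algebra[OF this]
    obtain z where "poly d z = 0" ..
    hence "poly P z = 0 \<and> poly Q z = 0" using d by (auto elim!: dvdE)
    thus False using assms(2) by blast
  qed
qed

lemma branched_inverse:
  assumes PQ: "coprime P Q" and B: "branched n P Q \<rho> D" and i: "i < n"
  obtains \<sigma> where "\<sigma> holomorphic_on ball 0 (1/\<rho>)"
    "\<And>w. cmod w < 1/\<rho> \<Longrightarrow> \<sigma> w \<in> D i \<and> poly Q (\<sigma> w) = w * poly P (\<sigma> w)"
    "\<And>z. z \<in> D i \<Longrightarrow> cmod (poly Q z / poly P z) < 1/\<rho> \<and> \<sigma> (poly Q z / poly P z) = z"
proof -
  have \<rho>: "0 < \<rho>" and op: "open (D i)" and sub: "D i \<subseteq> superlevel P Q \<rho>"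
    and ex1: "cmod w < 1 / \<rho> \<Longrightarrow> \<exists>!z. z \<in> D i \<and> poly Q z = w * poly P z" for w
    using B i unfolding branched_def by auto
  have nz: "poly P z \<noteq> 0" if "z \<in> D i" for z
    using sub that \<rho> by (auto simp: superlevel_def mult_less_0_iff)
  have vb: "cmod (poly Q z / poly P z) < 1/\<rho>" if "z \<in> D i" for z
    using sub that \<rho> nz[OF that] by (auto simp: superlevel_def norm_divide divide_simps mult.commute)
  define v where "v z = poly Q z / poly P z" for z
  have hol: "v holomorphic_on D i"
    unfolding v_def using nz by (intro holomorphic_intros) auto
  have inj: "inj_on v (D i)"
  proof (rule inj_onI)
    fix x y assume xy: "x \<in> D i" "y \<in> D i" "v x = v y"
    have "poly Q x = poly Q x / poly P x * poly P x" using nz[OF xy(1)] by simp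
    moreover have "poly Q y = poly Q x / poly P x * poly P y"
      unfolding xy(3)[unfolded v_def] using nz[OF xy(2)] by simp
    ultimately show "x = y" using ex1[OF vb[OF xy(1)]] xy(1,2) by blast
  qed
  obtain \<sigma> where \<sigma>: "\<sigma> holomorphic_on v ` D i"
      "\<And>z. z \<in> D i \<Longrightarrow> deriv v z * deriv \<sigma> (v z) = 1" "\<And>z. z \<in> D i \<Longrightarrow> \<sigma> (v z) = z"
    by (rule holomorphic_has_inverse[OF hol op inj]) (rule that, auto)
  have im: "\<exists>z\<in>D i. w = v z" if w: "cmod w < 1/\<rho>" for w
  proof -
    obtain z where "z \<in> D i" "poly Q z = w * poly P z" using ex1[OF w] by blast
    thus ?thesis using nz[of z] by (intro bexI[of _ z]) (auto simp: v_def)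
  qed
  show ?thesis
  proof (rule that[of \<sigma>])
    show "\<sigma> holomorphic_on ball 0 (1/\<rho>)"
    proof (rule holomorphic_on_subset[OF \<sigma>(1)], rule subsetI)
      fix w :: complex assume "w \<in> ball 0 (1/\<rho>)"
      thus "w \<in> v ` D i" using im[of w] by (simp add: image_iff)
    qed
    show "\<sigma> w \<in> D i \<and> poly Q (\<sigma> w) = w * poly P (\<sigma> w)" if w: "cmod w < 1/\<rho>" for w
    proof -
      obtain z where z: "z \<in> D i" "w = v z" using im[OF w] by blast
      thus ?thesis using \<sigma>(3)[OF z(1)] nz[OF z(1)] by (simp add: v_def)
    qed
    show "cmod (poly Q z / poly P z) < 1/\<rho> \<and> \<sigma> (poly Q z / poly P z) = z" if "z \<in> D i" for z
      using vb[OF that] \<sigma>(3)[OF that] unfolding v_def by (rule conjI)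
  qed
qed

lemma branched_inverses:
  assumes "coprime P Q" "branched n P Q \<rho> D"
  obtains \<sigma> where "\<And>i. i < n \<Longrightarrow> \<sigma> i holomorphic_on ball 0 (1/\<rho>)"
    "\<And>i w. i < n \<Longrightarrow> cmod w < 1/\<rho> \<Longrightarrow> \<sigma> i w \<in> D i \<and> poly Q (\<sigma> i w) = w * poly P (\<sigma> i w)"
    "\<And>i z. i < n \<Longrightarrow> z \<in> D i \<Longrightarrow> \<sigma> i (poly Q z / poly P z) = z"
proof -
  have "\<forall>i. \<exists>s. i < n \<longrightarrow> s holomorphic_on ball 0 (1/\<rho>)
      \<and> (\<forall>w. cmod w < 1/\<rho> \<longrightarrow> s w \<in> D i \<and> poly Q (s w) = w * poly P (s w))
      \<and> (\<forall>z\<in>D i. s (poly Q z / poly P z) = z)"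
    using branched_inverse[OF assms] by metis
  then show ?thesis using that unfolding choice_iff by blast
qed

section \<open>Conformal conjugation of rational functions\<close>

text \<open>The equation says that (P' y : Q' y) and (P z : Q z) are the same point of the
  projective line, coprimality excluding (0 : 0). Poles and finite values are thus treated
  alike.\<close>

lemma parallel_values:
  fixes P Q P' Q' :: "complex poly"
  assumes "coprime P Q" "coprime P' Q'" and eq: "poly P' y * poly Q z = poly P z * poly Q' y"
  obtains c where "c \<noteq> 0" "poly P' y = c * poly P z" "poly Q' y = c * poly Q z"
proof (cases "poly Q z = 0")
  case True
  hence P: "poly P z \<noteq> 0" using coprime_poly_0[OF assms(1), of z] by auto
  hence Q': "poly Q' y = 0" using eq True by auto
  hence "poly P' y \<noteq> 0" using coprime_poly_0[OF assms(2), of y] by auto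
  thus ?thesis using that[of "poly P' y / poly P z"] P True Q' by auto
next
  case False
  have P': "poly P' y = poly Q' y / poly Q z * poly P z" using eq False by (simp add: field_simps)
  moreover have "poly Q' y \<noteq> 0"
  proof
    assume "poly Q' y = 0"
    hence "poly P' y = 0" using P' by simp
    thus False using coprime_poly_0[OF assms(2), of y] \<open>poly Q' y = 0\<close> by auto
  qed
  ultimately show ?thesis using that[of "poly Q' y / poly Q z"] False by auto
qed

lemma level_transfer:
  fixes P Q P' Q' :: "complex poly"
  assumes "coprime P Q" "coprime P' Q'" and eq: "poly P' y * poly Q z = poly P z * poly Q' y"
  shows "y \<in> sublevel P' Q' r \<longleftrightarrow> z \<in> sublevel P Q r"
    "y \<in> level P' Q' r \<longleftrightarrow> z \<in> level P Q r"
    "y \<in> superlevel P' Q' r \<longleftrightarrow> z \<in> superlevel P Q r"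
proof -
  obtain c where c: "c \<noteq> 0" "poly P' y = c * poly P z" "poly Q' y = c * poly Q z"
    by (rule parallel_values[OF assms])
  have 1: "cmod (poly P' y) = cmod c * cmod (poly P z)"
    "r * cmod (poly Q' y) = cmod c * (r * cmod (poly Q z))"
    using c by (simp_all add: norm_mult)
  have "cmod c > 0" using c by simp
  thus "y \<in> sublevel P' Q' r \<longleftrightarrow> z \<in> sublevel P Q r"
    "y \<in> level P' Q' r \<longleftrightarrow> z \<in> level P Q r"
    "y \<in> superlevel P' Q' r \<longleftrightarrow> z \<in> superlevel P Q r"
    unfolding sublevel_def level_def superlevel_def mem_Collect_eq 1 by simp_all
qed

lemma connected_in_disjoint_family:
  assumes A: "connected A" "A \<noteq> {}" "A \<subseteq> (\<Union>i<n. D i)"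
    and D: "\<And>i. i < n \<Longrightarrow> open (D i)" "disjoint_family_on D {..<n}"
  obtains i :: nat where "i < n" "A \<subseteq> D i"
proof -
  obtain a where a: "a \<in> A" using A(2) by blast
  then obtain i where i: "i < n" "a \<in> D i" using A(3) by blast
  define V where "V = (\<Union>j\<in>{..<n} - {i}. D j)"
  have "open V" unfolding V_def using D(1) by (intro open_UN) auto
  moreover have "D i \<inter> V = {}" using D(2) i(1) by (auto simp: V_def disjoint_family_on_def)
  moreover have "A \<subseteq> D i \<union> V" using A(3) by (auto simp: V_def)
  ultimately have "A \<inter> V = {}"
    using connectedD[OF A(1) D(1)[OF i(1)], of V] a i(2) by blast
  hence "A \<subseteq> D i" using \<open>A \<subseteq> D i \<union> V\<close> by blast
  thus ?thesis using that i(1) by blast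
qed

lemma level_ratio:
  assumes "coprime P Q" "z \<in> superlevel P Q \<rho>" "\<rho> > 0"
  shows "poly P z \<noteq> 0" "cmod (poly Q z / poly P z) < 1 / \<rho>"
proof -
  show "poly P z \<noteq> 0" using assms by (auto simp: superlevel_def mult_less_0_iff)
  thus "cmod (poly Q z / poly P z) < 1 / \<rho>"
    using assms by (auto simp: superlevel_def norm_divide divide_simps mult.commute)
qed

text \<open>In the application \<open>P'\<close> and \<open>Q'\<close> are limits of coprime pairs
  and might have a common factor. Hence \<open>eq\<close> is cross-multiplied, and coprimality of
  the pair is derived below rather than assumed.\<close>

locale rational_conjugation =
  fixes P Q P' Q' :: "complex poly" and \<phi> :: "complex \<Rightarrow> complex" and n :: nat
  assumes PQ: "coprime P Q" "degree P < degree Q" and n: "n = degree Q"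
    and deg': "degree P' < degree Q'" and n': "n = degree Q'"
    and hol: "\<phi> holomorphic_on sublevel P Q 1" and inj: "inj_on \<phi> (sublevel P Q 1)"
    and lim: "((\<lambda>z. \<phi> z / z) \<longlongrightarrow> 1) at_infinity"
    and eq: "\<And>z. z \<in> sublevel P Q 1 \<Longrightarrow> poly P' (\<phi> z) * poly Q z = poly P z * poly Q' (\<phi> z)"
begin

text \<open>\<open>\<phi>\<close> carries the \<open>n\<close> points over \<open>w\<close>
  injectively to roots of \<open>w Q' - P'\<close>, which has degree \<open>n\<close>, so these are
  all its roots. At w = 0 the degree drops and the count breaks down.\<close>

lemma fibre:
  assumes w: "cmod w < 1" and card: "card {z. poly P z = w * poly Q z} = n" and "w \<noteq> 0"
  shows "{z. poly P z = w * poly Q z} \<subseteq> sublevel P Q 1"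
    "{y. poly P' y = w * poly Q' y} = \<phi> ` {z. poly P z = w * poly Q z}"
proof -
  define A where "A = {z. poly P z = w * poly Q z}"
  have QA: "poly Q z \<noteq> 0" if "z \<in> A" for z
    using that coprime_poly_0[OF PQ(1), of z] by (auto simp: A_def)
  have AS: "A \<subseteq> sublevel P Q 1"
  proof
    fix z assume z: "z \<in> A"
    have "cmod w * cmod (poly Q z) < 1 * cmod (poly Q z)" using w QA[OF z] by simp
    thus "z \<in> sublevel P Q 1" using z by (simp add: A_def sublevel_def norm_mult)
  qed
  thus "{z. poly P z = w * poly Q z} \<subseteq> sublevel P Q 1" by (simp add: A_def)
  define p where "p = smult w Q' - P'"
  have dp: "degree p = n"
    using degree_add_eq_left[of "- P'" "smult w Q'"] \<open>w \<noteq> 0\<close> deg' n' by (simp add: p_def)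
  have p0: "p \<noteq> 0" using dp deg' n' by auto
  have roots: "{y. poly P' y = w * poly Q' y} = {y. poly p y = 0}" by (auto simp: p_def)
  have sub: "\<phi> ` A \<subseteq> {y. poly p y = 0}"
  proof
    fix y assume "y \<in> \<phi> ` A"
    then obtain z where z: "z \<in> A" "y = \<phi> z" by blast
    have "poly P' y * poly Q z = w * poly Q z * poly Q' y"
      using eq[of z] z AS by (auto simp: A_def)
    thus "y \<in> {y. poly p y = 0}" using QA[OF z(1)] by (simp add: p_def)
  qed
  have "card (\<phi> ` A) = n"
    using card card_image[OF inj_on_subset[OF inj AS]] by (simp add: A_def)
  hence "\<phi> ` A = {y. poly p y = 0}"
    using card_seteq[OF poly_roots_finite[OF p0] sub] card_poly_roots_bound[OF p0] dp by simp
  thus "{y. poly P' y = w * poly Q' y} = \<phi> ` {z. poly P z = w * poly Q z}"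
    by (simp add: roots A_def)
qed

definition "exceptional = insert 0 {w. card {z. poly P z = w * poly Q z} \<noteq> n}"

lemma finite_exceptional: "finite exceptional"
  unfolding exceptional_def using finite_critical_values[OF PQ] unfolding n[symmetric] by simp

lemma fibre_point:
  assumes "poly P' y = w * poly Q' y" "cmod w < 1" "w \<notin> exceptional"
  obtains z where "z \<in> sublevel P Q 1" "y = \<phi> z" "poly P z = w * poly Q z"
proof -
  have "card {z. poly P z = w * poly Q z} = n" "w \<noteq> 0" using assms(3) by (auto simp: exceptional_def)
  note fib = fibre[OF assms(2) this]
  have "y \<in> {y. poly P' y = w * poly Q' y}" using assms(1) by simp
  then obtain z where "z \<in> {z. poly P z = w * poly Q z}" "y = \<phi> z" unfolding fib(2) by blast
  thus ?thesis using that fib(1) by blast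
qed

text \<open>A common root would lie over every value at once, in particular over two unexceptional
  ones; its single preimage under \<open>\<phi>\<close> would then carry two values of P/Q.\<close>

lemma coprime_image: "coprime P' Q'"
proof (rule coprime_if_no_common_root)
  show "Q' \<noteq> 0" using deg' by auto
  fix y
  show "\<not> (poly P' y = 0 \<and> poly Q' y = 0)"
  proof
    assume y: "poly P' y = 0 \<and> poly Q' y = 0"
    have inf: "infinite (ball (0::complex) 1 - exceptional)"
      using finite_exceptional uncountable_ball[of 1 "0::complex"] countable_finite
      by (metis Diff_infinite_finite zero_less_one)
    then obtain w1 where w1: "w1 \<in> ball 0 1 - exceptional" using infinite_imp_nonempty by blast
    have "infinite (ball (0::complex) 1 - exceptional - {w1})" using inf by simp
    then obtain w2 where w2: "w2 \<in> ball 0 1 - exceptional - {w1}" using infinite_imp_nonempty by blast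
    obtain z1 where z1: "z1 \<in> sublevel P Q 1" "y = \<phi> z1" "poly P z1 = w1 * poly Q z1"
      using fibre_point[of y w1] y w1 by auto
    obtain z2 where z2: "z2 \<in> sublevel P Q 1" "y = \<phi> z2" "poly P z2 = w2 * poly Q z2"
      using fibre_point[of y w2] y w2 by auto
    have "z1 = z2" using inj_onD[OF inj, of z1 z2] z1 z2 by simp
    hence "w1 * poly Q z1 = w2 * poly Q z1" using z1(3) z2(3) by metis
    hence "poly Q z1 = 0" using w2 by auto
    thus False using z1(3) coprime_poly_0[OF PQ(1), of z1] by auto
  qed
qed

lemma transfer:
  assumes "z \<in> sublevel P Q 1"
  shows "\<phi> z \<in> sublevel P' Q' r \<longleftrightarrow> z \<in> sublevel P Q r"
    "\<phi> z \<in> level P' Q' r \<longleftrightarrow> z \<in> level P Q r"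
    "\<phi> z \<in> superlevel P' Q' r \<longleftrightarrow> z \<in> superlevel P Q r"
  by (rule level_transfer[OF PQ(1) coprime_image eq[OF assms]])+

text \<open>Fibre counting reaches every point except the finitely many over exceptional values, and
  a finite set has empty interior. This is the density required of \<open>E\<close> in
  \<open>Jordan_pieces\<close>.\<close>

lemma sublevel_subset_closure_image:
  assumes r: "0 < r" "r \<le> 1"
  shows "sublevel P' Q' r \<subseteq> closure (\<phi> ` sublevel P Q r)"
proof
  fix y assume y: "y \<in> sublevel P' Q' r"
  define F where "F = (\<Union>w\<in>exceptional. {y. poly P' y = w * poly Q' y})"
  have "finite F"
    unfolding F_def
  proof (intro finite_UN_I finite_exceptional)
    fix w
    have "P' - smult w Q' \<noteq> 0"
    proof
      assume "P' - smult w Q' = 0"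
      hence e: "P' = smult w Q'" by simp
      have "w = 0" using deg' e degree_smult_eq[of w Q'] by (metis less_irrefl)
      hence "P' = 0" using e by simp
      hence "is_unit Q'" using coprime_image by simp
      thus False using deg' by (auto simp: is_unit_poly_iff)
    qed
    from poly_roots_finite[OF this] show "finite {y. poly P' y = w * poly Q' y}" by simp
  qed
  have sub: "sublevel P' Q' r - F \<subseteq> \<phi> ` sublevel P Q r"
  proof
    fix y assume y: "y \<in> sublevel P' Q' r - F"
    have Q': "poly Q' y \<noteq> 0" using y by (auto simp: sublevel_def)
    define w where "w = poly P' y / poly Q' y"
    have w: "poly P' y = w * poly Q' y" using Q' by (simp add: w_def)
    have wr: "cmod w < r" using y Q' by (auto simp: w_def sublevel_def norm_divide divide_simps)
    have "w \<notin> exceptional" using y w by (auto simp: F_def)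
    then obtain z where z: "poly P z = w * poly Q z" "y = \<phi> z"
      using fibre_point[OF w] wr r by auto
    have "poly Q z \<noteq> 0" using z(1) coprime_poly_0[OF PQ(1), of z] by auto
    hence "cmod w * cmod (poly Q z) < r * cmod (poly Q z)" using wr by simp
    hence "z \<in> sublevel P Q r" using z(1) by (simp add: sublevel_def norm_mult)
    thus "y \<in> \<phi> ` sublevel P Q r" using z by blast
  qed
  show "y \<in> closure (\<phi> ` sublevel P Q r)"
  proof (rule ccontr)
    assume ny: "y \<notin> closure (\<phi> ` sublevel P Q r)"
    define U where "U = sublevel P' Q' r \<inter> - closure (\<phi> ` sublevel P Q r)"
    have "open U" unfolding U_def using open_sublevel by (intro open_Int) auto
    moreover have "y \<in> U" using y ny by (simp add: U_def)
    ultimately obtain e where e: "e > 0" "ball y e \<subseteq> U" using openE by blast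
    have "U \<subseteq> F" using sub closure_subset[of "\<phi> ` sublevel P Q r"] by (auto simp: U_def)
    hence "finite (ball y e)" using \<open>finite F\<close> e(2) finite_subset by (metis subset_trans)
    thus False using uncountable_ball[OF e(1), of y] countable_finite by blast
  qed
qed

text \<open>Since r < 1, the level set of P/Q at \<open>r\<close> lies in the domain of
  \<open>\<phi>\<close>. The inverse branches parametrize it by \<open>n\<close> disjoint Jordan
  curves, and their images fill the level set of P'/Q', so \<open>Jordan_pieces\<close> applies to
  P'/Q' although nothing is assumed about its boundary at level 1.\<close>

lemma exists_branched_image:
  assumes conn: "connected (sublevel P Q r)" and br: "branched n P Q \<rho> D" and r: "\<rho> < r" "r < 1"
  obtains \<rho>' D' where "\<rho>' < r" "branched n P' Q' \<rho>' D'"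
proof -
  have \<rho>0: "\<rho> > 0" and dD: "disjoint_family_on D {..<n}" and UD: "(\<Union>i<n. D i) = superlevel P Q \<rho>"
    using br by (auto simp: branched_def)
  have r0: "r > 0" using \<rho>0 r by simp
  obtain \<sigma> where \<sigma>: "\<And>i. i < n \<Longrightarrow> \<sigma> i holomorphic_on ball 0 (1/\<rho>)"
    "\<And>i w. i < n \<Longrightarrow> cmod w < 1/\<rho> \<Longrightarrow> \<sigma> i w \<in> D i \<and> poly Q (\<sigma> i w) = w * poly P (\<sigma> i w)"
    "\<And>i z. i < n \<Longrightarrow> z \<in> D i \<Longrightarrow> \<sigma> i (poly Q z / poly P z) = z"
    using branched_inverses[OF PQ(1) br] by metis
  have tr: "cmod (t / of_real r) = 1 / r" "cmod (t / of_real r) < 1 / \<rho>" if "t \<in> sphere 0 1" for t :: complex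
  proof -
    show "cmod (t / of_real r) = 1 / r" using that r0 by (simp add: norm_divide)
    moreover have "1 / r < 1 / \<rho>" using r \<rho>0 by (simp add: frac_less2)
    ultimately show "cmod (t / of_real r) < 1 / \<rho>" by simp
  qed
  have lev: "\<sigma> i (t / of_real r) \<in> level P Q r" if "i < n" "t \<in> sphere 0 1" for i t
  proof -
    have "cmod (poly Q (\<sigma> i (t / of_real r))) = cmod (t / of_real r) * cmod (poly P (\<sigma> i (t / of_real r)))"
      using \<sigma>(2)[OF that(1) tr(2)[OF that(2)]] by (simp only: norm_mult)
    thus ?thesis unfolding tr(1)[OF that(2)] using r0 by (simp add: level_def)
  qed
  have levS: "level P Q r \<subseteq> sublevel P Q 1"
  proof
    fix z assume z: "z \<in> level P Q r"
    have "poly Q z \<noteq> 0" using z coprime_poly_0[OF PQ(1), of z] by (auto simp: level_def)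
    hence "r * cmod (poly Q z) < 1 * cmod (poly Q z)" using r by simp
    thus "z \<in> sublevel P Q 1" using z by (simp add: level_def sublevel_def)
  qed
  have inS: "\<sigma> i (t / of_real r) \<in> sublevel P Q 1" if "i < n" "t \<in> sphere 0 1" for i t
    using lev[OF that] levS by blast
  \<comment> \<open>At level \<open>r\<close> the quotient Q/P has modulus \<open>1/r\<close>, hence
    the argument \<open>t / r\<close> with |t| = 1.\<close>
  define c where "c i t = \<phi> (\<sigma> i (t / of_real r))" for i t
  have cont: "continuous_on (sphere 0 1) (c i)" if i: "i < n" for i
  proof -
    have "continuous_on (sphere 0 1) (\<lambda>t. \<sigma> i (t / of_real r))"
      by (rule continuous_on_compose2[OF holomorphic_on_imp_continuous_on[OF \<sigma>(1)[OF i]]])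
         (use r0 tr(2) in \<open>auto intro!: continuous_intros\<close>)
    thus ?thesis unfolding c_def
      by (rule continuous_on_compose2[OF holomorphic_on_imp_continuous_on[OF hol]])
         (use inS[OF i] in auto)
  qed
  have ratio: "poly Q (\<sigma> i w) / poly P (\<sigma> i w) = w" "poly P (\<sigma> i w) \<noteq> 0" if "i < n" "cmod w < 1/\<rho>" for i w
  proof -
    have "\<sigma> i w \<in> superlevel P Q \<rho>" using \<sigma>(2)[OF that] UD that(1) by blast
    thus "poly P (\<sigma> i w) \<noteq> 0" using level_ratio(1)[OF PQ(1) _ \<rho>0] by blast
    thus "poly Q (\<sigma> i w) / poly P (\<sigma> i w) = w" using \<sigma>(2)[OF that] by simp
  qed
  have injc: "inj_on (c i) (sphere 0 1)" if i: "i < n" for i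
  proof (rule inj_onI)
    fix s t assume st: "s \<in> sphere 0 1" "t \<in> sphere 0 1" "c i s = c i t"
    have "\<sigma> i (s / of_real r) = \<sigma> i (t / of_real r)"
      by (rule inj_onD[OF inj]) (use st inS[OF i] in \<open>auto simp: c_def\<close>)
    hence "s / of_real r = t / of_real r"
      using ratio(1)[OF i tr(2)[OF st(1)]] ratio(1)[OF i tr(2)[OF st(2)]] by metis
    thus "s = t" using r0 by simp
  qed
  have disj: "c i ` sphere 0 1 \<inter> c j ` sphere 0 1 = {}" if ij: "i < n" "j < n" "i \<noteq> j" for i j
  proof (rule equals0I)
    fix y assume "y \<in> c i ` sphere 0 1 \<inter> c j ` sphere 0 1"
    then obtain s t where st: "s \<in> sphere 0 1" "t \<in> sphere 0 1" "c i s = c j t" by auto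
    have "\<sigma> i (s / of_real r) = \<sigma> j (t / of_real r)"
      by (rule inj_onD[OF inj]) (use st inS ij in \<open>auto simp: c_def\<close>)
    moreover have "\<sigma> i (s / of_real r) \<in> D i" using \<sigma>(2)[OF ij(1) tr(2)[OF st(1)]] by blast
    moreover have "\<sigma> j (t / of_real r) \<in> D j" using \<sigma>(2)[OF ij(2) tr(2)[OF st(2)]] by blast
    ultimately show False using dD ij by (auto simp: disjoint_family_on_def)
  qed
  have lev': "level P' Q' r = (\<Union>i<n. c i ` sphere 0 1)"
  proof (intro equalityI subsetI)
    fix y assume y: "y \<in> level P' Q' r"
    have Q'y: "poly Q' y \<noteq> 0" using y coprime_poly_0[OF coprime_image, of y] by (auto simp: level_def)
    define w where "w = poly P' y / poly Q' y"
    have w: "poly P' y = w * poly Q' y" using Q'y by (simp add: w_def)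
    have cw: "cmod w = r" using y Q'y by (simp add: w_def level_def norm_divide)
    hence w0: "w \<noteq> 0" using r0 by auto
    have iw: "cmod (1 / w) < 1 / \<rho>" using cw r \<rho>0 w0 by (simp add: norm_divide frac_less2)
    define F where "F = {z. poly P z = w * poly Q z}"
    have F: "F = {z. poly Q z = (1/w) * poly P z}" using w0 by (auto simp: F_def field_simps)
    have fin: "finite F" "card F \<le> n"
      unfolding F n using card_roots_less_degree(3,4)[OF PQ(2) iw \<rho>0] by auto
    have sub: "(\<lambda>i. \<sigma> i (1/w)) ` {..<n} \<subseteq> F"
      unfolding F using \<sigma>(2)[OF _ iw] by blast
    have "inj_on (\<lambda>i. \<sigma> i (1/w)) {..<n}"
    proof (rule inj_onI)
      fix i j assume ij: "i \<in> {..<n}" "j \<in> {..<n}" "\<sigma> i (1/w) = \<sigma> j (1/w)"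
      have "\<sigma> i (1/w) \<in> D i" "\<sigma> i (1/w) \<in> D j"
        using \<sigma>(2)[OF _ iw, of i] \<sigma>(2)[OF _ iw, of j] ij by auto
      thus "i = j" using dD ij(1,2) unfolding disjoint_family_on_def by blast
    qed
    hence cn: "card ((\<lambda>i. \<sigma> i (1/w)) ` {..<n}) = n" by (simp add: card_image)
    hence im: "(\<lambda>i. \<sigma> i (1/w)) ` {..<n} = F" using card_seteq[OF fin(1) sub] fin(2) by simp
    \<comment> \<open>The branches give \<open>n\<close> distinct points over \<open>w\<close>, so
      no value of modulus \<open>r\<close> is exceptional and every level point of P'/Q' comes from
      \<open>\<phi>\<close>.\<close>
    hence "card F = n" using cn by simp
    hence "w \<notin> exceptional" using w0 by (simp add: exceptional_def F_def)
    then obtain z where z: "y = \<phi> z" "poly P z = w * poly Q z"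
      using fibre_point[OF w] cw r by auto
    then obtain i where i: "i < n" "z = \<sigma> i (1/w)" using im unfolding F_def by blast
    have "y = c i (of_real r / w)" using z(1) i(2) r0 by (simp add: c_def)
    moreover have "of_real r / w \<in> sphere 0 1" using cw r0 by (simp add: norm_divide)
    ultimately show "y \<in> (\<Union>i<n. c i ` sphere 0 1)" using i(1) by blast
  next
    fix y assume "y \<in> (\<Union>i<n. c i ` sphere 0 1)"
    then obtain i t where it: "i < n" "t \<in> sphere 0 1" "y = c i t" by auto
    show "y \<in> level P' Q' r"
      unfolding it(3) c_def using transfer(2)[OF inS[OF it(1,2)]] lev[OF it(1,2)] by blast
  qed
  have rS: "sublevel P Q r \<subseteq> sublevel P Q 1" by (rule sublevel_mono) (use r in simp)
  have cE: "connected (\<phi> ` sublevel P Q r)"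
    by (rule connected_continuous_image[OF continuous_on_subset[OF holomorphic_on_imp_continuous_on[OF hol] rS] conn])
  have ES: "\<phi> ` sublevel P Q r \<subseteq> sublevel P' Q' r"
    using transfer(1) rS by blast
  show ?thesis
  proof (rule Jordan_pieces[OF coprime_image deg' r0 n' _ _ _ lev' cE ES
        sublevel_subset_closure_image[OF r0 less_imp_le[OF r(2)]]])
    fix K assume K: "\<And>i. i < n \<Longrightarrow> compact (K i)" "\<And>i. i < n \<Longrightarrow> \<exists>z\<in>K i. poly Q' z = 0"
      "disjoint_family_on K {..<n}" "level P' Q' r \<union> superlevel P' Q' r = (\<Union>i<n. K i)"
    show thesis
      by (rule exists_branched[OF coprime_image deg' r0 n' K(1) K(2) K(3) K(4)]) (assumption | rule that)+
  qed (fact cont, fact injc, fact disj)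
qed

end

section \<open>Extension to an entire function\<close>

lemma entire_asymptotic_identity:
  fixes F :: "complex \<Rightarrow> complex"
  assumes hol: "F holomorphic_on UNIV" and lim: "((\<lambda>z. F z / z) \<longlongrightarrow> 1) at_infinity"
  shows "F z = z + F 0"
proof -
  have "\<forall>\<^sub>F z in at_infinity. dist (F z / z) 1 < 1" using lim by (rule tendstoD) simp
  then obtain b where b: "\<And>z. b \<le> cmod z \<Longrightarrow> dist (F z / z) 1 < 1"
    unfolding eventually_at_infinity by blast
  have bd: "cmod (F z) \<le> 2 * cmod z ^ 1" if "max b 1 \<le> cmod z" for z :: complex
  proof -
    have "cmod (F z / z - 1) < 1" using b[of z] that by (simp add: dist_norm)
    hence "cmod (F z / z) \<le> 2" using norm_triangle_ineq2[of "F z / z" 1] by simp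
    moreover have "cmod z > 0" using that by auto
    ultimately show ?thesis by (simp add: norm_divide divide_le_eq)
  qed
  have F: "F z = F 0 + deriv F 0 * z" for z :: complex
    using Liouville_polynomial[of F "max b 1" 2 1 z, OF hol bd] by simp
  have "((\<lambda>z::complex. F 0 / z + deriv F 0) \<longlongrightarrow> 0 + deriv F 0) at_infinity"
    by (intro tendsto_add tendsto_const tendsto_divide_0[OF tendsto_const] filterlim_ident)
  moreover have "\<forall>\<^sub>F z::complex in at_infinity. F 0 / z + deriv F 0 = F z / z"
    unfolding eventually_at_infinity
  proof (intro exI[of _ 1] allI impI)
    fix z :: complex assume "1 \<le> cmod z"
    hence "z \<noteq> 0" by auto
    thus "F 0 / z + deriv F 0 = F z / z" unfolding F[of z] by (simp add: add_divide_distrib)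
  qed
  ultimately have "((\<lambda>z. F z / z) \<longlongrightarrow> 0 + deriv F 0) at_infinity"
    by (rule Lim_transform_eventually)
  hence "deriv F 0 = 1"
    using tendsto_unique[OF _ _ lim] trivial_limit_at_infinity by fastforce
  thus ?thesis using F[of z] by simp
qed

text \<open>The part of |P/Q| < 1 inside a piece around a pole corresponds under Q/P to a round
  annulus. It is connected, so \<open>\<phi>\<close> maps it into a single piece for P'/Q', and one
  inverse branch continues \<open>\<phi>\<close> over the whole piece.\<close>

lemma (in rational_conjugation) is_translation:
  assumes conn: "connected (sublevel P Q 1)" and br: "branched n P Q \<rho> D" and \<rho>1: "\<rho> < 1"
  shows "\<exists>c. \<forall>z\<in>sublevel P Q 1. \<phi> z = z + c"
proof -
  define S where "S = sublevel P Q 1"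
  have oS: "open S" by (simp add: S_def open_sublevel)
  have \<rho>0: "\<rho> > 0" and oD: "\<And>i. i < n \<Longrightarrow> open (D i)" and dD: "disjoint_family_on D {..<n}"
    and UD: "(\<Union>i<n. D i) = superlevel P Q \<rho>"
    using br by (auto simp: branched_def)
  obtain r1 where r1: "0 < r1" "r1 < 1" "\<And>r. r1 < r \<Longrightarrow> r < 1 \<Longrightarrow> connected (sublevel P Q r)"
    using connected_sublevel_near[OF PQ conn] by metis
  define r where "r = (max \<rho> r1 + 1) / 2"
  have r: "\<rho> < r" "r1 < r" "r < 1" using \<rho>1 r1(2) by (auto simp: r_def)
  obtain \<rho>' D' where \<rho>'r: "\<rho>' < r" and br': "branched n P' Q' \<rho>' D'"
    using exists_branched_image[OF r1(3)[OF r(2,3)] br r(1,3)] by metis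
  have \<rho>'0: "\<rho>' > 0" and oD': "\<And>i. i < n \<Longrightarrow> open (D' i)" and dD': "disjoint_family_on D' {..<n}"
    and UD': "(\<Union>i<n. D' i) = superlevel P' Q' \<rho>'"
    using br' by (auto simp: branched_def)
  \<comment> \<open>A common level above which both functions have inverse branches. It is below 1,
    so the pieces \<open>B i\<close> overlap \<open>S\<close> and together with it cover the
    plane.\<close>
  define \<rho>0 where "\<rho>0 = max \<rho> \<rho>'"
  have \<rho>00: "\<rho>0 > 0" "\<rho>0 < 1" "\<rho> \<le> \<rho>0" "\<rho>' \<le> \<rho>0" using \<rho>0 \<rho>1 \<rho>'r r by (auto simp: \<rho>0_def)
  have mono: "superlevel P Q \<rho>0 \<subseteq> superlevel P Q \<rho>" "superlevel P' Q' \<rho>0 \<subseteq> superlevel P' Q' \<rho>'"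
    using superlevel_mono \<rho>00(3,4) by blast+
  define v where "v z = poly Q z / poly P z" for z
  obtain \<sigma> where \<sigma>: "\<And>i. i < n \<Longrightarrow> \<sigma> i holomorphic_on ball 0 (1/\<rho>)"
    "\<And>i w. i < n \<Longrightarrow> cmod w < 1/\<rho> \<Longrightarrow> \<sigma> i w \<in> D i \<and> poly Q (\<sigma> i w) = w * poly P (\<sigma> i w)"
    "\<And>i z. i < n \<Longrightarrow> z \<in> D i \<Longrightarrow> \<sigma> i (v z) = z"
    using branched_inverses[OF PQ(1) br] unfolding v_def by metis
  obtain \<tau> where \<tau>: "\<And>i. i < n \<Longrightarrow> \<tau> i holomorphic_on ball 0 (1/\<rho>')"
    "\<And>i z. i < n \<Longrightarrow> z \<in> D' i \<Longrightarrow> \<tau> i (poly Q' z / poly P' z) = z"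
    using branched_inverses[OF coprime_image br'] by metis
  define B where "B i = D i \<inter> superlevel P Q \<rho>0" for i
  have oB: "open (B i)" if "i < n" for i
    unfolding B_def by (intro open_Int oD[OF that] open_superlevel)
  have UB: "(\<Union>i<n. B i) = superlevel P Q \<rho>0" using UD mono(1) by (auto simp: B_def)
  have vB: "poly P z \<noteq> 0" "cmod (v z) < 1 / \<rho>0" if "z \<in> B i" for i z
    using level_ratio[OF PQ(1), of z \<rho>0] that \<rho>00(1) by (auto simp: B_def v_def)
  \<comment> \<open>The overlap of the i-th piece with \<open>S\<close> in the coordinate w = Q/P,
    where |P/Q| < 1 reads 1 < |w|. The subtracted 0 fits the form of
    \<open>connected_annulus\<close>.\<close>
  define A where "A i = \<sigma> i ` {w. 1 < cmod (w - 0) \<and> cmod (w - 0) < 1/\<rho>0}" for i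
  have le: "1 / \<rho>0 \<le> 1 / \<rho>" "1 / \<rho>0 \<le> 1 / \<rho>'" using \<rho>00 \<rho>0 \<rho>'0 by (auto intro: divide_left_mono)
  have one: "1 < 1 / \<rho>0" using \<rho>00 by simp
  have cA: "connected (A i)" if "i < n" for i
    unfolding A_def
  proof (rule connected_continuous_image)
    show "continuous_on {w. 1 < cmod (w - 0) \<and> cmod (w - 0) < 1/\<rho>0} (\<sigma> i)"
      by (rule continuous_on_subset[OF holomorphic_on_imp_continuous_on[OF \<sigma>(1)[OF that]]])
         (use le(1) in auto)
    show "connected {w::complex. 1 < cmod (w - 0) \<and> cmod (w - 0) < 1/\<rho>0}"
      by (rule connected_annulus) simp
  qed
  have A_iff: "A i = B i \<inter> S" if i: "i < n" for i
  proof (intro equalityI subsetI)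
    fix z assume "z \<in> A i"
    then obtain w where w: "1 < cmod w" "cmod w < 1/\<rho>0" "z = \<sigma> i w" by (auto simp: A_def)
    have z: "z \<in> D i" "poly Q z = w * poly P z" using \<sigma>(2)[OF i, of w] w le(1) by auto
    have P0: "poly P z \<noteq> 0" using level_ratio(1)[OF PQ(1) _ \<rho>0, of z] z(1) UD i by blast
    have "cmod (poly P z) * 1 < cmod (poly P z) * cmod w" using w(1) P0 by (intro mult_strict_left_mono) auto
    hence "z \<in> S" using z(2) by (simp add: S_def sublevel_def norm_mult mult.commute)
    moreover have "\<rho>0 * cmod w < 1" using w(2) \<rho>00(1) by (simp add: less_divide_eq mult.commute)
    hence "(\<rho>0 * cmod w) * cmod (poly P z) < 1 * cmod (poly P z)" using P0 by (intro mult_strict_right_mono) auto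
    hence "z \<in> superlevel P Q \<rho>0" using z(2) by (simp add: superlevel_def norm_mult mult.assoc)
    ultimately show "z \<in> B i \<inter> S" using z(1) by (simp add: B_def)
  next
    fix z assume z: "z \<in> B i \<inter> S"
    have zB: "z \<in> B i" "z \<in> D i" using z by (auto simp: B_def)
    have "cmod (poly P z) < cmod (poly Q z)" using z by (simp add: S_def sublevel_def)
    hence "1 < cmod (v z)" using vB(1)[OF zB(1)] by (simp add: v_def norm_divide)
    thus "z \<in> A i" using vB(2)[OF zB(1)] \<sigma>(3)[OF i zB(2)] unfolding A_def
      by (metis (mono_tags, lifting) diff_zero image_eqI mem_Collect_eq)
  qed
  have "\<exists>j<n. \<phi> ` A i \<subseteq> D' j" if i: "i < n" for i
  proof -
    have "(1 + 1/\<rho>0) / 2 > 1" "(1 + 1/\<rho>0) / 2 < 1/\<rho>0" using one by auto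
    hence "of_real ((1 + 1/\<rho>0) / 2) \<in> {w::complex. 1 < cmod (w - 0) \<and> cmod (w - 0) < 1/\<rho>0}"
      unfolding mem_Collect_eq diff_zero norm_of_real by linarith
    hence ne: "\<phi> ` A i \<noteq> {}" unfolding A_def by blast
    have AS: "A i \<subseteq> S" using A_iff[OF i] by blast
    have "connected (\<phi> ` A i)"
      by (rule connected_continuous_image[OF continuous_on_subset[OF holomorphic_on_imp_continuous_on[OF hol]] cA[OF i]])
         (use AS S_def in simp)
    moreover have "\<phi> ` A i \<subseteq> (\<Union>j<n. D' j)"
    proof
      fix y assume "y \<in> \<phi> ` A i"
      then obtain z where z: "z \<in> A i" "y = \<phi> z" by blast
      have "z \<in> superlevel P Q \<rho>0" "z \<in> sublevel P Q 1" using z(1) A_iff[OF i] by (auto simp: B_def S_def)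
      hence "y \<in> superlevel P' Q' \<rho>0" using transfer(3) z(2) by blast
      thus "y \<in> (\<Union>j<n. D' j)" using mono(2) UD' by blast
    qed
    ultimately show ?thesis using connected_in_disjoint_family[OF _ ne _ oD' dD'] by metis
  qed
  then obtain j where j: "\<And>i. i < n \<Longrightarrow> j i < n" "\<And>i. i < n \<Longrightarrow> \<phi> ` A i \<subseteq> D' (j i)" by metis
  \<comment> \<open>\<open>\<phi> z\<close> lies in \<open>D' (j i)\<close> and has the value
    \<open>v z\<close> under Q'/P', so the branch \<open>\<tau> (j i)\<close> returns it; the two
    definitions agree on the overlap.\<close>
  have ext: "\<tau> (j i) (v z) = \<phi> z" if i: "i < n" and z: "z \<in> B i" "z \<in> S" for i z
  proof -
    have yD: "\<phi> z \<in> D' (j i)" using j(2)[OF i] A_iff[OF i] z by blast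
    have "\<phi> z \<in> superlevel P' Q' \<rho>'" using yD UD' j(1)[OF i] by blast
    hence P'0: "poly P' (\<phi> z) \<noteq> 0" using level_ratio(1)[OF coprime_image _ \<rho>'0] by blast
    have "poly P' (\<phi> z) * poly Q z = poly P z * poly Q' (\<phi> z)" using eq z(2) by (simp add: S_def)
    hence "v z = poly Q' (\<phi> z) / poly P' (\<phi> z)" using P'0 vB(1)[OF z(1)] by (simp add: v_def field_simps)
    thus ?thesis using \<tau>(2)[OF j(1)[OF i] yD] by simp
  qed
  define idx where "idx z = (SOME i. i < n \<and> z \<in> B i)" for z
  have idx: "idx z = i" if "i < n" "z \<in> B i" for i z
  proof -
    have "idx z < n \<and> z \<in> B (idx z)" unfolding idx_def by (rule someI[of _ i]) (use that in blast)
    hence "idx z \<in> {..<n}" "z \<in> D (idx z) \<inter> D i" using that by (auto simp: B_def)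
    thus ?thesis using dD that(1) unfolding disjoint_family_on_def by (metis empty_iff lessThan_iff)
  qed
  define \<Phi> where "\<Phi> z = (if z \<in> S then \<phi> z else \<tau> (j (idx z)) (v z))" for z
  have \<Phi>B: "\<Phi> z = \<tau> (j i) (v z)" if "i < n" "z \<in> B i" for i z
    using ext[OF that] idx[OF that] by (simp add: \<Phi>_def)
  have cover: "z \<in> S \<or> (\<exists>i<n. z \<in> B i)" for z
  proof (cases "z \<in> S")
    case False
    hence ge: "cmod (poly Q z) \<le> cmod (poly P z)" by (simp add: S_def sublevel_def)
    have P0: "poly P z \<noteq> 0" using ge coprime_poly_0[OF PQ(1), of z] by auto
    have "\<rho>0 * cmod (poly Q z) \<le> \<rho>0 * cmod (poly P z)" using ge \<rho>00(1) by simp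
    also have "\<dots> < 1 * cmod (poly P z)" using P0 \<rho>00(2) by (intro mult_strict_right_mono) auto
    finally have "z \<in> superlevel P Q \<rho>0" by (simp add: superlevel_def)
    thus ?thesis using UB by blast
  qed simp
  have "\<Phi> field_differentiable at z" for z
  proof (cases "z \<in> S")
    case True
    have "\<phi> holomorphic_on S" using hol by (simp add: S_def)
    hence "\<Phi> holomorphic_on S" by (rule holomorphic_transform) (simp add: \<Phi>_def)
    thus ?thesis using oS True by (simp add: holomorphic_on_imp_differentiable_at)
  next
    case False
    then obtain i where i: "i < n" "z \<in> B i" using cover by blast
    have "v holomorphic_on B i" unfolding v_def using vB(1) by (intro holomorphic_intros) auto
    hence "(\<tau> (j i) \<circ> v) holomorphic_on B i"
      by (rule holomorphic_on_compose_gen[OF _ \<tau>(1)[OF j(1)[OF i(1)]]])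
         (use vB(2) le(2) in \<open>fastforce\<close>)
    hence "\<Phi> holomorphic_on B i" by (rule holomorphic_transform) (simp add: \<Phi>B[OF i(1)])
    thus ?thesis using oB[OF i(1)] i(2) by (simp add: holomorphic_on_imp_differentiable_at)
  qed
  hence hol\<Phi>: "\<Phi> holomorphic_on UNIV"
    by (auto simp: holomorphic_on_def intro: field_differentiable_at_within)
  obtain b where b: "b > 0" "\<And>z. b \<le> cmod z \<Longrightarrow> z \<in> S"
    using sublevel_contains_infinity[OF PQ(2), of 1] unfolding S_def by auto
  have "\<forall>\<^sub>F z in at_infinity. \<phi> z / z = \<Phi> z / z"
    unfolding eventually_at_infinity \<Phi>_def using b(2) by auto
  hence "((\<lambda>z. \<Phi> z / z) \<longlongrightarrow> 1) at_infinity" using lim tendsto_cong by fast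
  hence "\<Phi> z = z + \<Phi> 0" for z by (rule entire_asymptotic_identity[OF hol\<Phi>])
  hence "\<forall>z\<in>S. \<phi> z = z + \<Phi> 0" unfolding \<Phi>_def by metis
  thus ?thesis unfolding S_def by blast
qed

section \<open>The Riemann sphere\<close>

text \<open>Inverse stereographic projection in homogeneous coordinates: the point (a : b), with
  infinity as (1 : 0). Values of rational maps can be compared without splitting off the
  poles.\<close>

definition sph :: "complex \<Rightarrow> complex \<Rightarrow> real \<times> real \<times> real" where
  "sph a b = (2 * Re (a * cnj b) / ((cmod a)\<^sup>2 + (cmod b)\<^sup>2), 2 * Im (a * cnj b) / ((cmod a)\<^sup>2 + (cmod b)\<^sup>2),
     ((cmod a)\<^sup>2 - (cmod b)\<^sup>2) / ((cmod a)\<^sup>2 + (cmod b)\<^sup>2))"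

lemma sp_None: "sp None = sph 1 0"
  by (simp add: sp_def sph_def)

lemma sp_Some: "sp (Some z) = sph z 1"
  by (simp add: sp_def sph_def add.commute)

lemma sph_scale:
  assumes "c \<noteq> 0"
  shows "sph (c * a) (c * b) = sph a b"
proof -
  have "(c * a) * cnj (c * b) = (c * cnj c) * (a * cnj b)" by (simp add: mult_ac)
  hence m: "(c * a) * cnj (c * b) = of_real ((cmod c)\<^sup>2) * (a * cnj b)"
    unfolding complex_norm_square .
  have ReIm: "Re (of_real t * w) = t * Re w" "Im (of_real t * w) = t * Im w" for t w by simp_all
  have e: "Re ((c * a) * cnj (c * b)) = (cmod c)\<^sup>2 * Re (a * cnj b)"
    "Im ((c * a) * cnj (c * b)) = (cmod c)\<^sup>2 * Im (a * cnj b)"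
    unfolding m ReIm by (rule refl)+
  have c: "(cmod c)\<^sup>2 \<noteq> 0" using assms by simp
  show ?thesis
    unfolding sph_def e norm_mult power_mult_distrib distrib_left[symmetric] right_diff_distrib[symmetric]
    using c by (simp add: mult.left_commute)
qed

lemma sph_ratio: "b \<noteq> 0 \<Longrightarrow> sp (Some (a / b)) = sph a b"
  using sph_scale[of b "a / b" 1] by (simp add: sp_Some)

lemma continuous_on_sph: "continuous_on (- {(0, 0)}) (\<lambda>(a, b). sph a b)"
proof -
  have "(cmod a)\<^sup>2 + (cmod b)\<^sup>2 \<noteq> 0" if "(a, b) \<noteq> (0, 0)" for a b :: complex
    using that by (auto simp: sum_power2_eq_zero_iff)
  thus ?thesis unfolding sph_def case_prod_beta
    by (intro continuous_intros) (auto simp: prod_eq_iff)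
qed

lemma continuous_on_sph_compose:
  assumes "continuous_on S f" "continuous_on S g" "\<And>x. x \<in> S \<Longrightarrow> f x \<noteq> 0 \<or> g x \<noteq> 0"
  shows "continuous_on S (\<lambda>x. sph (f x) (g x))"
proof -
  have "continuous_on S (\<lambda>x. (f x, g x))" by (intro continuous_intros assms)
  moreover have "(\<lambda>x. (f x, g x)) ` S \<subseteq> - {(0, 0)}" using assms(3) by auto
  ultimately show ?thesis using continuous_on_compose2[OF continuous_on_sph] by fastforce
qed

lemma continuous_on_sp: "continuous_on S (\<lambda>z. sp (Some z))"
  unfolding sp_Some by (intro continuous_on_sph_compose continuous_intros) auto

definition stereo :: "real \<times> real \<times> real \<Rightarrow> complex" where
  "stereo q = Complex (fst q / (1 - snd (snd q))) (fst (snd q) / (1 - snd (snd q)))"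

lemma snd_sp_less: "snd (snd (sp (Some z))) < 1"
  by (simp add: sp_def divide_less_eq add_pos_nonneg)

lemma stereo_sp: "stereo (sp (Some z)) = z"
proof -
  have pos: "1 + (cmod z)\<^sup>2 > 0" by (simp add: add_pos_nonneg)
  have "1 - ((cmod z)\<^sup>2 - 1) / (1 + (cmod z)\<^sup>2) = 2 / (1 + (cmod z)\<^sup>2)"
    using pos by (simp add: field_simps)
  thus ?thesis using pos by (simp add: stereo_def sp_def)
qed

lemma sp_inj: "sp p = sp q \<longleftrightarrow> p = q"
proof
  assume eq: "sp p = sp q"
  have N: "sp None \<noteq> sp (Some z)" for z
    using snd_sp_less[of z] by (auto simp: sp_def)
  show "p = q"
    by (cases p; cases q) (use eq N N[symmetric] stereo_sp in \<open>auto, metis\<close>)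
qed auto

lemma open_stereo_vimage:
  assumes "open B"
  shows "open {q. snd (snd q) < 1 \<and> stereo q \<in> B}"
proof -
  have "continuous_on {q. snd (snd q) < (1::real)} stereo"
    unfolding stereo_def Complex_eq
    by (intro continuous_intros) auto
  moreover have "open {q :: real \<times> real \<times> real. snd (snd q) < (1::real)}"
    by (intro open_Collect_less continuous_intros)
  ultimately have "open ({q. snd (snd q) < 1} \<inter> stereo -` B)"
    using assms by (rule continuous_open_preimage)
  thus ?thesis by (simp add: Int_def vimage_def)
qed

lemma sp_tendsto_None: "((\<lambda>z. sp (Some z)) \<longlongrightarrow> sp None) at_infinity"
proof -
  have "isCont (\<lambda>t. sph 1 t) 0"
    using continuous_on_sph_compose[of UNIV "\<lambda>_. 1" "\<lambda>t. t"] by (auto simp: continuous_on_eq_continuous_at)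
  moreover have "((\<lambda>z::complex. 1 / z) \<longlongrightarrow> 0) at_infinity"
    by (intro tendsto_divide_0[OF tendsto_const] filterlim_ident)
  ultimately have "((\<lambda>z. sph 1 (1 / z)) \<longlongrightarrow> sph 1 0) at_infinity"
    by (rule isCont_tendsto_compose)
  moreover have "\<forall>\<^sub>F z in at_infinity. sph 1 (1 / z) = sp (Some z)"
    unfolding eventually_at_infinity
  proof (intro exI[of _ 1] allI impI)
    fix z :: complex assume "1 \<le> cmod z"
    hence "z \<noteq> 0" by auto
    thus "sph 1 (1 / z) = sp (Some z)" using sph_scale[of z 1 "1 / z"] by (simp add: sp_Some)
  qed
  ultimately show ?thesis unfolding sp_None using tendsto_cong by fast
qed

text \<open>The squared chordal distance is 4 |z - w|^2 / ((1 + |z|^2)(1 + |w|^2)), and both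
  denominators are at least 1.\<close>

lemma dist_sp_le: "dist (sp (Some z)) (sp (Some w)) \<le> 2 * dist z w"
proof -
  define a b c d where "a = Re z" "b = Im z" "c = Re w" "d = Im w"
  define A B where "A = 1 + (cmod z)\<^sup>2" "B = 1 + (cmod w)\<^sup>2"
  define p q where "p = 1 / A" "q = 1 / B"
  have AB: "A \<ge> 1" "B \<ge> 1" by (simp_all add: A_B_def)
  have pq: "p * A = 1" "q * B = 1" "0 \<le> p" "p \<le> 1" "0 \<le> q" "q \<le> 1"
    using AB by (simp_all add: p_q_def divide_le_eq)
  have Ae: "A = 1 + a^2 + b^2" "B = 1 + c^2 + d^2" by (simp_all add: A_B_def a_b_c_d_def cmod_power2)
  have spz: "sp (Some z) = (2*a*p, 2*b*p, 1 - 2*p)" "sp (Some w) = (2*c*q, 2*d*q, 1 - 2*q)"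
  proof -
    have "((cmod z)\<^sup>2 - 1) / A = 1 - 2 * p" "((cmod w)\<^sup>2 - 1) / B = 1 - 2 * q"
    proof -
      have e: "(cmod z)\<^sup>2 - 1 = A - 2" "(cmod w)\<^sup>2 - 1 = B - 2" by (simp_all add: A_B_def)
      show "((cmod z)\<^sup>2 - 1) / A = 1 - 2 * p" "((cmod w)\<^sup>2 - 1) / B = 1 - 2 * q"
        unfolding e using AB by (simp_all add: p_q_def diff_divide_distrib)
    qed
    thus "sp (Some z) = (2*a*p, 2*b*p, 1 - 2*p)" "sp (Some w) = (2*c*q, 2*d*q, 1 - 2*q)"
      unfolding A_B_def by (simp_all add: sp_def a_b_c_d_def p_q_def A_B_def)
  qed
  have "(dist (sp (Some z)) (sp (Some w)))\<^sup>2 = (2*a*p - 2*c*q)^2 + ((2*b*p - 2*d*q)^2 + ((1 - 2*p) - (1 - 2*q))^2)"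
    unfolding spz dist_prod_def by (simp add: dist_real_def)
  also have "\<dots> = 4 * (p * (p * A) + q * (q * B) - 2 * (a*c + b*d + 1) * p * q)"
    unfolding Ae by (simp add: power2_eq_square algebra_simps)
  \<comment> \<open>As \<open>p * A\<close> and \<open>q * B\<close> are both 1 they may be
    exchanged, which makes \<open>p * q\<close> a common factor.\<close>
  also have "\<dots> = 4 * (p * (q * B) + q * (p * A) - 2 * (a*c + b*d + 1) * p * q)" unfolding pq by simp
  also have "\<dots> = 4 * (p * q * ((a - c)^2 + (b - d)^2))"
    unfolding Ae by (simp add: power2_eq_square algebra_simps)
  also have "(a - c)^2 + (b - d)^2 = (dist z w)\<^sup>2" by (simp add: a_b_c_d_def dist_norm cmod_power2)
  also have "4 * (p * q * (dist z w)\<^sup>2) \<le> 4 * (1 * (dist z w)\<^sup>2)"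
    using pq by (intro mult_left_mono mult_right_mono mult_le_one) auto
  also have "\<dots> = (2 * dist z w)\<^sup>2" by (simp add: power_mult_distrib)
  finally show ?thesis by (rule power2_le_imp_le) simp
qed

lemma compact_sp_image: "compact K \<Longrightarrow> compact (sp ` Some ` K)"
  using compact_continuous_image[OF continuous_on_sp, of K] by (simp add: image_image)

text \<open>The chart \<open>t = 1 / z\<close> exhibits this set as the image of a closed disc, with
  \<open>t = 0\<close> giving infinity.\<close>

lemma compact_sp_exterior:
  assumes "r > 0"
  shows "compact (sp ` hat {z. r \<le> cmod z})"
proof -
  have "compact ((\<lambda>t. sph 1 t) ` cball 0 (1/r))"
    by (intro compact_continuous_image continuous_on_sph_compose continuous_intros) auto
  moreover have "(\<lambda>t. sph 1 t) ` cball 0 (1/r) = sp ` hat {z. r \<le> cmod z}"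
  proof -
    have e: "sph 1 t = sp (Some (1 / t))" if "t \<noteq> 0" for t
      using sph_scale[of t "1/t" 1] that by (simp add: sp_Some)
    show ?thesis
    proof (intro equalityI subsetI)
      fix q assume "q \<in> (\<lambda>t. sph 1 t) ` cball 0 (1/r)"
      then obtain t where t: "cmod t \<le> 1/r" "q = sph 1 t" by auto
      show "q \<in> sp ` hat {z. r \<le> cmod z}"
      proof (cases "t = 0")
        case True thus ?thesis using t sp_None by (auto simp: hat_def)
      next
        case False
        have "r \<le> cmod (1 / t)" using t(1) False assms by (simp add: norm_divide field_simps)
        thus ?thesis using e[OF False] t(2) by (auto simp: hat_def)
      qed
    next
      fix q assume "q \<in> sp ` hat {z. r \<le> cmod z}"
      then consider "q = sph 1 0" | z where "r \<le> cmod z" "q = sp (Some z)"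
        by (auto simp: hat_def sp_None)
      thus "q \<in> (\<lambda>t. sph 1 t) ` cball 0 (1/r)"
      proof cases
        case 1 thus ?thesis using assms by auto
      next
        case 2
        have z0: "z \<noteq> 0" using 2 assms by auto
        have "q = sph 1 (1 / z)" using e[of "1 / z"] z0 2 by simp
        moreover have "1 / z \<in> cball 0 (1/r)" using 2 assms by (simp add: norm_divide frac_le)
        ultimately show ?thesis by blast
      qed
    qed
  qed
  ultimately show ?thesis by simp
qed

lemma sp_in_hat: "sp (Some z) \<in> sp ` hat X \<longleftrightarrow> z \<in> X"
  by (auto simp: hat_def sp_inj)

text \<open>Removing infinity does not disconnect: the exterior of a large disc is connected, so it
  falls on one side of any separation of \<open>X\<close>, and adding infinity to that side would
  separate \<open>hat X\<close>.\<close>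

lemma domain_infD:
  assumes "domain_inf X"
  obtains r where "r > 0" "\<And>z. r \<le> cmod z \<Longrightarrow> z \<in> X" "open X" "connected X"
proof -
  obtain T where T: "open T" "sp ` hat X = range sp \<inter> T"
    using assms by (auto simp: domain_inf_def openin_open)
  have X: "X = (\<lambda>z. sp (Some z)) -` T"
  proof (intro equalityI subsetI)
    fix z assume "z \<in> X"
    hence "sp (Some z) \<in> sp ` hat X" by (simp add: sp_in_hat)
    thus "z \<in> (\<lambda>z. sp (Some z)) -` T" using T(2) by blast
  next
    fix z assume "z \<in> (\<lambda>z. sp (Some z)) -` T"
    hence "sp (Some z) \<in> sp ` hat X" using T(2) by blast
    thus "z \<in> X" by (simp add: sp_in_hat)
  qed
  have oX: "open X" unfolding X by (intro open_vimage T(1) continuous_on_sp)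
  have "sp None \<in> T" using T(2) by (auto simp: hat_def)
  hence "\<forall>\<^sub>F z in at_infinity. sp (Some z) \<in> T" using T(1) sp_tendsto_None topological_tendstoD by fast
  then obtain b where b: "\<And>z. b \<le> cmod z \<Longrightarrow> z \<in> X" unfolding eventually_at_infinity X by auto
  define r where "r = max b 1"
  have r: "r > 0" "\<And>z. r \<le> cmod z \<Longrightarrow> z \<in> X" using b by (auto simp: r_def)
  have empty: "B = {}" if AB: "open A" "open B" "A \<inter> B = {}" "X = A \<union> B" "- ball 0 r \<subseteq> A" for A B
  proof (rule ccontr)
    assume ne: "B \<noteq> {}"
    \<comment> \<open>\<open>TA\<close> is the complement of a compact set of finite points, hence
      contains infinity; \<open>TB\<close> is the open set of finite points read off through the
      stereographic chart.\<close>
    define TA where "TA = - (sp ` Some ` (- A))"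
    define TB where "TB = {q. snd (snd q) < 1 \<and> stereo q \<in> B}"
    have "bounded (- A)" using AB(5) bounded_subset[of "ball 0 r" "- A"] by auto
    hence "compact (- A)" using AB(1) by (simp add: compact_eq_bounded_closed closed_Compl)
    hence "open TA" unfolding TA_def by (intro open_Compl compact_imp_closed compact_sp_image)
    moreover have "open TB" unfolding TB_def by (rule open_stereo_vimage[OF AB(2)])
    moreover have inB: "sp (Some z) \<in> TB \<longleftrightarrow> z \<in> B" for z
      using snd_sp_less[of z] by (simp add: TB_def stereo_sp)
    have NB: "sp None \<notin> TB" by (simp add: TB_def sp_def)
    have inA: "sp (Some z) \<in> TA \<longleftrightarrow> z \<in> A" for z by (auto simp: TA_def sp_inj)
    have NA: "sp None \<in> TA" by (auto simp: TA_def sp_inj)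
    have "sp ` hat X \<subseteq> TA \<union> TB" using NA inA inB AB(4) by (auto simp: hat_def)
    moreover have "TA \<inter> TB \<inter> sp ` hat X = {}" using NB inA inB AB(3) by (auto simp: hat_def)
    moreover have "TA \<inter> sp ` hat X \<noteq> {}" using NA by (auto simp: hat_def)
    moreover have "TB \<inter> sp ` hat X \<noteq> {}"
    proof -
      obtain z where "z \<in> B" using ne by blast
      hence "sp (Some z) \<in> TB \<inter> sp ` hat X" using inB AB(4) by (simp add: sp_in_hat)
      thus ?thesis by blast
    qed
    ultimately show False using assms connectedD unfolding domain_inf_def by metis
  qed
  have "connected (- ball (0::complex) r)"
    using connected_complement_bounded_convex[of "ball (0::complex) r"] by simp
  note conn = connectedD[OF this]
  have "connected X"
  proof (rule connectedI)
    fix A B assume AB: "open A" "open B" "A \<inter> X \<noteq> {}" "B \<inter> X \<noteq> {}" "A \<inter> B \<inter> X = {}" "X \<subseteq> A \<union> B"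
    have sub: "- ball 0 r \<subseteq> X" using r(2) by auto
    have "- ball 0 r \<subseteq> A \<or> - ball 0 r \<subseteq> B"
      using conn[OF AB(1,2)] AB(5,6) sub by blast
    thus False
    proof
      assume "- ball 0 r \<subseteq> A"
      thus False using empty[of "A \<inter> X" "B \<inter> X"] AB oX sub by blast
    next
      assume "- ball 0 r \<subseteq> B"
      thus False using empty[of "B \<inter> X" "A \<inter> X"] AB oX sub by blast
    qed
  qed
  thus ?thesis using that r oX by blast
qed

section \<open>From the sphere to level sets in the plane\<close>

lemma rat_pre_disc_eq:
  assumes "degree P < degree Q"
  shows "rat_pre_disc P Q = hat (sublevel P Q 1)"
proof -
  have "Some z \<in> rat_pre_disc P Q \<longleftrightarrow> z \<in> sublevel P Q 1" for z
  proof -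
    have "Some z \<in> rat_pre_disc P Q \<longleftrightarrow> poly Q z \<noteq> 0 \<and> cmod (poly P z / poly Q z) < 1"
      by (simp add: rat_pre_disc_def ratR_def)
    thus ?thesis by (auto simp: sublevel_def norm_divide divide_less_eq)
  qed
  moreover have "None \<in> rat_pre_disc P Q" using assms by (auto simp: rat_pre_disc_def ratR_def)
  ultimately have "p \<in> rat_pre_disc P Q \<longleftrightarrow> p \<in> hat (sublevel P Q 1)" for p
    by (cases p) (simp_all add: hat_def image_iff)
  thus ?thesis by (intro set_eqI)
qed

lemma analytic_jordan_parametrization:
  assumes "analytic_jordan \<Gamma>"
  shows "\<exists>c :: complex \<Rightarrow> complex. continuous_on (sphere 0 1) c \<and> inj_on c (sphere 0 1) \<and> \<Gamma> = c ` sphere 0 1"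
proof -
  obtain c r where c: "0 < r" "r < 1" "c holomorphic_on {z. r < cmod z \<and> cmod z < 1 / r}"
    "inj_on c {z. r < cmod z \<and> cmod z < 1 / r}" "\<Gamma> = c ` sphere 0 1"
    using assms unfolding analytic_jordan_def by (elim exE conjE)
  have sub: "sphere 0 1 \<subseteq> {z::complex. r < cmod z \<and> cmod z < 1 / r}" using c(1,2) by auto
  show ?thesis
    by (intro exI[of _ c] conjI continuous_on_subset[OF holomorphic_on_imp_continuous_on[OF c(3)] sub]
          inj_on_subset[OF c(4) sub] c(5))
qed

text \<open>The boundary on the sphere is the level set: level points are limits of sublevel points
  by \<open>level_subset_closure_sublevel\<close>, and a limit point cannot lie in the superlevel
  set, which is open on the sphere as well.\<close>

lemma n_good_level:
  assumes good: "n_good n P Q" and deg: "degree P < degree Q"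
  obtains c where "\<And>i. i < n \<Longrightarrow> continuous_on (sphere 0 1) (c i)"
    "\<And>i. i < n \<Longrightarrow> inj_on (c i) (sphere 0 1)"
    "\<And>i j. i < n \<Longrightarrow> j < n \<Longrightarrow> i \<noteq> j \<Longrightarrow> c i ` sphere 0 1 \<inter> c j ` sphere 0 1 = {}"
    "level P Q 1 = (\<Union>i<n. c i ` sphere (0::complex) 1)"
proof -
  have cop: "coprime P Q" using good by (auto simp: n_good_def rat_map_def)
  define S where "S = sublevel P Q 1"
  have pre: "rat_pre_disc P Q = hat S" unfolding S_def by (rule rat_pre_disc_eq[OF deg])
  obtain \<Gamma> where \<Gamma>': "\<forall>i<n. analytic_jordan (\<Gamma> i)"
    "\<forall>i<n. \<forall>j<n. i \<noteq> j \<longrightarrow> \<Gamma> i \<inter> \<Gamma> j = {}"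
    "closure (sp ` hat S) - sp ` hat S = (\<Union>i<n. sp ` Some ` \<Gamma> i)"
    using good unfolding n_good_def pre by (elim conjE exE)
  note \<Gamma> = \<Gamma>'[rule_format]
  define c :: "nat \<Rightarrow> complex \<Rightarrow> complex" where
    "c i = (SOME c. continuous_on (sphere 0 1) c \<and> inj_on c (sphere 0 1) \<and> \<Gamma> i = c ` sphere 0 1)" for i
  have c: "continuous_on (sphere 0 1) (c i)" "inj_on (c i) (sphere 0 1)" "\<Gamma> i = c i ` sphere 0 1" if "i < n" for i
    using someI_ex[OF analytic_jordan_parametrization[OF \<Gamma>(1)[OF that]]] unfolding c_def by auto
  have "level P Q 1 = (\<Union>i<n. \<Gamma> i)"
  proof (intro equalityI subsetI)
    fix z assume z: "z \<in> level P Q 1"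
    have "z \<in> closure S" using level_subset_closure_sublevel[OF cop deg, of 1] z by (auto simp: S_def)
    hence "sp (Some z) \<in> closure ((\<lambda>z. sp (Some z)) ` S)"
      using image_closure_subset[OF continuous_on_sp closed_closure closure_subset, of S] by blast
    moreover have "(\<lambda>z. sp (Some z)) ` S \<subseteq> sp ` hat S" by (auto simp: hat_def)
    ultimately have "sp (Some z) \<in> closure (sp ` hat S)" using closure_mono by blast
    moreover have "z \<notin> S" using z by (auto simp: S_def level_def sublevel_def)
    hence "sp (Some z) \<notin> sp ` hat S" by (simp add: sp_in_hat)
    ultimately have "sp (Some z) \<in> (\<Union>i<n. sp ` Some ` \<Gamma> i)" unfolding \<Gamma>(3)[symmetric] by (intro DiffI)
    thus "z \<in> (\<Union>i<n. \<Gamma> i)" by (auto simp: sp_inj)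
  next
    fix z assume "z \<in> (\<Union>i<n. \<Gamma> i)"
    hence "sp (Some z) \<in> (\<Union>i<n. sp ` Some ` \<Gamma> i)" by blast
    hence z: "sp (Some z) \<in> closure (sp ` hat S)" "z \<notin> S"
      unfolding \<Gamma>(3)[symmetric] Diff_iff sp_in_hat by (rule conjunct1, rule conjunct2)
    have "z \<notin> superlevel P Q 1"
    proof
      assume zO: "z \<in> superlevel P Q 1"
      define T where "T = {q. snd (snd q) < 1 \<and> stereo q \<in> superlevel P Q 1}"
      have "open T" unfolding T_def by (rule open_stereo_vimage[OF open_superlevel])
      moreover have "T \<inter> sp ` hat S = {}"
        using level_disjoint(3)[of P Q 1] by (auto simp: T_def hat_def stereo_sp S_def) (auto simp: sp_def)
      ultimately have "T \<inter> closure (sp ` hat S) = {}" by (simp add: open_Int_closure_eq_empty)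
      moreover have "sp (Some z) \<in> T" using zO snd_sp_less by (simp add: T_def stereo_sp)
      ultimately show False using z(1) by blast
    qed
    thus "z \<in> level P Q 1" using level_cases[of z P Q 1] z(2) by (auto simp: S_def)
  qed
  hence lev: "level P Q 1 = (\<Union>i<n. c i ` sphere 0 1)" using c(3) by auto
  have disj: "c i ` sphere 0 1 \<inter> c j ` sphere 0 1 = {}" if "i < n" "j < n" "i \<noteq> j" for i j
    using \<Gamma>(2)[OF that] c(3) that by auto
  show ?thesis by (rule that) (fact c(1), fact c(2), fact disj, fact lev)
qed

section \<open>Limits of polynomials and of conformal maps\<close>

lemma coeff_prod_linear:
  fixes A :: "complex set"
  assumes "finite A" "A \<noteq> {}"
  shows "coeff (\<Prod>a\<in>A. [:- a, 1:]) (card A - 1) = - \<Sum>A"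
  using assms
proof (induction rule: finite_ne_induct)
  case (insert a A)
  define q where "q = (\<Prod>a\<in>A. [:- a, 1:])"
  have dq: "degree q = card A"
    unfolding q_def by (subst degree_prod_eq_sum_degree) auto
  have "lead_coeff q = 1" unfolding q_def by (subst lead_coeff_prod) simp
  hence lc: "coeff q (card A) = 1" using dq by simp
  obtain m where m: "card A = Suc m" using insert by (cases "card A") auto
  have "(\<Prod>a\<in>insert a A. [:- a, 1:]) = [:- a, 1:] * q" using insert by (simp add: q_def)
  moreover have "coeff ([:- a, 1:] * q) (card A) = - a * coeff q (card A) + coeff q (card A - 1)"
    by (simp add: m)
  moreover have "coeff q (card A - 1) = - \<Sum>A" using insert.IH by (simp add: q_def)
  ultimately show ?case using insert lc by simp
qed simp

lemma monic_eq_prod_roots: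
  fixes q :: "complex poly"
  assumes "rsquarefree q" "lead_coeff q = 1"
  shows "q = (\<Prod>a | poly q a = 0. [:- a, 1:])"
  using complex_poly_decompose_rsquarefree[OF assms(1)] assms(2) by simp

text \<open>Vieta's formula. It replaces the condition on the sum of the poles by one on a
  coefficient, which is stable under limits.\<close>

lemma coeff_eq_sum_roots:
  fixes q :: "complex poly"
  assumes "rsquarefree q" "lead_coeff q = 1" "degree q > 0"
  shows "coeff q (degree q - 1) = - \<Sum>{a. poly q a = 0}"
proof -
  have q0: "q \<noteq> 0" using assms(2) by auto
  have c: "card {a. poly q a = 0} = degree q" by (rule card_roots_rsquarefree[OF assms(1)])
  have "{a. poly q a = 0} \<noteq> {}"
  proof
    assume "{a. poly q a = 0} = {}"
    with c assms(3) show False by simp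
  qed
  from coeff_prod_linear[OF poly_roots_finite[OF q0] this]
  show ?thesis unfolding monic_eq_prod_roots[OF assms(1,2), symmetric] c .
qed

lemma max_modulus_disc:
  assumes "f holomorphic_on UNIV" "\<And>z. cmod z = R \<Longrightarrow> cmod (f z) \<le> B" "cmod w \<le> R"
  shows "cmod (f w) \<le> B"
proof (rule maximum_modulus_frontier[of f "cball 0 R"])
  show "f holomorphic_on interior (cball 0 R)" by (rule holomorphic_on_subset[OF assms(1)]) auto
  show "continuous_on (closure (cball 0 R)) f"
    by (rule continuous_on_subset[OF holomorphic_on_imp_continuous_on[OF assms(1)]]) auto
  fix z assume "z \<in> frontier (cball (0::complex) R)"
  hence "cmod z = R" using frontier_cball[of "0::complex" R] by (auto split: if_splits)
  thus "cmod (f z) \<le> B" by (rule assms(2))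
qed (use assms(3) in auto)

text \<open>Removing the constant term and dividing by \<open>z\<close> lowers the index by one and
  at most doubles the bound on the unit circle, the constant term being bounded by the maximum
  principle.\<close>

lemma cmod_coeff_le:
  fixes p :: "complex poly"
  assumes "\<And>z. cmod z = 1 \<Longrightarrow> cmod (poly p z) \<le> B"
  shows "cmod (coeff p j) \<le> 2 ^ j * B"
  using assms
proof (induction j arbitrary: p B)
  case 0
  have "cmod (poly p 0) \<le> B"
    by (rule max_modulus_disc[of "poly p" 1]) (use 0 in \<open>auto intro: holomorphic_intros\<close>)
  thus ?case by (simp add: poly_0_coeff_0)
next
  case (Suc j)
  obtain a p' where p: "p = pCons a p'" by (cases p)
  have a: "cmod (poly p 0) \<le> B"
    by (rule max_modulus_disc[of "poly p" 1]) (use Suc.prems in \<open>auto intro: holomorphic_intros\<close>)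
  have "cmod (poly p' z) \<le> 2 * B" if z: "cmod z = 1" for z
  proof -
    have "cmod (poly p' z) = cmod (z * poly p' z)" by (simp add: norm_mult z)
    also have "z * poly p' z = poly p z - poly p 0" by (simp add: p)
    also have "cmod \<dots> \<le> B + B" using norm_triangle_ineq4[of "poly p z" "poly p 0"] a Suc.prems[OF z] by linarith
    finally show ?thesis by simp
  qed
  from Suc.IH[OF this] show ?case by (simp add: p)
qed

lemma bounded_coeffs_convergent_subsequence:
  fixes p :: "nat \<Rightarrow> complex poly"
  assumes deg: "\<And>k. degree (p k) \<le> n" and bd: "\<And>k j. cmod (coeff (p k) j) \<le> B j"
  obtains s q where "strict_mono (s :: nat \<Rightarrow> nat)" "degree q \<le> n" "\<And>j. (\<lambda>k. coeff (p (s k)) j) \<longlonglongrightarrow> coeff q j"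
proof -
  have "\<exists>s. strict_mono (s :: nat \<Rightarrow> nat) \<and> (\<forall>j<m. \<exists>l. (\<lambda>k. coeff (p (s k)) j) \<longlonglongrightarrow> l)" for m
  proof (induction m)
    case 0 show ?case by (rule exI[of _ id]) (simp add: strict_mono_def)
  next
    case (Suc m)
    then obtain s where s: "strict_mono (s :: nat \<Rightarrow> nat)" "\<And>j. j < m \<Longrightarrow> \<exists>l. (\<lambda>k. coeff (p (s k)) j) \<longlonglongrightarrow> l"
      by blast
    have "bounded (range (\<lambda>k. coeff (p (s k)) m))" using bd by (auto simp: bounded_iff)
    then obtain l r where r: "strict_mono (r :: nat \<Rightarrow> nat)" "((\<lambda>k. coeff (p (s k)) m) \<circ> r) \<longlonglongrightarrow> l"
      using bounded_imp_convergent_subsequence by metis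
    have "\<exists>l. (\<lambda>k. coeff (p ((s \<circ> r) k)) j) \<longlonglongrightarrow> l" if "j < Suc m" for j
    proof (cases "j = m")
      case True thus ?thesis using r(2) by (auto simp: o_def)
    next
      case False
      then obtain l' where "(\<lambda>k. coeff (p (s k)) j) \<longlonglongrightarrow> l'" using s(2)[of j] \<open>j < Suc m\<close> by auto
      from LIMSEQ_subseq_LIMSEQ[OF this r(1)] show ?thesis by (auto simp: o_def)
    qed
    moreover have "strict_mono (s \<circ> r)" using s(1) r(1) by (rule strict_mono_o)
    ultimately show ?case by blast
  qed
  from this[of "Suc n"] obtain s where s: "strict_mono (s :: nat \<Rightarrow> nat)"
    "\<And>j. j < Suc n \<Longrightarrow> \<exists>l. (\<lambda>k. coeff (p (s k)) j) \<longlonglongrightarrow> l" by blast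
  define l where "l j = lim (\<lambda>k. coeff (p (s k)) j)" for j
  have l: "(\<lambda>k. coeff (p (s k)) j) \<longlonglongrightarrow> l j" if "j < Suc n" for j
    using s(2)[OF that] unfolding l_def by (metis limI)
  define q where "q = (\<Sum>j\<le>n. monom (l j) j)"
  have cq: "coeff q j = (if j \<le> n then l j else 0)" for j
    by (simp add: q_def coeff_sum)
  have "degree q \<le> n" by (rule degree_le) (simp add: cq)
  moreover have "(\<lambda>k. coeff (p (s k)) j) \<longlonglongrightarrow> coeff q j" for j
  proof (cases "j \<le> n")
    case True thus ?thesis using l[of j] by (simp add: cq)
  next
    case False
    have "coeff (p (s k)) j = 0" for k by (rule coeff_eq_0) (use deg[of "s k"] False in linarith)
    thus ?thesis using False by (simp add: cq)
  qed
  ultimately show ?thesis using that[OF s(1)] by blast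
qed

lemma poly_eq_sum_le:
  fixes p :: "complex poly"
  assumes "degree p \<le> n"
  shows "poly p x = (\<Sum>i\<le>n. coeff p i * x ^ i)"
  unfolding poly_altdef by (rule sum.mono_neutral_left) (use assms in \<open>auto simp: coeff_eq_0\<close>)

lemma tendsto_poly_coeffs:
  fixes p :: "nat \<Rightarrow> complex poly"
  assumes "\<And>k. degree (p k) \<le> n" "degree q \<le> n" "\<And>j. (\<lambda>k. coeff (p k) j) \<longlonglongrightarrow> coeff q j" "w \<longlonglongrightarrow> y"
  shows "(\<lambda>k. poly (p k) (w k)) \<longlonglongrightarrow> poly q y"
  unfolding poly_eq_sum_le[OF assms(1)] poly_eq_sum_le[OF assms(2)]
  by (intro tendsto_sum tendsto_mult tendsto_power assms)

section \<open>Normal families on varying domains\<close>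

text \<open>No fixed domain carries all the \<open>g k\<close>, but each compact part of
  \<open>X\<close> carries a tail of the sequence. Montel is applied to tails on the members of a
  compact exhaustion, and a diagonal subsequence serves all of them.\<close>

lemma diagonal_Montel:
  fixes g :: "nat \<Rightarrow> complex \<Rightarrow> complex"
  assumes X: "open X" and ker: "\<And>K. compact K \<Longrightarrow> K \<subseteq> X \<Longrightarrow> eventually (\<lambda>k. K \<subseteq> Xs k) sequentially"
    and hol: "\<And>k. g k holomorphic_on Xs k"
    and bd: "\<And>R. \<exists>B. \<forall>k. \<forall>z\<in>Xs k. cmod z \<le> R \<longrightarrow> cmod (g k z) \<le> B"
  obtains s h where "strict_mono (s :: nat \<Rightarrow> nat)" "h holomorphic_on X"
    "\<And>K. compact K \<Longrightarrow> K \<subseteq> X \<Longrightarrow> uniform_limit K (\<lambda>k. g (s k)) h sequentially"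
proof -
  obtain C where C: "\<And>n. compact (C n)" "\<And>n. C n \<subseteq> X" "\<And>n. C n \<subseteq> interior (C (Suc n))"
    "\<Union>(range C) = X" "\<And>K. \<lbrakk>compact K; K \<subseteq> X\<rbrakk> \<Longrightarrow> \<exists>N. \<forall>n\<ge>N. K \<subseteq> C n"
    using open_Union_compact_subsets[OF X] by metis
  define P where "P m s \<longleftrightarrow> (\<exists>h. uniform_limit (C m) (\<lambda>k. g (s k)) h sequentially)" for m and s :: "nat \<Rightarrow> nat"
  have ex: "\<exists>r. strict_mono r \<and> P m (s \<circ> r)" if s: "strict_mono s" for m and s :: "nat \<Rightarrow> nat"
  proof -
    \<comment> \<open>The shift by \<open>N\<close> discards the terms not yet defined on
      \<open>C (Suc m)\<close>; Montel needs the open set \<open>interior (C (Suc m))\<close>, which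
      contains \<open>C m\<close>.\<close>
    obtain N where N: "\<And>k. N \<le> k \<Longrightarrow> C (Suc m) \<subseteq> Xs k"
      using ker[OF C(1,2), of "Suc m"] unfolding eventually_sequentially by blast
    define F where "F k = g (s (k + N))" for k
    have sub: "interior (C (Suc m)) \<subseteq> Xs (s (k + N))" for k
      using N[of "s (k + N)"] seq_suble[OF s, of "k + N"] interior_subset by force
    have holF: "h holomorphic_on interior (C (Suc m))" if "h \<in> range F" for h
      using that holomorphic_on_subset[OF hol sub] by (auto simp: F_def)
    have bF: "\<exists>B. \<forall>h\<in>range F. \<forall>z\<in>K. norm (h z) \<le> B"
      if K: "compact K" "K \<subseteq> interior (C (Suc m))" for K
    proof -
      obtain R where R: "\<And>z. z \<in> K \<Longrightarrow> cmod z \<le> R"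
        using compact_imp_bounded[OF K(1)] by (auto simp: bounded_iff)
      obtain B where B: "\<And>k z. z \<in> Xs k \<Longrightarrow> cmod z \<le> R \<Longrightarrow> cmod (g k z) \<le> B"
        using bd[of R] by blast
      have "cmod (F k z) \<le> B" if "z \<in> K" for k z
        unfolding F_def using B[of z "s (k + N)"] sub[of k] K(2) R[OF that] that by blast
      thus ?thesis by blast
    qed
    obtain h r where r: "strict_mono (r :: nat \<Rightarrow> nat)"
      "\<And>K. \<lbrakk>compact K; K \<subseteq> interior (C (Suc m))\<rbrakk> \<Longrightarrow> uniform_limit K (F \<circ> r) h sequentially"
      using Montel[of "interior (C (Suc m))" "range F" F, OF open_interior holF bF order_refl] by metis
    have "uniform_limit (C m) (F \<circ> r) h sequentially" by (rule r(2)[OF C(1) C(3)])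
    hence "P m (s \<circ> (\<lambda>k. r k + N))" unfolding P_def by (auto simp: F_def o_def)
    moreover have "strict_mono (\<lambda>k. r k + N)" using r(1) by (simp add: strict_mono_def)
    ultimately show ?thesis by blast
  qed
  interpret subseqs P by unfold_locales (rule ex)
  have Psub: "P m (s \<circ> r)" if r: "strict_mono r" and s: "P m s" for r s m
  proof -
    obtain h where "uniform_limit (C m) (\<lambda>k. g (s k)) h sequentially" using s by (auto simp: P_def)
    from filterlim_compose[OF this filterlim_subseq[OF r]]
    show ?thesis unfolding P_def o_def by blast
  qed
  define d where "d = diagseq"
  have d: "strict_mono d" unfolding d_def by (rule subseq_diagseq)
  have conv: "\<exists>h. uniform_limit (C m) (\<lambda>k. g (d k)) h sequentially" for m
  proof -
    have "P m (diagseq \<circ> (+) (Suc m))" by (rule diagseq_holds) (rule Psub)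
    then obtain h where h: "uniform_limit (C m) (\<lambda>k. g (d (Suc m + k))) h sequentially"
      by (auto simp: P_def o_def d_def)
    have "uniform_limit (C m) (\<lambda>k. g (d k)) h sequentially"
      unfolding uniform_limit_iff
    proof (intro allI impI)
      fix e :: real assume "e > 0"
      hence "\<forall>\<^sub>F k in sequentially. \<forall>x\<in>C m. dist (g (d (k + Suc m)) x) (h x) < e"
        using h unfolding uniform_limit_iff by (simp add: add.commute)
      thus "\<forall>\<^sub>F k in sequentially. \<forall>x\<in>C m. dist (g (d k) x) (h x) < e"
        by (subst (asm) eventually_sequentially_seg)
    qed
    thus ?thesis by blast
  qed
  define h where "h z = lim (\<lambda>k. g (d k) z)" for z
  have ulC: "uniform_limit (C m) (\<lambda>k. g (d k)) h sequentially" for m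
  proof -
    obtain h' where h': "uniform_limit (C m) (\<lambda>k. g (d k)) h' sequentially" using conv by blast
    have "h' z = h z" if "z \<in> C m" for z
      using limI[OF tendsto_uniform_limitI[OF h' that]] by (simp add: h_def)
    thus ?thesis using uniform_limit_cong'[of "C m" "\<lambda>k. g (d k)" "\<lambda>k. g (d k)" h' h] h' by simp
  qed
  have ul: "uniform_limit K (\<lambda>k. g (d k)) h sequentially" if "compact K" "K \<subseteq> X" for K
    using C(5)[OF that] uniform_limit_on_subset[OF ulC] by blast
  have "h field_differentiable (at z)" if z: "z \<in> X" for z
  proof -
    obtain m where m: "z \<in> C m" using C(4) z by blast
    define S where "S = interior (C (Suc m))"
    obtain N where N: "\<And>k. N \<le> k \<Longrightarrow> C (Suc m) \<subseteq> Xs k"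
      using ker[OF C(1,2), of "Suc m"] unfolding eventually_sequentially by blast
    have "h holomorphic_on S"
    proof (rule holomorphic_uniform_sequence[of S "\<lambda>k. g (d (k + N))"])
      show "open S" by (simp add: S_def)
      show "g (d (k + N)) holomorphic_on S" for k
        using N[of "d (k + N)"] seq_suble[OF d, of "k + N"] interior_subset[of "C (Suc m)"]
        by (intro holomorphic_on_subset[OF hol]) (auto simp: S_def)
      fix x assume "x \<in> S"
      then obtain e where e: "e > 0" "cball x e \<subseteq> S" using open_contains_cball[of S] by (auto simp: S_def)
      have "cball x e \<subseteq> X" using e(2) interior_subset[of "C (Suc m)"] C(2)[of "Suc m"] by (auto simp: S_def)
      hence "uniform_limit (cball x e) (\<lambda>k. g (d k)) h sequentially" by (intro ul) auto
      from filterlim_compose[OF this filterlim_add_const_nat_at_top[of N]] e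
      show "\<exists>e>0. cball x e \<subseteq> S \<and> uniform_limit (cball x e) (\<lambda>k. g (d (k + N))) h sequentially" by blast
    qed
    moreover have "z \<in> S" using m C(3) by (auto simp: S_def)
    ultimately show ?thesis by (auto simp: S_def intro: holomorphic_on_imp_differentiable_at)
  qed
  hence "h holomorphic_on X" by (auto simp: holomorphic_on_def intro: field_differentiable_at_within)
  thus ?thesis using that d ul by blast
qed

text \<open>Injectivity concerns two points at a time. Join them by a path; a tube around it has
  compact closure in \<open>X\<close>, so a tail of the sequence lives there and Hurwitz's theorem
  applies. Nonconstancy on the tube follows from the identity theorem.\<close>

lemma Hurwitz_injective_exhausting:
  fixes g :: "nat \<Rightarrow> complex \<Rightarrow> complex"
  assumes X: "open X" "connected X"
    and ker: "\<And>K. compact K \<Longrightarrow> K \<subseteq> X \<Longrightarrow> eventually (\<lambda>k. K \<subseteq> Xs k) sequentially"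
    and hol: "\<And>k. g k holomorphic_on Xs k" and inj: "\<And>k. inj_on (g k) (Xs k)"
    and ul: "\<And>K. compact K \<Longrightarrow> K \<subseteq> X \<Longrightarrow> uniform_limit K g h sequentially"
    and h: "h holomorphic_on X" "\<not> h constant_on X"
  shows "inj_on h X"
proof (rule inj_onI)
  fix x y assume xy: "x \<in> X" "y \<in> X" "h x = h y"
  have "path_connected X" using X connected_open_path_connected by blast
  then obtain \<gamma> where \<gamma>: "path \<gamma>" "path_image \<gamma> \<subseteq> X" "pathstart \<gamma> = x" "pathfinish \<gamma> = y"
    using xy unfolding path_connected_def by metis
  define A where "A = path_image \<gamma>"
  have A: "compact A" "connected A" "A \<subseteq> X" "x \<in> A" "y \<in> A"
    using \<gamma> pathstart_in_path_image[of \<gamma>] pathfinish_in_path_image[of \<gamma>]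
    by (auto simp: A_def intro: compact_path_image connected_path_image)
  obtain e where e: "e > 0" "(\<Union>a\<in>A. cball a e) \<subseteq> X"
    using compact_subset_open_imp_cball_epsilon_subset[OF A(1) X(1) A(3)] by blast
  \<comment> \<open>The path \<open>A\<close> is added to every ball so that all members of the
    union share a point and connectedness is immediate.\<close>
  define S where "S = \<Union> ((\<lambda>a. ball a e \<union> A) ` A)"
  define K where "K = (\<Union>a\<in>A. cball a e)"
  have K: "compact K" unfolding K_def by (rule compact_minkowski_sum_cball[OF A(1)])
  have S_eq: "S = (\<Union>a\<in>A. ball a e)" using e(1) by (auto simp: S_def)
  have SK: "S \<subseteq> K" unfolding S_eq K_def using ball_subset_cball by blast
  have KX: "K \<subseteq> X" unfolding K_def by (rule e(2))
  have oS: "open S" unfolding S_eq by auto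
  have cS: "connected S" unfolding S_def
  proof (rule connected_Union)
    show "connected s" if s: "s \<in> (\<lambda>a. ball a e \<union> A) ` A" for s
    proof -
      obtain a where a: "a \<in> A" "s = ball a e \<union> A" using s by blast
      have "a \<in> ball a e \<inter> A" using a(1) e(1) by simp
      thus ?thesis unfolding a(2) by (intro connected_Un connected_ball A(2)) blast
    qed
    show "\<Inter> ((\<lambda>a. ball a e \<union> A) ` A) \<noteq> {}" using A(4) by blast
  qed
  obtain N where N: "\<And>k. N \<le> k \<Longrightarrow> K \<subseteq> Xs k"
    using ker[OF K KX] unfolding eventually_sequentially by blast
  have sub: "S \<subseteq> Xs (k + N)" for k using N[of "k + N"] SK by auto
  have "inj_on h S"
  proof (rule Hurwitz_injective[of S "\<lambda>k. g (k + N)"])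
    show "g (k + N) holomorphic_on S" for k by (rule holomorphic_on_subset[OF hol sub])
    show "h holomorphic_on S" by (rule holomorphic_on_subset[OF h(1)]) (use SK KX in blast)
    show "inj_on (g (k + N)) S" for k by (rule inj_on_subset[OF inj sub])
    show "uniform_limit K' (\<lambda>k. g (k + N)) h sequentially" if "compact K'" "K' \<subseteq> S" for K'
    proof -
      have "uniform_limit K' g h sequentially" using ul that SK KX by blast
      from filterlim_compose[OF this filterlim_add_const_nat_at_top[of N]] show ?thesis .
    qed
    show "\<not> h constant_on S"
    proof
      assume "h constant_on S"
      then obtain c where c: "\<And>z. z \<in> S \<Longrightarrow> h z = c" by (auto simp: constant_on_def)
      have xS: "x \<in> S" using A(4) by (auto simp: S_def)
      have "h z - c = 0" if "z \<in> X" for z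
      proof (rule analytic_continuation[of "\<lambda>z. h z - c" X S x])
        show "(\<lambda>z. h z - c) holomorphic_on X" by (intro holomorphic_intros h)
        show "x islimpt S" using oS xS interior_limit_point[of x S] by (simp add: interior_open)
      qed (use X SK KX xy c that in auto)
      hence "h constant_on X" unfolding constant_on_def by (metis eq_iff_diff_eq_0)
      thus False using h(2) by simp
    qed
  qed (fact oS, fact cS)
  moreover have "x \<in> S" "y \<in> S" using A(4,5) by (auto simp: S_def)
  ultimately show "x = y" using xy(3) unfolding inj_on_def by blast
qed

section \<open>Normal form and uniform estimates\<close>

text \<open>The algebraic part of the normalization. A monic denominator removes the free common
  factor of the pair, so that convergence of the maps can be expressed by coefficients.\<close>

definition normal_form :: "nat \<Rightarrow> complex poly \<Rightarrow> complex poly \<Rightarrow> bool" where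
  "normal_form n p q \<longleftrightarrow> coprime p q \<and> degree p < degree q \<and> degree q = n \<and> lead_coeff q = 1
     \<and> rsquarefree q \<and> \<Sum>{a. poly q a = 0} = 0"

definition uniformizes :: "complex set \<Rightarrow> (complex \<Rightarrow> complex) \<Rightarrow> complex poly \<Rightarrow> complex poly \<Rightarrow> bool" where
  "uniformizes X g p q \<longleftrightarrow> g holomorphic_on X \<and> inj_on g X \<and> g ` X = sublevel p q 1
     \<and> ((\<lambda>z. g z / z) \<longlongrightarrow> 1) at_infinity"

text \<open>By \<open>exterior_const_bound\<close>, any value omitted beyond radius \<open>r\<close>
  is close to \<open>g z\<close> on |z| = 8 r. Averaging over the \<open>n\<close> poles, which are
  omitted and sum to 0, bounds \<open>g z\<close> itself; the triangle inequality then bounds every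
  omitted value. By injectivity the values of \<open>g\<close> on |z| <= r are omitted beyond radius
  \<open>r\<close> too, whence the last bound.\<close>

lemma uniformizer_bounds:
  assumes nf: "normal_form n p q" and u: "uniformizes X g p q" and r: "0 < r" and X: "\<And>z. r \<le> cmod z \<Longrightarrow> z \<in> X"
  shows "cmod z = 8 * r \<Longrightarrow> cmod (g z) \<le> exterior_const * r"
    and "y \<notin> sublevel p q 1 \<Longrightarrow> cmod y \<le> 2 * exterior_const * r"
    and "z \<in> X \<Longrightarrow> cmod z \<le> r \<Longrightarrow> cmod (g z) \<le> 2 * exterior_const * r"
proof -
  have g: "g holomorphic_on X" "inj_on g X" "g ` X = sublevel p q 1" "((\<lambda>z. g z / z) \<longlongrightarrow> 1) at_infinity"
    using u by (simp_all add: uniformizes_def)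
  have sub: "{z. r < cmod z} \<subseteq> X" using X by auto
  have om: "cmod (g z - y) \<le> exterior_const * r" if "y \<notin> g ` {z. r < cmod z}" "cmod z = 8 * r" for y z
    by (rule exterior_const_bound[OF r holomorphic_on_subset[OF g(1) sub] inj_on_subset[OF g(2) sub] g(4) that])
  have om': "y \<notin> g ` {z. r < cmod z}" if "y \<notin> sublevel p q 1" for y using that sub g(3) by blast
  have b: "cmod (g z) \<le> exterior_const * r" if z: "cmod z = 8 * r" for z
  proof -
    define A where "A = {a. poly q a = 0}"
    have A: "card A = n" "\<Sum>A = 0" using card_roots_rsquarefree[of q] nf by (auto simp: normal_form_def A_def)
    have n0: "n > 0" using nf by (auto simp: normal_form_def)
    have "of_nat n * g z = (\<Sum>a\<in>A. g z - a)" by (simp add: sum_subtractf A)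
    also have "cmod \<dots> \<le> (\<Sum>a\<in>A. exterior_const * r)"
    proof (rule sum_norm_le)
      fix a assume "a \<in> A"
      hence "a \<notin> sublevel p q 1" by (auto simp: A_def sublevel_def)
      thus "cmod (g z - a) \<le> exterior_const * r" by (rule om[OF om' z])
    qed
    also have "\<dots> = of_nat n * (exterior_const * r)" by (simp add: A)
    finally have "of_nat n * cmod (g z) \<le> of_nat n * (exterior_const * r)" by (simp add: norm_mult)
    thus ?thesis using n0 by simp
  qed
  thus "cmod z = 8 * r \<Longrightarrow> cmod (g z) \<le> exterior_const * r" .
  have tri: "cmod y \<le> 2 * exterior_const * r" if y: "y \<notin> g ` {z. r < cmod z}" for y
  proof -
    define z where "z = complex_of_real (8 * r)"
    have z: "cmod z = 8 * r" using r unfolding z_def norm_of_real by simp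
    have "cmod y \<le> cmod (g z) + cmod (g z - y)" using norm_triangle_ineq4[of "g z" "g z - y"] by simp
    thus ?thesis using b[OF z] om[OF y z] by simp
  qed
  show "y \<notin> sublevel p q 1 \<Longrightarrow> cmod y \<le> 2 * exterior_const * r" by (rule tri[OF om'])
  show "cmod (g z) \<le> 2 * exterior_const * r" if z: "z \<in> X" "cmod z \<le> r"
  proof (rule tri)
    show "g z \<notin> g ` {z. r < cmod z}"
    proof
      assume "g z \<in> g ` {z. r < cmod z}"
      then obtain w where w: "r < cmod w" "g z = g w" by blast
      have "z = w" by (rule inj_onD[OF g(2) w(2) z(1)]) (use X w(1) in simp)
      thus False using w(1) z(2) by simp
    qed
  qed
qed

section \<open>Uniqueness of the Bell representation\<close>

text \<open>Once \<open>h\<close> composed with the inverse of \<open>g\<close> is a translation by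
  \<open>t\<close>, it moves the \<open>n\<close> simple roots of \<open>q\<close> to
  \<open>n\<close> distinct roots of \<open>q'\<close>. These exhaust the degree, so
  \<open>q'\<close> has simple roots as well, and its vanishing subleading coefficient forces t =
  0.\<close>

lemma normal_form_unique:
  assumes nf: "normal_form n p q" and gm: "uniformizes X g p q"
    and c: "\<And>i. i < n \<Longrightarrow> continuous_on (sphere 0 1) (c i)"
      "\<And>i. i < n \<Longrightarrow> inj_on (c i) (sphere 0 1)"
      "\<And>i j. i < n \<Longrightarrow> j < n \<Longrightarrow> i \<noteq> j \<Longrightarrow> c i ` sphere 0 1 \<inter> c j ` sphere 0 1 = {}"
      "level p q 1 = (\<Union>i<n. c i ` sphere (0::complex) 1)"
    and X: "open X" "connected X" "r > 0" "\<And>z. r \<le> cmod z \<Longrightarrow> z \<in> X"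
    and h: "h holomorphic_on X" "inj_on h X" "((\<lambda>z. h z / z) \<longlongrightarrow> 1) at_infinity"
    and pq': "degree p' < n" "degree q' = n" "lead_coeff q' = 1" "coeff q' (n - 1) = 0"
    and f: "\<And>z. z \<in> X \<Longrightarrow> poly p (g z) = f z * poly q (g z)"
      "\<And>z. z \<in> X \<Longrightarrow> poly p' (h z) = f z * poly q' (h z)"
  shows "p' = p" "q' = q" "\<And>z. z \<in> X \<Longrightarrow> h z = g z"
proof -
  have nfD: "coprime p q" "degree p < degree q" "n = degree q" "lead_coeff q = 1" "rsquarefree q"
    "\<Sum>{a. poly q a = 0} = 0" using nf by (auto simp: normal_form_def)
  have n0: "n > 0" using nfD by linarith
  define S where "S = sublevel p q 1"
  have g: "g holomorphic_on X" "inj_on g X" "g ` X = S" "((\<lambda>z. g z / z) \<longlongrightarrow> 1) at_infinity"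
    using gm by (auto simp: uniformizes_def S_def)
  obtain gi where gi: "gi holomorphic_on g ` X" "\<And>z. z \<in> X \<Longrightarrow> deriv g z * deriv gi (g z) = 1"
    "\<And>z. z \<in> X \<Longrightarrow> gi (g z) = z"
    by (rule holomorphic_has_inverse[OF g(1) X(1) g(2)]) (rule that, auto)
  have giS: "gi w \<in> X" "g (gi w) = w" if "w \<in> S" for w
    using that gi(3) unfolding g(3)[symmetric] by auto
  define \<phi> where "\<phi> w = h (gi w)" for w
  have \<phi>g: "\<phi> (g z) = h z" if "z \<in> X" for z using gi(3)[OF that] by (simp add: \<phi>_def)
  have hol\<phi>: "\<phi> holomorphic_on S"
    using holomorphic_on_compose_gen[OF gi(1) h(1)] giS(1) unfolding g(3) \<phi>_def o_def by blast
  have inj\<phi>: "inj_on \<phi> S"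
  proof (rule inj_onI)
    fix x y assume xy: "x \<in> S" "y \<in> S" "\<phi> x = \<phi> y"
    have "gi x = gi y" by (rule inj_onD[OF h(2)]) (use xy giS in \<open>auto simp: \<phi>_def\<close>)
    thus "x = y" using giS(2)[OF xy(1)] giS(2)[OF xy(2)] by metis
  qed
  obtain bS where bS: "bS > 0" "\<And>w. bS \<le> cmod w \<Longrightarrow> w \<in> S"
    using sublevel_contains_infinity[OF nfD(2), of 1] unfolding S_def by auto
  \<comment> \<open>\<open>g\<close> is bounded on the bounded parts of \<open>X\<close> by
    \<open>uniformizer_bounds\<close>, so large values of \<open>g\<close> come from large
    arguments. Tangency of \<open>\<phi>\<close> follows by dividing the asymptotics of
    \<open>h\<close> by those of \<open>g\<close>.\<close>
  have gi_inf: "filterlim gi at_infinity at_infinity"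
    unfolding filterlim_at_infinity[OF order_refl]
  proof (intro allI impI)
    fix R :: real assume "0 < R"
    define r' where "r' = max r R"
    have bd: "cmod (g z) \<le> 2 * exterior_const * r'" if "z \<in> X" "cmod z \<le> r'" for z
      by (rule uniformizer_bounds(3)[OF nf gm _ _ that]) (use X(3,4) in \<open>auto simp: r'_def\<close>)
    show "\<forall>\<^sub>F w in at_infinity. R \<le> norm (gi w)"
      unfolding eventually_at_infinity
    proof (intro exI[of _ "max bS (2 * exterior_const * r' + 1)"] allI impI)
      fix w :: complex assume w: "max bS (2 * exterior_const * r' + 1) \<le> cmod w"
      have wS: "w \<in> S" using bS(2) w by simp
      show "R \<le> cmod (gi w)"
      proof (rule ccontr)
        assume "\<not> R \<le> cmod (gi w)"
        hence "cmod (g (gi w)) \<le> 2 * exterior_const * r'" by (intro bd giS(1)[OF wS]) (simp add: r'_def)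
        thus False using giS(2)[OF wS] w by simp
      qed
    qed
  qed
  have lim1: "((\<lambda>w. (h (gi w) / gi w) / (g (gi w) / gi w)) \<longlongrightarrow> 1 / 1) at_infinity"
    by (intro tendsto_divide filterlim_compose[OF h(3) gi_inf] filterlim_compose[OF g(4) gi_inf]) simp
  have ev: "\<forall>\<^sub>F w in at_infinity. (h (gi w) / gi w) / (g (gi w) / gi w) = \<phi> w / w"
  proof -
    have "\<forall>\<^sub>F w in at_infinity. 1 \<le> cmod (gi w)"
      using gi_inf unfolding filterlim_at_infinity[OF order_refl] using zero_less_one by metis
    moreover have "\<forall>\<^sub>F w in at_infinity. w \<in> S" unfolding eventually_at_infinity using bS(2) by blast
    ultimately show ?thesis
    proof eventually_elim
      case (elim w)
      hence "gi w \<noteq> 0" by auto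
      thus ?case using giS(2)[OF elim(2)] by (simp add: \<phi>_def)
    qed
  qed
  have lim\<phi>: "((\<lambda>w. \<phi> w / w) \<longlongrightarrow> 1) at_infinity"
    using Lim_transform_eventually[OF lim1 ev] by simp
  have eq\<phi>: "poly p' (\<phi> w) * poly q w = poly p w * poly q' (\<phi> w)" if "w \<in> S" for w
    using f[OF giS(1)[OF that]] giS(2)[OF that] by (simp add: \<phi>_def)
  interpret rational_conjugation p q p' q' \<phi> n
    by unfold_locales (use nfD pq' hol\<phi> inj\<phi> lim\<phi> eq\<phi> in \<open>auto simp: S_def\<close>)
  have connS: "connected (sublevel p q 1)"
    using connected_continuous_image[OF holomorphic_on_imp_continuous_on[OF g(1)] X(2)] g(3) by (simp add: S_def)
  have unb: "\<not> bounded (sublevel p q 1)"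
    using not_bounded_if_exterior_subset[of bS S] bS(2) unfolding S_def by blast
  have "\<exists>\<rho> D. \<rho> < 1 \<and> branched n p q \<rho> D"
  proof (rule Jordan_pieces[OF nfD(1,2) zero_less_one nfD(3) _ _ _ c(4) connS order_refl closure_subset])
    fix K assume K: "\<And>i. i < n \<Longrightarrow> compact (K i)" "\<And>i. i < n \<Longrightarrow> \<exists>z\<in>K i. poly q z = 0"
      "disjoint_family_on K {..<n}" "level p q 1 \<union> superlevel p q 1 = (\<Union>i<n. K i)"
    show "\<exists>\<rho> D. \<rho> < 1 \<and> branched n p q \<rho> D"
      by (rule exists_branched[OF nfD(1,2) zero_less_one nfD(3) K(1) K(2) K(3) K(4)]) (assumption | blast)+
  qed (fact c(1), fact c(2), fact c(3))
  then obtain \<rho> D where br: "\<rho> < 1" "branched n p q \<rho> D" by (elim exE conjE)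
  obtain t where t: "\<And>w. w \<in> S \<Longrightarrow> \<phi> w = w + t"
    using is_translation[OF connS br(2,1)] unfolding S_def by blast
  define A where "A = {a. poly q a = 0}"
  have fA: "finite A" unfolding A_def by (rule poly_roots_finite) (use nfD in auto)
  have cA: "card A = n" unfolding A_def using card_roots_rsquarefree[OF nfD(5)] nfD(3) by simp
  \<comment> \<open>With the translation moved into the polynomials, the conjugation equation is a
    polynomial identity, valid everywhere because it holds on the infinite set
    \<open>S\<close>.\<close>
  define ps qs where "ps = pcompose p' [:t, 1:]" "qs = pcompose q' [:t, 1:]"
  have pe: "ps * q = p * qs"
  proof -
    have "poly (ps * q - p * qs) w = 0" if "w \<in> S" for w
      using eq\<phi>[OF that] t[OF that] by (simp add: ps_qs_def poly_pcompose add.commute)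
    hence sub: "S \<subseteq> {w. poly (ps * q - p * qs) w = 0}" by blast
    have "infinite S" using unb finite_imp_bounded S_def by blast
    hence "infinite {w. poly (ps * q - p * qs) w = 0}" using sub finite_subset by blast
    hence "ps * q - p * qs = 0" using poly_roots_finite by blast
    thus ?thesis by simp
  qed
  have roots: "poly q' (a + t) = 0" if "a \<in> A" for a
  proof -
    have "poly p a * poly qs a = 0" using arg_cong[OF pe, of "\<lambda>x. poly x a"] that by (simp add: A_def)
    moreover have "poly p a \<noteq> 0" using coprime_poly_0[OF nfD(1), of a] that by (auto simp: A_def)
    ultimately show ?thesis by (simp add: ps_qs_def poly_pcompose add.commute)
  qed
  define A' where "A' = (\<lambda>a. a + t) ` A"
  have q'0: "q' \<noteq> 0" using pq'(3) by auto
  have cA': "card A' = n" unfolding A'_def using cA by (simp add: card_image)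
  have A': "A' = {a. poly q' a = 0}"
    by (rule card_seteq[OF poly_roots_finite[OF q'0]])
       (use roots card_poly_roots_bound[OF q'0] pq'(2) cA' in \<open>auto simp: A'_def\<close>)
  have q'_prod: "q' = (\<Prod>a\<in>A'. [:- a, 1:])"
  proof -
    define P where "P = (\<Prod>a\<in>A'. [:- a, 1:])"
    have fA': "finite A'" unfolding A'_def using fA by simp
    have dP: "degree P = n" unfolding P_def by (subst degree_prod_eq_sum_degree) (auto simp: cA')
    have lP: "lead_coeff P = 1" unfolding P_def by (subst lead_coeff_prod) simp
    have "q' = P"
    proof (rule poly_eqI_degree_lead_coeff[where n = n and A = A'])
      show "coeff q' n = coeff P n" using lP dP pq'(2,3) by simp
      show "poly q' z = poly P z" if "z \<in> A'" for z
        using that A' fA' by (auto simp: P_def poly_prod)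
    qed (use dP pq'(2) cA' in auto)
    thus ?thesis by (simp add: P_def)
  qed
  have neA': "A' \<noteq> {}" using cA' n0 by auto
  \<comment> \<open>The translation changes the sum of the roots by \<open>n * t\<close>, and both
    sums vanish.\<close>
  have "coeff q' (n - 1) = - \<Sum>A'"
    using coeff_prod_linear[of A'] neA' fA unfolding q'_prod[symmetric] cA' by (simp add: A'_def)
  also have "\<Sum>A' = \<Sum>A + of_nat n * t"
    unfolding A'_def by (subst sum.reindex) (simp_all add: sum.distrib cA)
  also have "\<Sum>A = 0" using nfD(6) by (simp add: A_def)
  finally have t0: "t = 0" using pq'(4) n0 by simp
  have "A' = A" using t0 by (simp add: A'_def)
  thus q': "q' = q" using q'_prod monic_eq_prod_roots[OF nfD(5,4)] by (simp add: A_def)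
  have "ps = p'" "qs = q'" using t0 by (simp_all add: ps_qs_def pcompose_idR)
  hence "p' * q = p * q" using pe q' by simp
  thus "p' = p" using q' q'0 by simp
  show "h z = g z" if "z \<in> X" for z
    using t[of "g z"] t0 \<phi>g[OF that] g(3) that by auto
qed

section \<open>Uniform convergence on the sphere\<close>

lemma uniform_limit_subseq_principle:
  fixes F :: "nat \<Rightarrow> 'a \<Rightarrow> 'b :: metric_space"
  assumes "\<And>r. strict_mono (r :: nat \<Rightarrow> nat) \<Longrightarrow>
     \<exists>s. strict_mono (s :: nat \<Rightarrow> nat) \<and> uniform_limit S (\<lambda>k. F (r (s k))) G sequentially"
  shows "uniform_limit S F G sequentially"
proof (rule ccontr)
  assume "\<not> uniform_limit S F G sequentially"
  then obtain e where e: "e > 0" "\<not> (\<forall>\<^sub>F k in sequentially. \<forall>x\<in>S. dist (F k x) (G x) < e)"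
    unfolding uniform_limit_iff by blast
  obtain r where r: "strict_mono (r :: nat \<Rightarrow> nat)" "\<And>k. \<not> (\<forall>x\<in>S. dist (F (r k) x) (G x) < e)"
    using not_eventually_sequentiallyD[OF e(2)] by blast
  obtain s where s: "uniform_limit S (\<lambda>k. F (r (s k))) G sequentially"
    using assms[OF r(1)] by blast
  have "\<forall>\<^sub>F k in sequentially. \<forall>x\<in>S. dist (F (r (s k)) x) (G x) < e"
    using s e(1) unfolding uniform_limit_iff by blast
  thus False using r(2) unfolding eventually_sequentially by blast
qed

text \<open>On the compact set \<open>T\<close> the limit pair stays away from (0, 0), so a compact
  neighbourhood of its image lies where \<open>sph\<close> is uniformly continuous.\<close>

lemma uniform_limit_sph:
  fixes a b :: "complex \<Rightarrow> complex"
  assumes T: "compact T" and cont: "continuous_on T a" "continuous_on T b"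
    and nz: "\<And>x. x \<in> T \<Longrightarrow> a x \<noteq> 0 \<or> b x \<noteq> 0"
    and ul: "uniform_limit T as a sequentially" "uniform_limit T bs b sequentially"
  shows "uniform_limit T (\<lambda>k x. sph (as k x) (bs k x)) (\<lambda>x. sph (a x) (b x)) sequentially"
proof -
  define A where "A = (\<lambda>x. (a x, b x)) ` T"
  have A: "compact A" unfolding A_def by (intro compact_continuous_image continuous_intros cont T)
  have A0: "A \<subseteq> - {(0, 0)}" using nz by (auto simp: A_def)
  obtain d where d: "d > 0" "(\<Union>x\<in>A. cball x d) \<subseteq> - {(0, 0)}"
    using compact_subset_open_imp_cball_epsilon_subset[OF A _ A0] by auto
  define N where "N = (\<Union>x\<in>A. cball x d)"
  have N: "compact N" unfolding N_def by (rule compact_minkowski_sum_cball[OF A])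
  have "continuous_on N (\<lambda>(a, b). sph a b)"
    by (rule continuous_on_subset[OF continuous_on_sph]) (use d(2) N_def in simp)
  hence uc: "uniformly_continuous_on N (\<lambda>(a, b). sph a b)" using N by (rule compact_uniformly_continuous)
  show ?thesis unfolding uniform_limit_iff
  proof (intro allI impI)
    fix e :: real assume "e > 0"
    then obtain \<delta> where \<delta>: "\<delta> > 0" "\<And>x y. x \<in> N \<Longrightarrow> y \<in> N \<Longrightarrow> dist y x < \<delta> \<Longrightarrow>
        dist ((\<lambda>(a, b). sph a b) y) ((\<lambda>(a, b). sph a b) x) < e"
      using uc unfolding uniformly_continuous_on_def by metis
    define \<epsilon> where "\<epsilon> = min \<delta> d / 2"
    have \<epsilon>: "\<epsilon> > 0" using \<delta>(1) d(1) by (simp add: \<epsilon>_def)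
    have "\<forall>\<^sub>F k in sequentially. \<forall>x\<in>T. dist (as k x) (a x) < \<epsilon>"
      "\<forall>\<^sub>F k in sequentially. \<forall>x\<in>T. dist (bs k x) (b x) < \<epsilon>"
      using ul \<epsilon> unfolding uniform_limit_iff by blast+
    thus "\<forall>\<^sub>F k in sequentially. \<forall>x\<in>T. dist (sph (as k x) (bs k x)) (sph (a x) (b x)) < e"
    proof eventually_elim
      case (elim k)
      show ?case
      proof
        fix x assume x: "x \<in> T"
        have "dist (as k x, bs k x) (a x, b x) \<le> dist (as k x) (a x) + dist (bs k x) (b x)"
          unfolding dist_prod_def fst_conv snd_conv by (rule sqrt_sum_squares_le_sum) auto
        also have "\<dots> < \<epsilon> + \<epsilon>" using elim x by (intro add_strict_mono) auto
        also have "\<dots> = min \<delta> d" by (simp add: \<epsilon>_def)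
        finally have lt: "dist (as k x, bs k x) (a x, b x) < min \<delta> d" .
        have xA: "(a x, b x) \<in> A" using x by (auto simp: A_def)
        have "(a x, b x) \<in> N" unfolding N_def using xA d(1) by (intro UN_I[OF xA]) simp
        moreover have "(as k x, bs k x) \<in> N" unfolding N_def using lt by (intro UN_I[OF xA]) (simp add: dist_commute)
        ultimately show "dist (sph (as k x) (bs k x)) (sph (a x) (b x)) < e"
          using \<delta>(2)[of "(a x, b x)" "(as k x, bs k x)"] lt by simp
      qed
    qed
  qed
qed

text \<open>The exponents are left free so as to cover both a polynomial (\<open>m i = i\<close>)
  and its reversal (\<open>m i = n - i\<close>).\<close>

lemma uniform_limit_coeff_sum:
  fixes c :: "nat \<Rightarrow> nat \<Rightarrow> complex"
  assumes "\<And>j. (\<lambda>k. c k j) \<longlonglongrightarrow> l j"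
  shows "uniform_limit (cball 0 1) (\<lambda>k x. \<Sum>i\<le>n. c k i * x ^ m i) (\<lambda>x. \<Sum>i\<le>n. l i * x ^ m i) sequentially"
  unfolding uniform_limit_iff
proof (intro allI impI)
  fix e :: real assume e: "e > 0"
  have "(\<lambda>k. \<Sum>i\<le>n. cmod (c k i - l i)) \<longlonglongrightarrow> (\<Sum>i\<le>n. cmod (l i - l i))"
    by (intro tendsto_intros assms)
  hence "\<forall>\<^sub>F k in sequentially. (\<Sum>i\<le>n. cmod (c k i - l i)) < e"
    using e by (intro order_tendstoD(2)) auto
  thus "\<forall>\<^sub>F k in sequentially. \<forall>x\<in>cball 0 1. dist (\<Sum>i\<le>n. c k i * x ^ m i) (\<Sum>i\<le>n. l i * x ^ m i) < e"
  proof eventually_elim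
    case (elim k)
    show ?case
    proof
      fix x :: complex assume "x \<in> cball 0 1"
      hence x: "cmod x ^ m i \<le> 1" for i by (simp add: power_le_one)
      have "dist (\<Sum>i\<le>n. c k i * x ^ m i) (\<Sum>i\<le>n. l i * x ^ m i) = cmod (\<Sum>i\<le>n. (c k i - l i) * x ^ m i)"
        by (simp add: dist_norm left_diff_distrib sum_subtractf)
      also have "\<dots> \<le> (\<Sum>i\<le>n. cmod (c k i - l i))"
        by (rule sum_norm_le) (simp add: norm_mult norm_power x mult_left_le)
      finally show "dist (\<Sum>i\<le>n. c k i * x ^ m i) (\<Sum>i\<le>n. l i * x ^ m i) < e" using elim by simp
    qed
  qed
qed

lemma sp_ratR_Some:
  assumes "coprime p q"
  shows "sp (ratR p q (Some z)) = sph (poly p z) (poly q z)"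
proof (cases "poly q z = 0")
  case True
  hence "poly p z \<noteq> 0" using coprime_poly_0[OF assms, of z] by auto
  thus ?thesis using True sph_scale[of "poly p z" 1 0] by (simp add: ratR_def sp_None)
next
  case False thus ?thesis by (simp add: ratR_def sph_ratio)
qed

text \<open>Two closed discs cover the sphere: |z| <= 1, and |u| <= 1 with u = 1/z. On the second
  the reversed polynomials are homogeneous coordinates; at u = 0 they do not both vanish because
  \<open>q\<close> is monic of degree \<open>n\<close>.\<close>

lemma uniform_limit_ratR:
  assumes nf: "\<And>k. normal_form n (ps k) (qs k)" "normal_form n p q"
    and conv: "\<And>j. (\<lambda>k. coeff (ps k) j) \<longlonglongrightarrow> coeff p j" "\<And>j. (\<lambda>k. coeff (qs k) j) \<longlonglongrightarrow> coeff q j"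
  shows "uniform_limit UNIV (\<lambda>k x. sp (ratR (ps k) (qs k) x)) (\<lambda>x. sp (ratR p q x)) sequentially"
proof -
  have deg: "degree p \<le> n" "degree q \<le> n" "coprime p q" if "normal_form n p q" for p q
    using that by (auto simp: normal_form_def)
  \<comment> \<open>Numerator and denominator are reversed with respect to the same degree
    \<open>n\<close>, so that the factor \<open>u ^ n\<close> cancels in \<open>sph\<close>.\<close>
  define rev where "rev p u = (\<Sum>i\<le>n. coeff p i * u ^ (n - i))" for p :: "complex poly" and u
  have rev: "u ^ n * poly p (1 / u) = rev p u" if "degree p \<le> n" "u \<noteq> 0" for p u
    unfolding poly_eq_sum_le[OF that(1)] rev_def sum_distrib_left
  proof (rule sum.cong)
    fix i assume "i \<in> {..n}"
    hence "u ^ n = u ^ (n - i) * u ^ i" by (simp flip: power_add)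
    thus "u ^ n * (coeff p i * (1 / u) ^ i) = coeff p i * u ^ (n - i)"
      using that(2) by (simp add: power_divide)
  qed simp
  have rev0: "rev p 0 = coeff p n" for p
  proof -
    have "rev p 0 = (\<Sum>i\<le>n. if i = n then coeff p i else 0)"
      unfolding rev_def by (rule sum.cong) (auto simp: power_0_left)
    thus ?thesis by simp
  qed
  define pt where "pt u = (if u = 0 then None else Some (1 / u))" for u :: complex
  have coeffn: "coeff p n = 0" "coeff q n = 1" if "normal_form n p q" for p q
    using that by (auto simp: normal_form_def coeff_eq_0)
  have nr: "rev p u \<noteq> 0 \<or> rev q u \<noteq> 0" if "normal_form n p q" for p q u
  proof (cases "u = 0")
    case True thus ?thesis using coeffn[OF that] by (simp add: rev0)
  next
    case False
    thus ?thesis using rev[OF deg(1)[OF that] False] rev[OF deg(2)[OF that] False]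
        coprime_poly_0[OF deg(3)[OF that], of "1 / u"] by (metis mult_eq_0_iff power_not_zero)
  qed
  have spr: "sp (ratR p q (pt u)) = sph (rev p u) (rev q u)" if "normal_form n p q" for p q u
  proof (cases "u = 0")
    case True
    have "degree p < degree q" using that by (simp add: normal_form_def)
    thus ?thesis using True coeffn[OF that] by (simp add: pt_def rev0 ratR_def sp_Some)
  next
    case False
    thus ?thesis using sph_scale[of "u ^ n" "poly p (1/u)" "poly q (1/u)"]
        rev[OF deg(1)[OF that] False] rev[OF deg(2)[OF that] False]
      by (simp add: pt_def sp_ratR_Some[OF deg(3)[OF that]])
  qed
  have "uniform_limit (cball 0 1) (\<lambda>k. poly (ps k)) (poly p) sequentially"
    "uniform_limit (cball 0 1) (\<lambda>k. poly (qs k)) (poly q) sequentially"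
    using uniform_limit_coeff_sum[OF conv(1), where n = n and m = "\<lambda>i. i"] uniform_limit_coeff_sum[OF conv(2), where n = n and m = "\<lambda>i. i"]
    by (simp_all add: poly_eq_sum_le[OF deg(1)[OF nf(1)], abs_def] poly_eq_sum_le[OF deg(2)[OF nf(1)], abs_def]
        poly_eq_sum_le[OF deg(1)[OF nf(2)], abs_def] poly_eq_sum_le[OF deg(2)[OF nf(2)], abs_def])
  hence 1: "uniform_limit (cball 0 1) (\<lambda>k x. sph (poly (ps k) x) (poly (qs k) x)) (\<lambda>x. sph (poly p x) (poly q x)) sequentially"
    using coprime_poly_0[OF deg(3)[OF nf(2)]]
    by (intro uniform_limit_sph) (auto intro!: continuous_intros)
  have "uniform_limit (cball 0 1) (\<lambda>k. rev (ps k)) (rev p) sequentially"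
    "uniform_limit (cball 0 1) (\<lambda>k. rev (qs k)) (rev q) sequentially"
    using uniform_limit_coeff_sum[OF conv(1), where n = n and m = "\<lambda>i. n - i"] uniform_limit_coeff_sum[OF conv(2), where n = n and m = "\<lambda>i. n - i"]
    by (simp_all add: rev_def[abs_def])
  hence 2: "uniform_limit (cball 0 1) (\<lambda>k x. sph (rev (ps k) x) (rev (qs k) x)) (\<lambda>x. sph (rev p x) (rev q x)) sequentially"
    using nr[OF nf(2)]
    by (intro uniform_limit_sph) (auto simp: rev_def[abs_def] intro!: continuous_intros)
  show ?thesis unfolding uniform_limit_iff
  proof (intro allI impI)
    fix e :: real assume "e > 0"
    hence "\<forall>\<^sub>F k in sequentially. \<forall>x\<in>cball 0 1. dist (sph (poly (ps k) x) (poly (qs k) x)) (sph (poly p x) (poly q x)) < e"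
      "\<forall>\<^sub>F k in sequentially. \<forall>x\<in>cball 0 1. dist (sph (rev (ps k) x) (rev (qs k) x)) (sph (rev p x) (rev q x)) < e"
      using 1 2 unfolding uniform_limit_iff by blast+
    thus "\<forall>\<^sub>F k in sequentially. \<forall>x\<in>UNIV. dist (sp (ratR (ps k) (qs k) x)) (sp (ratR p q x)) < e"
    proof eventually_elim
      case (elim k)
      show ?case
      proof
        fix x :: "complex option"
        show "dist (sp (ratR (ps k) (qs k) x)) (sp (ratR p q x)) < e"
        proof (cases "\<exists>z\<in>cball 0 1. x = Some z")
          case True
          then obtain z where z: "z \<in> cball 0 1" "x = Some z" by blast
          show ?thesis unfolding z(2) sp_ratR_Some[OF deg(3)[OF nf(1)]] sp_ratR_Some[OF deg(3)[OF nf(2)]]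
            using elim(1) z(1) by blast
        next
          case False
          have "\<exists>u\<in>cball 0 1. x = pt u"
          proof (cases x)
            case None thus ?thesis by (intro bexI[of _ 0]) (auto simp: pt_def)
          next
            case (Some z)
            hence z: "cmod z > 1" using False by auto
            hence "z \<noteq> 0" by auto
            thus ?thesis using z Some by (intro bexI[of _ "1 / z"]) (auto simp: pt_def norm_divide)
          qed
          then obtain u where u: "u \<in> cball 0 1" "x = pt u" by blast
          show ?thesis unfolding u(2) spr[OF nf(1)] spr[OF nf(2)] using elim(2) u(1) by blast
        qed
      qed
    qed
  qed
qed

text \<open>Convergence on the circle |z| = 8 r spreads to the whole exterior by
  \<open>maximum_modulus_exterior\<close> applied to \<open>gs k - g\<close>; the rest of
  \<open>K\<close> is a compact set of finite points.\<close>

lemma loc_unif_sph_from_compacts: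
  assumes X: "\<And>z. r \<le> cmod z \<Longrightarrow> z \<in> X" "r > 0"
    and g: "\<And>k. gs k holomorphic_on {z. r < cmod z}" "\<And>k. ((\<lambda>z. gs k z / z) \<longlongrightarrow> 1) at_infinity"
      "g holomorphic_on {z. r < cmod z}" "((\<lambda>z. g z / z) \<longlongrightarrow> 1) at_infinity"
    and ul: "\<And>K. compact K \<Longrightarrow> K \<subseteq> X \<Longrightarrow> uniform_limit K gs g sequentially"
    and K: "compact K" "K \<subseteq> sp ` hat X"
  shows "uniform_limit (hat X \<inter> sp -` K) (\<lambda>k p. sp (ext_map (gs k) p)) (\<lambda>p. sp (ext_map g p)) sequentially"
  unfolding uniform_limit_iff
proof (intro allI impI)
  fix e :: real assume e: "e > 0"
  define T where "T = (cball 0 (8*r) \<inter> (\<lambda>z. sp (Some z)) -` K) \<union> sphere 0 (8*r)"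
  have "closed ((\<lambda>z. sp (Some z)) -` K)"
    by (rule closed_vimage[OF compact_imp_closed[OF K(1)] continuous_on_sp])
  hence cT: "compact T" unfolding T_def by (intro compact_Un compact_Int_closed) auto
  have "T \<subseteq> X"
  proof
    fix z assume "z \<in> T"
    hence "sp (Some z) \<in> sp ` hat X \<or> r \<le> cmod z" using K(2) X(2) by (auto simp: T_def)
    thus "z \<in> X" using X(1) by (auto simp: sp_in_hat)
  qed
  \<comment> \<open>\<open>sp\<close> has Lipschitz constant 2, so e/3 leaves room for a strict
    inequality.\<close>
  have e3: "e / 3 > 0" using e by simp
  from ul[OF cT \<open>T \<subseteq> X\<close>] e3 have "\<forall>\<^sub>F k in sequentially. \<forall>z\<in>T. dist (gs k z) (g z) < e / 3"
    unfolding uniform_limit_iff by blast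
  thus "\<forall>\<^sub>F k in sequentially. \<forall>p\<in>hat X \<inter> sp -` K. dist (sp (ext_map (gs k) p)) (sp (ext_map g p)) < e"
  proof eventually_elim
    case (elim k)
    have ext: "dist (gs k z) (g z) \<le> e / 3" if z: "8 * r \<le> cmod z" for z
    proof -
      have "((\<lambda>z. gs k z / z - g z / z) \<longlongrightarrow> 1 - 1) at_infinity" by (intro tendsto_diff g)
      hence l: "((\<lambda>z. (gs k z - g z) / z) \<longlongrightarrow> 0) at_infinity" by (simp add: diff_divide_distrib)
      have "cmod (gs k z - g z) \<le> e / 3"
      proof (rule maximum_modulus_exterior[OF _ l X(2) _ _ z])
        show "(\<lambda>z. gs k z - g z) holomorphic_on {z. r < cmod z}" by (intro holomorphic_intros g)
        show "r < 8 * r" using X(2) by simp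
        fix w assume "cmod w = 8 * r"
        hence "w \<in> T" by (simp add: T_def)
        thus "cmod (gs k w - g w) \<le> e / 3" using elim by (auto simp: dist_norm less_imp_le)
      qed
      thus ?thesis by (simp add: dist_norm)
    qed
    show ?case
    proof
      fix p assume p: "p \<in> hat X \<inter> sp -` K"
      show "dist (sp (ext_map (gs k) p)) (sp (ext_map g p)) < e"
      proof (cases p)
        case None thus ?thesis using e by (simp add: ext_map_def)
      next
        case (Some z)
        have "dist (gs k z) (g z) \<le> e / 3"
        proof (cases "8 * r \<le> cmod z")
          case True thus ?thesis by (rule ext)
        next
          case False
          hence "z \<in> T" using p Some by (auto simp: T_def)
          thus ?thesis using elim by (auto intro: less_imp_le)
        qed
        moreover have "dist (sp (Some (gs k z))) (sp (Some (g z))) \<le> 2 * dist (gs k z) (g z)" by (rule dist_sp_le)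
        ultimately show ?thesis using e by (simp add: Some ext_map_def)
      qed
    qed
  qed
qed

section \<open>Convergence of the Bell representation\<close>

text \<open>One radius \<open>r\<close> serves \<open>X\<close> and all \<open>Xs k\<close>, which
  makes the bounds on poles, coefficients and maps independent of \<open>k\<close>. The limit found
  by compactness is then identified by \<open>normal_form_unique\<close>.\<close>

lemma convergent_subsequence:
  fixes gs :: "nat \<Rightarrow> complex \<Rightarrow> complex"
  assumes nf: "normal_form n p q" and gm: "uniformizes X g p q"
    and c: "\<And>i. i < n \<Longrightarrow> continuous_on (sphere 0 1) (c i)"
      "\<And>i. i < n \<Longrightarrow> inj_on (c i) (sphere 0 1)"
      "\<And>i j. i < n \<Longrightarrow> j < n \<Longrightarrow> i \<noteq> j \<Longrightarrow> c i ` sphere 0 1 \<inter> c j ` sphere 0 1 = {}"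
      "level p q 1 = (\<Union>i<n. c i ` sphere (0::complex) 1)"
    and X: "open X" "connected X" "r > 0" "\<And>z. r \<le> cmod z \<Longrightarrow> z \<in> X"
    and nfk: "\<And>k. normal_form n (ps k) (qs k)" and gmk: "\<And>k. uniformizes (Xs k) (gs k) (ps k) (qs k)"
    and Xk: "\<And>k z. r \<le> cmod z \<Longrightarrow> z \<in> Xs k"
    and ker: "\<And>K. compact K \<Longrightarrow> K \<subseteq> X \<Longrightarrow> eventually (\<lambda>k. K \<subseteq> Xs k) sequentially"
    and f: "\<And>z. z \<in> X \<Longrightarrow> poly p (g z) = f z * poly q (g z)"
    and fk: "\<And>k z. z \<in> Xs k \<Longrightarrow> poly (ps k) (gs k z) = fs k z * poly (qs k) (gs k z)"
    and conv: "\<And>z. z \<in> X \<Longrightarrow> (\<lambda>k. fs k z) \<longlonglongrightarrow> f z"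
  shows "\<exists>s. strict_mono (s :: nat \<Rightarrow> nat) \<and> (\<forall>j. (\<lambda>k. coeff (ps (s k)) j) \<longlonglongrightarrow> coeff p j)
      \<and> (\<forall>j. (\<lambda>k. coeff (qs (s k)) j) \<longlonglongrightarrow> coeff q j)
      \<and> (\<forall>K. compact K \<longrightarrow> K \<subseteq> X \<longrightarrow> uniform_limit K (\<lambda>k. gs (s k)) g sequentially)"
proof -
  have n0: "n > 0" using nf by (auto simp: normal_form_def)
  define C where "C = exterior_const"
  have C: "C > 0" by (simp add: C_def exterior_const_pos)
  have C': "cmod z = 8 * R \<Longrightarrow> cmod (gs k z) \<le> C * R"
    "y \<notin> sublevel (ps k) (qs k) 1 \<Longrightarrow> cmod y \<le> 2 * C * R"
    "z \<in> Xs k \<Longrightarrow> cmod z \<le> R \<Longrightarrow> cmod (gs k z) \<le> 2 * C * R" if "r \<le> R" for k R z y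
    using uniformizer_bounds[OF nfk[of k] gmk[of k], of R] Xk that X(3) unfolding C_def by auto
  define M where "M = 2 * C * r"
  have M0: "M > 0" using C X(3) by (simp add: M_def)
  have omit: "cmod y \<le> M" if "y \<notin> sublevel (ps k) (qs k) 1" for k y
    using C'(2)[OF order_refl] that by (simp add: M_def)
  \<comment> \<open>All roots have modulus at most \<open>M\<close>, so each linear factor is at
    most 1 + 2 M on |z| <= 1 + M.\<close>
  define B where "B = (1 + M + M) ^ n"
  have qb: "cmod (poly (qs k) z) \<le> B" if z: "cmod z \<le> 1 + M" for k z
  proof -
    define A where "A = {a. poly (qs k) a = 0}"
    have rs: "rsquarefree (qs k)" "lead_coeff (qs k) = 1" "degree (qs k) = n" using nfk[of k] by (auto simp: normal_form_def)
    have cA: "card A = n" using card_roots_rsquarefree[OF rs(1)] rs(3) by (simp add: A_def)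
    have "poly (qs k) z = (\<Prod>a\<in>A. z - a)"
      by (subst monic_eq_prod_roots[OF rs(1,2)]) (simp add: poly_prod A_def)
    hence "cmod (poly (qs k) z) = (\<Prod>a\<in>A. cmod (z - a))" by (simp add: prod_norm)
    also have "\<dots> \<le> (\<Prod>a\<in>A. 1 + M + M)"
    proof (rule prod_mono, intro conjI norm_ge_zero)
      fix a assume "a \<in> A"
      hence "a \<notin> sublevel (ps k) (qs k) 1" by (auto simp: A_def sublevel_def)
      thus "cmod (z - a) \<le> 1 + M + M" using omit[of a k] z norm_triangle_ineq4[of z a] by linarith
    qed
    also have "\<dots> = B" by (simp add: B_def cA)
    finally show ?thesis .
  qed
  \<comment> \<open>The circle |w| = 1 + M lies in the sublevel set, where |p| < |q|; the maximum
    principle carries the bound for \<open>q\<close> there to \<open>p\<close> on the unit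
    circle.\<close>
  have pb: "cmod (poly (ps k) z) \<le> B" if z: "cmod z = 1" for k z
  proof (rule max_modulus_disc[of "poly (ps k)" "1 + M"])
    show "poly (ps k) holomorphic_on UNIV" by (intro holomorphic_intros)
    show "cmod z \<le> 1 + M" using z M0 by simp
    fix w assume w: "cmod w = 1 + M"
    have "w \<in> sublevel (ps k) (qs k) 1" using omit[of w k] w by fastforce
    thus "cmod (poly (ps k) w) \<le> B" using qb[of w k] w by (simp add: sublevel_def)
  qed
  have degk: "degree (ps k) \<le> n" "degree (qs k) \<le> n" for k using nfk[of k] by (auto simp: normal_form_def)
  have cpb: "cmod (coeff (ps k) j) \<le> 2 ^ j * B" for k j by (rule cmod_coeff_le) (rule pb)
  have cqb: "cmod (coeff (qs k) j) \<le> 2 ^ j * B" for k j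
    by (rule cmod_coeff_le, rule qb) (use M0 in auto)
  obtain s1 p' where s1: "strict_mono (s1 :: nat \<Rightarrow> nat)" "degree p' \<le> n" "\<And>j. (\<lambda>k. coeff (ps (s1 k)) j) \<longlonglongrightarrow> coeff p' j"
    by (rule bounded_coeffs_convergent_subsequence[of ps n, OF degk(1) cpb]) (rule that, auto)
  obtain s2 q' where s2: "strict_mono (s2 :: nat \<Rightarrow> nat)" "degree q' \<le> n" "\<And>j. (\<lambda>k. coeff (qs (s1 (s2 k))) j) \<longlonglongrightarrow> coeff q' j"
    by (rule bounded_coeffs_convergent_subsequence[of "\<lambda>k. qs (s1 k)" n, OF degk(2) cqb]) (rule that, auto)
  define s12 where "s12 = s1 \<circ> s2"
  have s12: "strict_mono s12" unfolding s12_def using s1(1) s2(1) by (rule strict_mono_o)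
  have ker12: "eventually (\<lambda>k. K \<subseteq> Xs (s12 k)) sequentially" if "compact K" "K \<subseteq> X" for K
    by (rule eventually_subseq[OF s12 ker[OF that]])
  have holk: "gs k holomorphic_on Xs k" "inj_on (gs k) (Xs k)" "((\<lambda>z. gs k z / z) \<longlongrightarrow> 1) at_infinity" for k
    using gmk[of k] by (auto simp: uniformizes_def)
  have bd: "\<exists>B. \<forall>k. \<forall>z\<in>Xs (s12 k). cmod z \<le> R \<longrightarrow> cmod (gs (s12 k) z) \<le> B" for R
  proof (intro exI[of _ "2 * C * max r R"] allI ballI impI)
    fix k z assume "z \<in> Xs (s12 k)" "cmod z \<le> R"
    thus "cmod (gs (s12 k) z) \<le> 2 * C * max r R" using C'(3)[of "max r R" z "s12 k"] by simp
  qed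
  obtain s3 h where s3: "strict_mono (s3 :: nat \<Rightarrow> nat)" and h: "h holomorphic_on X"
    and ul: "\<And>K. compact K \<Longrightarrow> K \<subseteq> X \<Longrightarrow> uniform_limit K (\<lambda>k. gs (s12 (s3 k))) h sequentially"
    by (rule diagonal_Montel[of X "\<lambda>k. Xs (s12 k)" "\<lambda>k. gs (s12 k)", OF X(1) _ holk(1) bd])
      (rule ker12, assumption, assumption, rule that, auto)
  define s where "s = s12 \<circ> s3"
  have s: "strict_mono s" unfolding s_def using s12 s3 by (rule strict_mono_o)
  have ul: "uniform_limit K (\<lambda>k. gs (s k)) h sequentially" if "compact K" "K \<subseteq> X" for K
    using ul[OF that] by (simp add: s_def)
  have kers: "eventually (\<lambda>k. K \<subseteq> Xs (s k)) sequentially" if "compact K" "K \<subseteq> X" for K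
    by (rule eventually_subseq[OF s ker[OF that]])
  have pconv: "(\<lambda>k. coeff (ps (s k)) j) \<longlonglongrightarrow> coeff p' j" for j
    using LIMSEQ_subseq_LIMSEQ[OF s1(3)[of j] strict_mono_o[OF s2(1) s3]] by (simp add: s_def s12_def o_def)
  have qconv: "(\<lambda>k. coeff (qs (s k)) j) \<longlonglongrightarrow> coeff q' j" for j
    using LIMSEQ_subseq_LIMSEQ[OF s2(3)[of j] s3] by (simp add: s_def s12_def o_def)
  have glim: "(\<lambda>k. gs (s k) z) \<longlonglongrightarrow> h z" if "z \<in> X" for z
    using tendsto_uniform_limitI[OF ul[of "{z}"], of z] that by simp
  have cq: "coeff (qs k) n = 1" "coeff (qs k) (n - 1) = 0" "coeff (ps k) n = 0" for k
  proof -
    have *: "degree (qs k) = n" "lead_coeff (qs k) = 1" "rsquarefree (qs k)" "\<Sum>{a. poly (qs k) a = 0} = 0" "degree (ps k) < n"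
      using nfk[of k] by (auto simp: normal_form_def)
    show "coeff (qs k) n = 1" using *(1,2) by simp
    show "coeff (qs k) (n - 1) = 0" using coeff_eq_sum_roots[OF *(3,2)] *(1,4) n0 by simp
    show "coeff (ps k) n = 0" using *(5) by (rule coeff_eq_0)
  qed
  have cq': "coeff q' n = 1" "coeff q' (n - 1) = 0" "coeff p' n = 0"
    using qconv[of n] qconv[of "n - 1"] pconv[of n] unfolding cq LIMSEQ_const_iff by simp_all
  have degq': "degree q' = n" using s2(2) cq'(1) by (metis le_antisym le_degree zero_neq_one)
  have lcq': "lead_coeff q' = 1" using degq' cq'(1) by simp
  have degp': "degree p' < n"
  proof (rule ccontr)
    assume "\<not> degree p' < n"
    hence "degree p' = n" using s1(2) by simp
    hence "lead_coeff p' = 0" using cq'(3) by simp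
    thus False using \<open>degree p' = n\<close> n0 by auto
  qed
  \<comment> \<open>Locally uniform convergence does not transmit tangency at infinity to
    \<open>h\<close>. A bound on \<open>gs k z - z\<close> independent of both \<open>k\<close> and
    \<open>z\<close> does.\<close>
  have near: "cmod (h z - z) \<le> C * r + 8 * r" if z: "8 * r \<le> cmod z" for z
  proof -
    have zX: "z \<in> X" using X(3,4) z by simp
    have "cmod (gs k z - z) \<le> C * r + 8 * r" for k
    proof (rule maximum_modulus_exterior[of "\<lambda>z. gs k z - z" r "8 * r", OF _ _ X(3) _ _ z])
      show "(\<lambda>z. gs k z - z) holomorphic_on {z. r < cmod z}"
        by (intro holomorphic_intros holomorphic_on_subset[OF holk(1)]) (use Xk in auto)
      have "((\<lambda>z. gs k z / z - 1) \<longlongrightarrow> 1 - 1) at_infinity" by (intro tendsto_diff holk tendsto_const)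
      moreover have "\<forall>\<^sub>F z in at_infinity. gs k z / z - 1 = (gs k z - z) / z"
        unfolding eventually_at_infinity by (intro exI[of _ 1]) (auto simp: diff_divide_distrib)
      ultimately show "((\<lambda>z. (gs k z - z) / z) \<longlongrightarrow> 0) at_infinity"
        using Lim_transform_eventually by force
      show "r < 8 * r" using X(3) by simp
      fix w assume w: "cmod w = 8 * r"
      have "cmod (gs k w) \<le> C * r" using C'(1)[OF order_refl] w by simp
      thus "cmod (gs k w - w) \<le> C * r + 8 * r" using norm_triangle_ineq4[of "gs k w" w] w by simp
    qed
    hence "\<forall>k. cmod (gs (s k) z - z) \<le> C * r + 8 * r" by blast
    moreover have "(\<lambda>k. cmod (gs (s k) z - z)) \<longlonglongrightarrow> cmod (h z - z)" by (intro tendsto_intros glim zX)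
    ultimately show ?thesis using LIMSEQ_le_const2 by blast
  qed
  have hlim: "((\<lambda>z. h z / z) \<longlongrightarrow> 1) at_infinity"
  proof -
    define E where "E = C * r + 8 * r"
    have E: "0 \<le> E" using C X(3) by (simp add: E_def)
    have "((\<lambda>z. h z / z - 1) \<longlongrightarrow> 0) at_infinity"
    proof (rule Lim_null_comparison)
      show "\<forall>\<^sub>F z in at_infinity. norm (h z / z - 1) \<le> cmod (of_real E / z)"
        unfolding eventually_at_infinity
      proof (intro exI[of _ "8 * r"] allI impI)
        fix z :: complex assume z: "8 * r \<le> cmod z"
        have z0: "z \<noteq> 0" using z X(3) by auto
        have "h z / z - 1 = (h z - z) / z" using z0 by (simp add: diff_divide_distrib)
        hence "norm (h z / z - 1) = cmod (h z - z) / cmod z" by (simp add: norm_divide)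
        also have "\<dots> \<le> E / cmod z" using near[OF z] unfolding E_def by (intro divide_right_mono) auto
        also have "\<dots> = cmod (of_real E / z)" using E by (simp add: norm_divide)
        finally show "norm (h z / z - 1) \<le> cmod (of_real E / z)" .
      qed
      have "((\<lambda>z::complex. of_real E / z) \<longlongrightarrow> 0) at_infinity"
        by (intro tendsto_divide_0[OF tendsto_const] filterlim_ident)
      thus "((\<lambda>z::complex. cmod (of_real E / z)) \<longlongrightarrow> 0) at_infinity"
        by (rule tendsto_norm_zero)
    qed
    thus ?thesis using LIM_zero_iff by blast
  qed
  have hnc: "\<not> h constant_on X"
  proof
    assume "h constant_on X"
    then obtain c where c: "\<And>z. z \<in> X \<Longrightarrow> h z = c" by (auto simp: constant_on_def)
    have "((\<lambda>z. c / z) \<longlongrightarrow> 0) at_infinity" by (intro tendsto_divide_0[OF tendsto_const] filterlim_ident)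
    moreover have "\<forall>\<^sub>F z in at_infinity. c / z = h z / z"
      unfolding eventually_at_infinity using c X(4) by auto
    ultimately have "((\<lambda>z. h z / z) \<longlongrightarrow> 0) at_infinity" by (rule Lim_transform_eventually)
    from tendsto_unique[OF trivial_limit_at_infinity this hlim] show False by simp
  qed
  have hinj: "inj_on h X"
    by (rule Hurwitz_injective_exhausting[of X "\<lambda>k. Xs (s k)" "\<lambda>k. gs (s k)", OF X(1,2) kers holk(1) holk(2) ul h hnc])
  have hf: "poly p' (h z) = f z * poly q' (h z)" if z: "z \<in> X" for z
  proof -
    have 1: "(\<lambda>k. poly (ps (s k)) (gs (s k) z)) \<longlonglongrightarrow> poly p' (h z)"
      by (rule tendsto_poly_coeffs[OF degk(1) s1(2) pconv glim[OF z]])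
    have 2: "(\<lambda>k. poly (qs (s k)) (gs (s k) z)) \<longlonglongrightarrow> poly q' (h z)"
      by (rule tendsto_poly_coeffs[OF degk(2) s2(2) qconv glim[OF z]])
    have "(\<lambda>k. fs (s k) z) \<longlonglongrightarrow> f z" using LIMSEQ_subseq_LIMSEQ[OF conv[OF z] s] by (simp add: o_def)
    from tendsto_mult[OF this 2]
    have 3: "(\<lambda>k. fs (s k) z * poly (qs (s k)) (gs (s k) z)) \<longlonglongrightarrow> f z * poly q' (h z)" .
    have "eventually (\<lambda>k. {z} \<subseteq> Xs (s k)) sequentially" by (rule kers) (use z in auto)
    hence "eventually (\<lambda>k. fs (s k) z * poly (qs (s k)) (gs (s k) z) = poly (ps (s k)) (gs (s k) z)) sequentially"
      by eventually_elim (simp add: fk)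
    from Lim_transform_eventually[OF 3 this] 1 show ?thesis using LIMSEQ_unique by blast
  qed
  note u = normal_form_unique[OF nf gm c(1) c(2) c(3) c(4) X(1,2,3,4) h hinj hlim degp' degq' lcq' cq'(2) f hf]
  have p': "p' = p" by (rule u(1))
  have q': "q' = q" by (rule u(2))
  have hg: "h z = g z" if "z \<in> X" for z by (rule u(3)) (use that in auto)
  have "uniform_limit K (\<lambda>k. gs (s k)) g sequentially" if K: "compact K" "K \<subseteq> X" for K
  proof -
    have "h z = g z" if "z \<in> K" for z using hg K(2) that by blast
    thus ?thesis using uniform_limit_cong'[of K "\<lambda>k. gs (s k)" "\<lambda>k. gs (s k)" h g sequentially] ul[OF K] by simp
  qed
  thus ?thesis using s pconv qconv unfolding p' q' by blast
qed

section \<open>Monic denominators and conclusion\<close>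

definition monic_scale :: "complex poly \<Rightarrow> complex poly \<Rightarrow> complex poly" where
  "monic_scale Q R = smult (inverse (lead_coeff Q)) R"

lemma monic_scale_normal_form:
  assumes good: "normalized_good n P Q" and n: "n > 0"
  shows "normal_form n (monic_scale Q P) (monic_scale Q Q)" "degree P < degree Q"
    "ratR (monic_scale Q P) (monic_scale Q Q) = ratR P Q"
    "level (monic_scale Q P) (monic_scale Q Q) 1 = level P Q 1"
    "sublevel (monic_scale Q P) (monic_scale Q Q) 1 = sublevel P Q 1"
proof -
  have P: "Q \<noteq> 0" "coprime P Q" "max (degree P) (degree Q) = n" "ratR P Q None = Some 0"
    "\<And>z. poly Q z = 0 \<Longrightarrow> order z Q = 1" "\<Sum>{z. poly Q z = 0} = 0"
    using good by (auto simp: normalized_good_def n_good_def rat_map_def)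
  show deg: "degree P < degree Q"
  proof (rule ccontr)
    assume "\<not> degree P < degree Q"
    hence e: "degree P = degree Q" "coeff P (degree Q) = 0"
      using P(1,4) by (auto simp: ratR_def split: if_splits)
    hence "P = 0" by (metis leading_coeff_0_iff)
    thus False using P(3) e(1) n by simp
  qed
  define t where "t = inverse (lead_coeff Q)"
  have t: "t \<noteq> 0" using P(1) by (simp add: t_def)
  have m: "monic_scale Q R = smult t R" for R by (simp add: monic_scale_def t_def)
  have "coprime (smult t P) (smult t Q)"
    by (rule coprime_if_no_common_root) (use t P(1) coprime_poly_0[OF P(2)] in auto)
  moreover have "rsquarefree (smult t Q)"
    unfolding rsquarefree_def
  proof (intro conjI allI)
    show "smult t Q \<noteq> 0" using t P(1) by simp
    fix a
    show "order a (smult t Q) = 0 \<or> order a (smult t Q) = 1"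
      using P(5)[of a] t by (cases "poly Q a = 0") (auto simp: order_smult order_0I)
  qed
  moreover have "{a. poly (smult t Q) a = 0} = {a. poly Q a = 0}" using t by auto
  ultimately show "normal_form n (monic_scale Q P) (monic_scale Q Q)"
    unfolding normal_form_def m using deg P(3,6) t P(1) by (auto simp: t_def)
  show "ratR (monic_scale Q P) (monic_scale Q Q) = ratR P Q"
    unfolding m by (rule ext) (use t in \<open>auto simp: ratR_def split: option.splits\<close>)
  show "level (monic_scale Q P) (monic_scale Q Q) 1 = level P Q 1"
    "sublevel (monic_scale Q P) (monic_scale Q Q) 1 = sublevel P Q 1"
    unfolding m level_def sublevel_def using t by (auto simp: norm_mult)
qed

lemma tangent_biholo_uniformizes:
  assumes "tangent_biholo X g P Q" and deg: "degree P < degree Q"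
    and sub: "sublevel p q 1 = sublevel P Q 1"
  shows "uniformizes X g p q"
proof -
  have b: "bij_betw (ext_map g) (hat X) (hat (sublevel P Q 1))"
    using assms(1) rat_pre_disc_eq[OF deg] by (simp add: tangent_biholo_def)
  have "inj_on g X"
  proof (rule inj_onI)
    fix x y assume xy: "x \<in> X" "y \<in> X" "g x = g y"
    have "Some x = Some y"
      by (rule inj_onD[OF bij_betw_imp_inj_on[OF b]]) (use xy in \<open>auto simp: ext_map_def hat_def\<close>)
    thus "x = y" by simp
  qed
  moreover have "g ` X = sublevel P Q 1"
  proof -
    have im: "ext_map g ` hat X = hat (sublevel P Q 1)" using b by (rule bij_betw_imp_surj_on)
    have e: "ext_map g ` hat X = hat (g ` X)" by (auto simp: ext_map_def hat_def image_image)
    have "hat A = hat B \<Longrightarrow> A = B" for A B :: "complex set" by (auto simp: hat_def)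
    thus ?thesis using im e by simp
  qed
  ultimately show ?thesis using assms(1) sub by (simp add: uniformizes_def tangent_biholo_def)
qed

lemma factors_poly:
  assumes "factors X f P Q g" "ratR p q = ratR P Q" "z \<in> X"
  shows "poly p (g z) = f z * poly q (g z)"
proof -
  have "Some z \<in> hat X" using assms(3) by (simp add: hat_def)
  hence "ratR p q (ext_map g (Some z)) = Some (ext_fun f 0 (Some z))"
    using assms(1,2) unfolding factors_def by simp
  hence "poly q (g z) \<noteq> 0" "poly p (g z) / poly q (g z) = f z"
    by (auto simp: ratR_def ext_map_def ext_fun_def split: if_splits)
  thus ?thesis by (metis nonzero_divide_eq_eq)
qed

theorem mainTheorem5:
  fixes n :: nat
    and Xs :: "nat \<Rightarrow> complex set" and X :: "complex set"
    and fs gs :: "nat \<Rightarrow> complex \<Rightarrow> complex" and f g :: "complex \<Rightarrow> complex"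
    and Ps Qs :: "nat \<Rightarrow> complex poly" and P Q :: "complex poly"
  assumes "\<forall>k. nondeg_nconn_domain n (Xs k)"
    and "nondeg_nconn_domain n X"
    and "cara_conv Xs X"
    and "\<forall>k. grunsky n (Xs k) (fs k)"
    and "grunsky n X f"
    and "loc_unif X fs f"
    and "normalized_good n P Q"
    and "\<forall>k. normalized_good n (Ps k) (Qs k)"
    and "tangent_biholo X g P Q"
    and "\<forall>k. tangent_biholo (Xs k) (gs k) (Ps k) (Qs k)"
    and "factors X f P Q g"
    and "\<forall>k. factors (Xs k) (fs k) (Ps k) (Qs k) (gs k)"
  shows "loc_unif_sph X gs g
       \<and> uniform_limit UNIV (\<lambda>k p. sp (ratR (Ps k) (Qs k) p)) (\<lambda>p. sp (ratR P Q p)) sequentially"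
proof -
  have dom: "domain_inf X" using assms(2) by (simp add: nondeg_nconn_domain_def)
  obtain r where X: "r > 0" "\<And>z. r \<le> cmod z \<Longrightarrow> z \<in> X" "open X" "connected X"
    by (rule domain_infD[OF dom]) (rule that, auto)
  \<comment> \<open>In degree 0 the rational map would be constantly 0, so \<open>f\<close> would
    vanish on the unbounded set \<open>X\<close>, against the finiteness of its fibres.\<close>
  have n0: "n > 0"
  proof (rule ccontr)
    assume "\<not> n > 0"
    hence d: "degree P = 0" "degree Q = 0" "Q \<noteq> 0" "ratR P Q None = Some 0"
      using assms(7) by (auto simp: normalized_good_def n_good_def rat_map_def)
    have "coeff Q 0 \<noteq> 0" using d(2,3) leading_coeff_0_iff by metis
    hence "coeff P 0 = 0" using d by (auto simp: ratR_def split: if_splits)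
    hence P0: "P = 0" using d(1) leading_coeff_0_iff by metis
    obtain a where "Q = [:a:]" using degree_eq_zeroE d(2) by blast
    hence Q0: "poly Q z \<noteq> 0" for z using d(3) by simp
    have "f z = 0" if "z \<in> X" for z
      using factors_poly[OF assms(11) refl that] Q0[of "g z"] P0 by simp
    hence "{z \<in> X. f z = 0} = X" by blast
    moreover have "finite {z \<in> X. f z = 0}" using assms(5) by (auto simp: grunsky_def)
    moreover have "\<not> bounded X" by (rule not_bounded_if_exterior_subset[of r]) (rule X(2))
    ultimately show False using finite_imp_bounded by metis
  qed
  define p q where "p = monic_scale Q P" "q = monic_scale Q Q"
  define ps qs where "ps = (\<lambda>k. monic_scale (Qs k) (Ps k))" "qs = (\<lambda>k. monic_scale (Qs k) (Qs k))"
  note nrm = monic_scale_normal_form[OF assms(7) n0, folded p_q_def]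
  have nrmk: "normal_form n (ps k) (qs k)" "degree (Ps k) < degree (Qs k)" "ratR (ps k) (qs k) = ratR (Ps k) (Qs k)"
    "sublevel (ps k) (qs k) 1 = sublevel (Ps k) (Qs k) 1" for k
    using monic_scale_normal_form[OF assms(8)[rule_format] n0, of k] by (simp_all add: ps_qs_def)
  have gm: "uniformizes X g p q" by (rule tangent_biholo_uniformizes[OF assms(9) nrm(2,5)])
  have gmk: "uniformizes (Xs k) (gs k) (ps k) (qs k)" for k
    by (rule tangent_biholo_uniformizes[OF assms(10)[rule_format] nrmk(2,4)])
  have good: "n_good n P Q" using assms(7) by (simp add: normalized_good_def)
  obtain c where c: "\<And>i. i < n \<Longrightarrow> continuous_on (sphere 0 1) (c i)"
    "\<And>i. i < n \<Longrightarrow> inj_on (c i) (sphere 0 1)"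
    "\<And>i j. i < n \<Longrightarrow> j < n \<Longrightarrow> i \<noteq> j \<Longrightarrow> c i ` sphere 0 1 \<inter> c j ` sphere 0 1 = {}"
    "level P Q 1 = (\<Union>i<n. c i ` sphere (0::complex) 1)"
    by (rule n_good_level[OF good nrm(2)]) (rule that, auto)
  have kc: "kernel_cond Xs X"
    using assms(3) unfolding cara_conv_def is_kernel_def by (auto simp: strict_mono_def o_def dest!: spec[of _ "\<lambda>k. k"])
  have ker: "eventually (\<lambda>k. K \<subseteq> Xs k) sequentially" if K: "compact K" "K \<subseteq> X" for K
  proof -
    have "sp ` Some ` K \<subseteq> sp ` hat X" using K(2) by (auto simp: hat_def)
    hence "eventually (\<lambda>k. sp ` Some ` K \<subseteq> sp ` hat (Xs k)) sequentially"
      using kc compact_sp_image[OF K(1)] unfolding kernel_cond_def by blast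
    thus ?thesis
    proof eventually_elim
      case (elim k)
      show ?case
      proof
        fix z assume "z \<in> K"
        hence "sp (Some z) \<in> sp ` hat (Xs k)" using elim by blast
        thus "z \<in> Xs k" by (simp add: sp_in_hat)
      qed
    qed
  qed
  \<comment> \<open>The closed exterior with infinity is compact on the sphere, so the kernel
    condition places it in every \<open>Xs k\<close> with k >= N. This is the common radius on which
    all estimates rest.\<close>
  have "hat {z. r \<le> cmod z} \<subseteq> hat X" using X(2) by (auto simp: hat_def)
  hence "eventually (\<lambda>k. sp ` hat {z. r \<le> cmod z} \<subseteq> sp ` hat (Xs k)) sequentially"
    using kc compact_sp_exterior[OF X(1)] unfolding kernel_cond_def by (meson image_mono)
  then obtain N where N: "\<And>k. N \<le> k \<Longrightarrow> sp ` hat {z. r \<le> cmod z} \<subseteq> sp ` hat (Xs k)"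
    unfolding eventually_sequentially by blast
  have ext: "z \<in> Xs k" if "N \<le> k" "r \<le> cmod z" for k z
  proof -
    have "sp (Some z) \<in> sp ` hat {z. r \<le> cmod z}" using that(2) by (simp add: sp_in_hat)
    hence "sp (Some z) \<in> sp ` hat (Xs k)" using N[OF that(1)] by blast
    thus ?thesis by (simp add: sp_in_hat)
  qed
  have fconv: "(\<lambda>k. fs k z) \<longlonglongrightarrow> f z" if z: "z \<in> X" for z
  proof -
    have "compact {sp (Some z)}" "{sp (Some z)} \<subseteq> sp ` hat X" using z by (auto simp: hat_def)
    hence "uniform_limit {w \<in> X. sp (Some w) \<in> {sp (Some z)}} fs f sequentially"
      using assms(6) unfolding loc_unif_def by blast
    thus ?thesis by (rule tendsto_uniform_limitI) (use z in simp)
  qed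
  have key: "\<exists>s. strict_mono (s :: nat \<Rightarrow> nat) \<and> (\<forall>K. compact K \<and> K \<subseteq> sp ` hat X \<longrightarrow>
        uniform_limit (hat X \<inter> sp -` K) (\<lambda>k x. sp (ext_map (gs (u (s k))) x)) (\<lambda>x. sp (ext_map g x)) sequentially)
      \<and> uniform_limit UNIV (\<lambda>k x. sp (ratR (Ps (u (s k))) (Qs (u (s k))) x)) (\<lambda>x. sp (ratR P Q x)) sequentially"
    if u: "strict_mono (u :: nat \<Rightarrow> nat)" for u
  proof -
    \<comment> \<open>Dropping \<open>N\<close> terms makes the common radius valid for every
      member; as a subsequence of \<open>u\<close> the result is indexed by
      \<open>s k + N\<close>.\<close>
    define v where "v k = u (k + N)" for k
    have v: "strict_mono v" using u by (simp add: v_def strict_mono_def)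
    have vN: "N \<le> v k" for k using seq_suble[OF u, of "k + N"] by (simp add: v_def)
    have "\<exists>s. strict_mono (s :: nat \<Rightarrow> nat) \<and> (\<forall>j. (\<lambda>k. coeff (ps (v (s k))) j) \<longlonglongrightarrow> coeff p j)
      \<and> (\<forall>j. (\<lambda>k. coeff (qs (v (s k))) j) \<longlonglongrightarrow> coeff q j)
      \<and> (\<forall>K. compact K \<longrightarrow> K \<subseteq> X \<longrightarrow> uniform_limit K (\<lambda>k. gs (v (s k))) g sequentially)"
    proof (rule convergent_subsequence[of n p q X g c r "\<lambda>k. ps (v k)" "\<lambda>k. qs (v k)" "\<lambda>k. Xs (v k)" "\<lambda>k. gs (v k)" f "\<lambda>k. fs (v k)"])
      show "level p q 1 = (\<Union>i<n. c i ` sphere 0 1)" using nrm(4) c(4) by simp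
      show "eventually (\<lambda>k. K \<subseteq> Xs (v k)) sequentially" if "compact K" "K \<subseteq> X" for K
        by (rule eventually_subseq[OF v ker[OF that]])
      show "poly p (g z) = f z * poly q (g z)" if "z \<in> X" for z by (rule factors_poly[OF assms(11) nrm(3) that])
      show "poly (ps (v k)) (gs (v k) z) = fs (v k) z * poly (qs (v k)) (gs (v k) z)" if "z \<in> Xs (v k)" for k z
        by (rule factors_poly[OF assms(12)[rule_format] nrmk(3) that])
      show "(\<lambda>k. fs (v k) z) \<longlonglongrightarrow> f z" if "z \<in> X" for z
        using LIMSEQ_subseq_LIMSEQ[OF fconv[OF that] v] by (simp add: o_def)
      show "z \<in> Xs (v k)" if "r \<le> cmod z" for k z by (rule ext[OF vN that])
    qed (fact nrm(1), fact gm, fact c(1), fact c(2), fact c(3), fact X(3), fact X(4), fact X(1), fact X(2),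
        fact nrmk(1), fact gmk)
    then obtain s where s: "strict_mono (s :: nat \<Rightarrow> nat)"
      "\<And>j. (\<lambda>k. coeff (ps (v (s k))) j) \<longlonglongrightarrow> coeff p j" "\<And>j. (\<lambda>k. coeff (qs (v (s k))) j) \<longlonglongrightarrow> coeff q j"
      "\<And>K. compact K \<Longrightarrow> K \<subseteq> X \<Longrightarrow> uniform_limit K (\<lambda>k. gs (v (s k))) g sequentially"
      by blast
    have "uniform_limit (hat X \<inter> sp -` K) (\<lambda>k x. sp (ext_map (gs (v (s k))) x)) (\<lambda>x. sp (ext_map g x)) sequentially"
      if K: "compact K" "K \<subseteq> sp ` hat X" for K
    proof (rule loc_unif_sph_from_compacts[OF X(2,1) _ _ _ _ s(4) K])
      show "gs (v (s k)) holomorphic_on {z. r < cmod z}" for k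
        by (rule holomorphic_on_subset[of _ "Xs (v (s k))"]) (use gmk ext[OF vN] in \<open>auto simp: uniformizes_def\<close>)
      show "((\<lambda>z. gs (v (s k)) z / z) \<longlongrightarrow> 1) at_infinity" for k using gmk by (simp add: uniformizes_def)
      show "g holomorphic_on {z. r < cmod z}"
        by (rule holomorphic_on_subset[of _ X]) (use gm X(2) in \<open>auto simp: uniformizes_def\<close>)
      show "((\<lambda>z. g z / z) \<longlongrightarrow> 1) at_infinity" using gm by (simp add: uniformizes_def)
    qed
    moreover have "uniform_limit UNIV (\<lambda>k x. sp (ratR (Ps (v (s k))) (Qs (v (s k))) x)) (\<lambda>x. sp (ratR P Q x)) sequentially"
      using uniform_limit_ratR[OF nrmk(1) nrm(1) s(2,3)] by (simp add: nrm(3) nrmk(3))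
    moreover have "strict_mono (\<lambda>k. s k + N)" using s(1) by (simp add: strict_mono_def)
    ultimately show ?thesis unfolding v_def by blast
  qed
  have "uniform_limit (hat X \<inter> sp -` K) (\<lambda>k x. sp (ext_map (gs k) x)) (\<lambda>x. sp (ext_map g x)) sequentially"
    if K: "compact K" "K \<subseteq> sp ` hat X" for K
    by (rule uniform_limit_subseq_principle) (use key K in blast)
  moreover have "uniform_limit UNIV (\<lambda>k x. sp (ratR (Ps k) (Qs k) x)) (\<lambda>x. sp (ratR P Q x)) sequentially"
    by (rule uniform_limit_subseq_principle) (use key in blast)
  ultimately show ?thesis unfolding loc_unif_sph_def by blast
qed

end
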